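(* Let $m_0\in\mathcal{P}[0,1]$. (1) There is a unique solution $m=(m(t),\,t\in\mathbb{R}_+)$ to Problem 1 starting at $m_0$. For the total variation norm on $\mathcal{P}[0,1]$, $t\mapsto m(t)$ is continuous, and $m_0\mapsto(m(t),\,t\in\mathbb{R}_+)$ is continuous for uniform convergence on bounded time sets. (2) There is a unique law $Q=\mathcal{L}(\widehat X)$ on $D(\mathbb{R}_+,[0,1])$ for an inhomogeneous Markov process $\widehat X=(\widehat X(t),\,t\in\mathbb{R}_+)$ with generator $\mathcal{A}(m(t))$ at time $t$ and initial law $\mathcal{L}(\widehat X(0))=m_0$. Its marginal $Q_t=\mathcal{L}(\widehat X(t))$ is given by $m(t)$.
   Context: Fix $\Delta\in(0,1]$ and $w\in(0,1)$. $\mathcal{P}[0,1]$ is the set of Borel probability measures on $[0,1]$. For $\mu\in\mathcal{P}[0,1]$ the bounded operator $\mathcal{A}(\mu)$ acts on bounded measurable $h:[0,1]\to\mathbb{R}$ by $$\mathcal{A}(\mu)h(x)=2\int_{[0,1]}[h(wx+(1-w)y)-h(x)]\,1_{\{|x-y|\le\Delta\}}\,\mu(dy).$$ Problem 1: a family $m=(m(t),\,t\in\mathbb{R}_+)$ with $m(t)\in\mathcal{P}[0,1]$ is a solution to Problem 1 with initial value $m_0$ if $m(0)=m_0$ and, for all bounded measurable $h:[0,1]\to\mathbb{R}$ and all $t\ge0$, with $\langle h,\mu\rangle=\int h\,d\mu$, $$\langle h,m(t)\rangle-\langle h,m(0)\rangle=\int_0^t\langle\mathcal{A}(m(s))h,m(s)\rangle\,ds.$$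 The distance in total variation norm is $|\mu-\mu'|=\sup_{\|\phi\|_\infty\le1}\langle\phi,\mu-\mu'\rangle$ (measurable $\phi$). $D(\mathbb{R}_+,[0,1])$ is the Skorohod space of right-continuous paths with left-hand limits from $\mathbb{R}_+$ to $[0,1]$, with the product $\sigma$-field. *)

theory Defs
  imports "HOL-Probability.Probability"
begin

(* Time is indexed by real, and only nonnegative times are ever constrained.  Likewise functions
   on [0,1] are functions on real of which only the values on {0..1} matter.  The set P[0,1] is
   "space (prob_algebra unit_borel)". *)

abbreviation unit_borel :: "real measure" where
  "unit_borel \<equiv> restrict_space borel {0..1}"

definition bdd_meas :: "(real \<Rightarrow> real) set" where
  "bdd_meas = {h \<in> borel_measurable unit_borel. bounded (h ` {0..1})}"

definition gen :: "real \<Rightarrow> real \<Rightarrow> real measure \<Rightarrow> (real \<Rightarrow> real) \<Rightarrow> real \<Rightarrow> real" where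
  "gen \<Delta> w \<mu> h x =
     2 * (\<integral>y. (h (w * x + (1 - w) * y) - h x) * indicator {y. \<bar>x - y\<bar> \<le> \<Delta>} y \<partial>\<mu>)"

(* Integrability in time is required explicitly: the library integral of a non-integrable function
   is 0, whereas writing the equation in Problem 1 presupposes that the integral exists. *)
definition problem1 ::
  "real \<Rightarrow> real \<Rightarrow> real measure \<Rightarrow> (real \<Rightarrow> real measure) \<Rightarrow> bool" where
  "problem1 \<Delta> w m0 m \<longleftrightarrow>
     (\<forall>t\<ge>0. m t \<in> space (prob_algebra unit_borel)) \<and>
     m 0 = m0 \<and>
     (\<forall>h\<in>bdd_meas. \<forall>t\<ge>0.
        set_integrable lborel {0..t} (\<lambda>s. \<integral>x. gen \<Delta> w (m s) h x \<partial>m s) \<and>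
        (\<integral>x. h x \<partial>m t) - (\<integral>x. h x \<partial>m 0) =
          (LINT s:{0..t}|lborel. (\<integral>x. gen \<Delta> w (m s) h x \<partial>m s)))"

definition tv_dist :: "real measure \<Rightarrow> real measure \<Rightarrow> real" where
  "tv_dist \<mu> \<nu> =
     (SUP \<phi>\<in>{\<phi> \<in> borel_measurable unit_borel. \<forall>x\<in>{0..1}. \<bar>\<phi> x\<bar> \<le> 1}.
        (\<integral>x. \<phi> x \<partial>\<mu>) - (\<integral>x. \<phi> x \<partial>\<nu>))"

definition skorohod_paths :: "(real \<Rightarrow> real) set" where
  "skorohod_paths =
     {\<omega> \<in> {0..} \<rightarrow>\<^sub>E {0..1}.
        (\<forall>t\<ge>0. (\<omega> \<longlongrightarrow> \<omega> t) (at_right t)) \<and>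
        (\<forall>t>0. \<exists>l. (\<omega> \<longlongrightarrow> l) (at_left t))}"

definition skorohod :: "(real \<Rightarrow> real) measure" where
  "skorohod = restrict_space (Pi\<^sub>M {0..} (\<lambda>_. unit_borel)) skorohod_paths"

definition transition_family :: "(real \<Rightarrow> real \<Rightarrow> real \<Rightarrow> real measure) \<Rightarrow> bool" where
  "transition_family P \<longleftrightarrow>
     (\<forall>s t. 0 \<le> s \<and> s \<le> t \<longrightarrow> P s t \<in> unit_borel \<rightarrow>\<^sub>M prob_algebra unit_borel) \<and>
     (\<forall>s\<ge>0. \<forall>x\<in>{0..1}. P s s x = return unit_borel x) \<and>
     (\<forall>s t u. 0 \<le> s \<and> s \<le> t \<and> t \<le> u \<longrightarrow>
        (\<forall>x\<in>{0..1}. P s u x = P s t x \<bind> P t u))"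

(* The evolution system (P s t) on the Banach space of bounded measurable functions with the sup
   norm is strongly continuous and has the bounded operators A t as generators.  Continuity of
   (s,t) |-> P s t cannot be dropped: the right derivatives alone do not see jumps at fixed times
   and so would not determine P. *)
definition has_generator ::
  "(real \<Rightarrow> real \<Rightarrow> real \<Rightarrow> real measure) \<Rightarrow> (real \<Rightarrow> (real \<Rightarrow> real) \<Rightarrow> real \<Rightarrow> real) \<Rightarrow> bool" where
  "has_generator P A \<longleftrightarrow>
     (\<forall>h\<in>bdd_meas. \<forall>s t. 0 \<le> s \<and> s \<le> t \<longrightarrow>
        uniform_limit {0..1} (\<lambda>(s', t') x. \<integral>y. h y \<partial>P s' t' x) (\<lambda>x. \<integral>y. h y \<partial>P s t x)
          (at (s, t) within {(s', t'). 0 \<le> s' \<and> s' \<le> t'})) \<and>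
     (\<forall>h\<in>bdd_meas. \<forall>t\<ge>0.
        uniform_limit {0..1} (\<lambda>\<epsilon> x. ((\<integral>y. h y \<partial>P t (t + \<epsilon>) x) - h x) / \<epsilon>) (A t h) (at_right 0))"

definition natural_filtration :: "'a measure \<Rightarrow> (real \<Rightarrow> 'a \<Rightarrow> real) \<Rightarrow> real \<Rightarrow> 'a measure" where
  "natural_filtration M X s =
     sigma (space M) {X r -` B \<inter> space M | r B. 0 \<le> r \<and> r \<le> s \<and> B \<in> sets unit_borel}"

definition markov_process ::
  "'a measure \<Rightarrow> (real \<Rightarrow> 'a \<Rightarrow> real) \<Rightarrow> (real \<Rightarrow> real \<Rightarrow> real \<Rightarrow> real measure) \<Rightarrow> bool" where
  "markov_process M X P \<longleftrightarrow>
     prob_space M \<and>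
     (\<forall>t\<ge>0. X t \<in> M \<rightarrow>\<^sub>M unit_borel) \<and>
     transition_family P \<and>
     (\<forall>s t. 0 \<le> s \<and> s \<le> t \<longrightarrow> (\<forall>B\<in>sets unit_borel.
        AE \<omega> in M. real_cond_exp M (natural_filtration M X s) (\<lambda>\<omega>. indicator B (X t \<omega>)) \<omega>
                     = measure (P s t (X s \<omega>)) B))"

definition markov_law ::
  "(real \<Rightarrow> (real \<Rightarrow> real) \<Rightarrow> real \<Rightarrow> real) \<Rightarrow> real measure \<Rightarrow> (real \<Rightarrow> real) measure \<Rightarrow> bool" where
  "markov_law A m0 Q \<longleftrightarrow>
     Q \<in> space (prob_algebra skorohod) \<and>
     (\<exists>P. markov_process Q (\<lambda>t \<omega>. \<omega> t) P \<and> has_generator P A) \<and>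
     distr Q unit_borel (\<lambda>\<omega>. \<omega> 0) = m0"

end

theory Submission
  imports Defs
begin

text \<open>
  An agent at \<open>x\<close> meets, at rate \<open>2\<close>, a partner at \<open>y\<close> drawn from the current law, and moves to \<open>T (x, y)\<close>, which is
  \<open>w x + (1 - w) y\<close> if \<open>x\<close> and \<open>y\<close> are within distance \<open>\<Delta>\<close>, and \<open>x\<close> otherwise. Let \<open>coll \<mu> \<nu>\<close> be the law of
  \<open>T (X, Y)\<close> for independent \<open>X\<close> and \<open>Y\<close> with laws \<open>\<mu>\<close> and \<open>\<nu>\<close>. Then Problem 1 is the quadratic equation
  \<open>m' = 2 (coll m m - m)\<close>, and it is solved explicitly by a Wild sum: a mixture, with geometric weights of success
  probability \<open>exp (- 2 t)\<close>, of laws \<open>W\<^sub>n\<close> defined by \<open>W\<^sub>0 = m0\<close> and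
  \<open>(n + 1) W\<^sub>n\<^sub>+\<^sub>1 = \<Sum>k\<le>n. coll W\<^sub>k W\<^sub>n\<^sub>-\<^sub>k\<close>. Tested against a bounded function this is a power series, and
  the recursion says exactly that its derivative is the square of the series with respect to \<open>coll\<close>
  (\<open>evol_deriv\<close>). If one marked leaf of the recursion carries another initial law \<open>\<nu>\<close>, the same computation
  solves the linear equation \<open>\<nu>' = 2 (coll \<nu> m - \<nu>)\<close>; point masses \<open>\<nu>\<close> then give the transition
  kernels of a tagged agent in the environment \<open>m\<close>.

  The product \<open>coll\<close> is bilinear and contracts total variation in each argument, so a Gronwall argument
  (\<open>evolves_stability\<close>) yields at once the uniqueness for both equations and the continuous dependence of \<open>m\<close> on
  \<open>m0\<close>. Continuity in time holds because jump rates are bounded. Uniqueness turns into the semigroup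
  property of the flow and the Chapman-Kolmogorov equation of the kernels (\<open>evol_add\<close>), and the derivative of the Wild
  sum at time \<open>0\<close> is the generator, uniformly in the starting point (\<open>transition_generator\<close>). Conversely the
  generator determines the kernels: if \<open>P'\<close> has the same generator as \<open>P\<close>, then
  \<open>r \<mapsto> P'\<^sub>s\<^sub>,\<^sub>r P\<^sub>r\<^sub>,\<^sub>t h (x)\<close> has right derivative zero (\<open>generator_determines_transitions\<close>).

  A process is Markov with given kernels and initial law if and only if its finite-dimensional distributions are
  the iterated integrals of the kernels (\<open>markov_process_fdd\<close>, \<open>has_fdd_imp_markov_process\<close>). This gives the
  uniqueness of the law on path space, and its marginals. For existence, Kolmogorov's theorem provides a
  process without path regularity. Two of its values differ with probability at most four times the
  time elapsed, so along the dyadic times it has almost surely finitely many jumps in bounded time. The number of jumps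
  up to a dyadic time is monotone and integer valued, and therefore constant on one-sided neighbourhoods of every time;
  so is the path, and its right limits form a version with step paths (\<open>exists_skorohod_law\<close>).
\<close>

section \<open>Bounded test functions and mixtures of probability measures\<close>

definition bounded_meas :: "'a measure \<Rightarrow> real \<Rightarrow> ('a \<Rightarrow> real) set" where
  "bounded_meas M B = {h \<in> borel_measurable M. \<forall>x\<in>space M. \<bar>h x\<bar> \<le> B}"

lemma bounded_meas_measurable[measurable_dest]: "h \<in> bounded_meas M B \<Longrightarrow> h \<in> borel_measurable M"
  by (simp add: bounded_meas_def)

lemma bounded_meas_bound: "h \<in> bounded_meas M B \<Longrightarrow> x \<in> space M \<Longrightarrow> \<bar>h x\<bar> \<le> B"
  by (simp add: bounded_meas_def)

abbreviation probs :: "'a measure \<Rightarrow> 'a measure set" where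
  "probs M \<equiv> space (prob_algebra M)"

lemma prob_algebraD:
  assumes "\<mu> \<in> probs M"
  shows "prob_space \<mu>" "sets \<mu> = sets M" "space \<mu> = space M"
  using assms by (auto simp: space_prob_algebra dest: sets_eq_imp_space_eq)

lemma bounded_meas_integrable:
  assumes "\<mu> \<in> probs M" "h \<in> bounded_meas M B"
  shows "integrable \<mu> h"
proof -
  interpret prob_space \<mu> using prob_algebraD[OF assms(1)] by simp
  note [measurable_cong] = prob_algebraD(2)[OF assms(1)]
  have [measurable]: "h \<in> borel_measurable M" using assms(2) by (rule bounded_meas_measurable)
  show ?thesis
    by (rule integrable_const_bound[where B=B])
       (use assms in \<open>auto simp: prob_algebraD(3) bounded_meas_def\<close>)
qed

lemma bounded_meas_integral:
  assumes \<mu>: "\<mu> \<in> probs M" and h: "h \<in> bounded_meas M B"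
  shows "\<bar>\<integral>x. h x \<partial>\<mu>\<bar> \<le> B"
proof -
  interpret prob_space \<mu> using prob_algebraD[OF \<mu>] by simp
  have "\<bar>\<integral>x. h x \<partial>\<mu>\<bar> \<le> (\<integral>x. \<bar>h x\<bar> \<partial>\<mu>)" by (rule integral_abs_bound)
  also have "\<dots> \<le> (\<integral>x. B \<partial>\<mu>)"
    using bounded_meas_integrable[OF \<mu> h] h
    by (intro integral_mono) (auto simp: prob_algebraD(3)[OF \<mu>] bounded_meas_def)
  finally show ?thesis by (simp add: prob_space)
qed

lemma bounded_meas_kernel:
  assumes K[measurable]: "K \<in> L \<rightarrow>\<^sub>M prob_algebra M" and h: "h \<in> bounded_meas M B"
  shows "(\<lambda>x. \<integral>y. h y \<partial>K x) \<in> bounded_meas L B"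
proof -
  have [measurable]: "h \<in> borel_measurable M" using h by (rule bounded_meas_measurable)
  have [measurable]: "K \<in> L \<rightarrow>\<^sub>M subprob_algebra M" by (rule measurable_prob_algebraD) measurable
  show ?thesis
    using bounded_meas_integral[OF measurable_space[OF K] h] by (auto simp: bounded_meas_def)
qed

lemma bounded_meas_swap:
  "g \<in> bounded_meas (M \<Otimes>\<^sub>M N) B \<Longrightarrow> (\<lambda>(y, x). g (x, y)) \<in> bounded_meas (N \<Otimes>\<^sub>M M) B"
  using measurable_compose[OF measurable_pair_swap', of g M N borel]
  by (auto simp: bounded_meas_def space_pair_measure split_beta')

text \<open>Fubini for test functions: averaging one of two variables over a probability measure leaves a test
  function with the same bound.\<close>
lemma bounded_meas_integrate_out:
  assumes \<nu>: "\<nu> \<in> probs N" and g: "g \<in> bounded_meas (M \<Otimes>\<^sub>M N) B"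
  shows "(\<lambda>x. \<integral>y. g (x, y) \<partial>\<nu>) \<in> bounded_meas M B"
proof -
  interpret \<nu>: prob_space \<nu> using prob_algebraD[OF \<nu>] by simp
  note [measurable_cong] = prob_algebraD(2)[OF \<nu>]
  have [measurable]: "g \<in> borel_measurable (M \<Otimes>\<^sub>M N)" using g by (rule bounded_meas_measurable)
  have "(\<lambda>y. g (x, y)) \<in> bounded_meas N B" if [measurable]: "x \<in> space M" for x
    using g that by (auto simp: bounded_meas_def space_pair_measure)
  moreover have "(\<lambda>x. \<integral>y. g (x, y) \<partial>\<nu>) \<in> borel_measurable M"
    by (intro \<nu>.borel_measurable_lebesgue_integral) measurable
  ultimately show ?thesis
    using bounded_meas_integral[OF \<nu>] by (auto simp: bounded_meas_def[of M B])
qed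

lemma integral_bind_prob:
  assumes \<nu>: "\<nu> \<in> probs L" and K: "K \<in> L \<rightarrow>\<^sub>M prob_algebra M"
    and h: "h \<in> bounded_meas M B"
  shows "(\<integral>y. h y \<partial>(\<nu> \<bind> K)) = (\<integral>x. (\<integral>y. h y \<partial>K x) \<partial>\<nu>)"
proof -
  interpret prob_space \<nu> using prob_algebraD[OF \<nu>] by simp
  note [measurable_cong] = prob_algebraD(2)[OF \<nu>]
  have [measurable]: "h \<in> borel_measurable M" using h by (rule bounded_meas_measurable)
  have "K \<in> \<nu> \<rightarrow>\<^sub>M subprob_algebra M" using measurable_prob_algebraD[OF K] by measurable
  moreover have "emeasure (K x) (space (K x)) \<le> ennreal 1" if "x \<in> space \<nu>" for x
    using measurable_space[OF K] that prob_algebraD[OF \<nu>]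
    by (auto simp: space_prob_algebra prob_space.emeasure_space_1)
  ultimately show ?thesis
    by (intro integral_bind[where K=M and B=B and B'=1])
       (use h in \<open>auto simp: not_empty bounded_meas_def emeasure_space_1\<close>)
qed

lemma bind_in_prob_algebra:
  assumes "\<nu> \<in> probs L" "K \<in> L \<rightarrow>\<^sub>M prob_algebra M"
  shows "\<nu> \<bind> K \<in> probs M"
  using measurable_bind_prob_space[OF measurable_const, OF assms, THEN measurable_space, of undefined "count_space UNIV"]
  by simp

lemma measure_pmf_in_prob_algebra: "measure_pmf p \<in> space (prob_algebra (count_space UNIV))"
  by (simp add: space_prob_algebra prob_space_measure_pmf)

text \<open>A mixture with geometric weights is a power series in the failure probability. This is how
  Wild sums, which are defined as measures, become accessible to calculus.\<close>
lemma geometric_integral_sums: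
  fixes f :: "nat \<Rightarrow> real"
  assumes p: "0 < p" "p \<le> 1" and f: "\<And>n. \<bar>f n\<bar> \<le> B"
  shows "(\<lambda>n. p * (1 - p) ^ n * f n) sums (\<integral>n. f n \<partial>measure_pmf (geometric_pmf p))"
proof -
  have g: "(\<lambda>n. (1 - p) ^ n) sums (1 / (1 - (1 - p)))"
    using p by (intro geometric_sums) auto
  have abs_summable: "summable (\<lambda>n. \<bar>p * (1 - p) ^ n * f n\<bar>)"
  proof (rule summable_comparison_test)
    show "summable (\<lambda>n. (p * B) * (1 - p) ^ n)" using g by (intro summable_mult) (rule sums_summable)
    have "norm \<bar>p * (1 - p) ^ n * f n\<bar> \<le> p * B * (1 - p) ^ n" for n
      using p f[of n] mult_left_mono[OF f[of n], of "p * (1 - p)^n"] by (simp add: abs_mult mult_ac)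
    then show "\<exists>N. \<forall>n\<ge>N. norm \<bar>p * (1 - p) ^ n * f n\<bar> \<le> p * B * (1 - p) ^ n" by auto
  qed
  have "(\<integral>n. f n \<partial>measure_pmf (geometric_pmf p)) = (\<integral>n. p * (1 - p) ^ n * f n \<partial>count_space UNIV)"
    unfolding measure_pmf_eq_density using p
    by (subst integral_density) (auto simp: mult_ac pmf_geometric)
  then show ?thesis
    using sums_integral_count_space_nat[of "\<lambda>n. p * (1 - p) ^ n * f n"] abs_summable
    by (simp add: integrable_count_space_nat_iff)
qed

section \<open>Collisions and Wild sums\<close>

text \<open>The opinion model enters the evolution only through the map that sends the positions of an agent and of
  its partner to the new position of the agent. All of the analysis holds for any measurable such map.\<close>
locale collision =
  fixes M :: "'a measure" and T :: "'a \<times> 'a \<Rightarrow> 'a"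
  assumes T_measurable[measurable]: "T \<in> M \<Otimes>\<^sub>M M \<rightarrow>\<^sub>M M"
begin

text \<open>The law of the new position of an agent distributed by \<open>\<mu>\<close> after it has met an independent partner
  distributed by \<open>\<nu>\<close>. With this product, the equation of the model is \<open>m' = 2 (coll m m - m)\<close>.\<close>
definition coll :: "'a measure \<Rightarrow> 'a measure \<Rightarrow> 'a measure" where
  "coll \<mu> \<nu> = \<mu> \<bind> (\<lambda>x. \<nu> \<bind> (\<lambda>y. return M (T (x, y))))"

abbreviation drift :: "('a \<Rightarrow> real) \<Rightarrow> 'a measure \<Rightarrow> 'a measure \<Rightarrow> real" where
  "drift h \<mu> \<nu> \<equiv> 2 * ((\<integral>x. h x \<partial>coll \<mu> \<nu>) - (\<integral>x. h x \<partial>\<mu>))"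

lemma coll_measurable[measurable (raw)]:
  assumes [measurable]: "f \<in> L \<rightarrow>\<^sub>M prob_algebra M" "g \<in> L \<rightarrow>\<^sub>M prob_algebra M"
  shows "(\<lambda>x. coll (f x) (g x)) \<in> L \<rightarrow>\<^sub>M prob_algebra M"
  unfolding coll_def by measurable

lemma coll_in_prob_algebra:
  assumes "\<mu> \<in> probs M" "\<nu> \<in> probs M"
  shows "coll \<mu> \<nu> \<in> probs M"
  using coll_measurable[OF measurable_const, OF assms(1) measurable_const, OF assms(2),
      THEN measurable_space, of undefined "count_space UNIV"] by simp

lemma T_bounded_meas: "h \<in> bounded_meas M B \<Longrightarrow> (\<lambda>z. h (T z)) \<in> bounded_meas (M \<Otimes>\<^sub>M M) B"
  using measurable_space[OF T_measurable] by (auto simp: bounded_meas_def intro: measurable_compose[OF T_measurable])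

lemma integrate_partner_bounded_meas:
  assumes "\<nu> \<in> probs M" "h \<in> bounded_meas M B"
  shows "(\<lambda>x. \<integral>y. h (T (x, y)) \<partial>\<nu>) \<in> bounded_meas M B"
  using bounded_meas_integrate_out[OF assms(1) T_bounded_meas[OF assms(2)]] .

lemma integrate_agent_bounded_meas:
  assumes "\<mu> \<in> probs M" "h \<in> bounded_meas M B"
  shows "(\<lambda>y. \<integral>x. h (T (x, y)) \<partial>\<mu>) \<in> bounded_meas M B"
  using bounded_meas_integrate_out[OF assms(1) bounded_meas_swap[OF T_bounded_meas[OF assms(2)]]] by simp

lemma integral_coll:
  assumes \<mu>: "\<mu> \<in> probs M" and \<nu>: "\<nu> \<in> probs M"
    and h: "h \<in> bounded_meas M B"
  shows "(\<integral>x. h x \<partial>coll \<mu> \<nu>) = (\<integral>x. (\<integral>y. h (T (x, y)) \<partial>\<nu>) \<partial>\<mu>)"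
proof -
  have [measurable]: "h \<in> borel_measurable M" using h by (rule bounded_meas_measurable)
  note [measurable] = \<nu> \<mu>
  have "(\<integral>x. h x \<partial>coll \<mu> \<nu>) = (\<integral>x. (\<integral>y. h y \<partial>(\<nu> \<bind> (\<lambda>y. return M (T (x, y))))) \<partial>\<mu>)"
    unfolding coll_def by (rule integral_bind_prob[OF \<mu> _ h]) measurable
  also have "\<dots> = (\<integral>x. (\<integral>y. (\<integral>z. h z \<partial>return M (T (x, y))) \<partial>\<nu>) \<partial>\<mu>)"
  proof (rule Bochner_Integration.integral_cong[OF refl])
    fix x assume "x \<in> space \<mu>"
    then have [measurable]: "x \<in> space M" using prob_algebraD[OF \<mu>] by simp
    show "(\<integral>y. h y \<partial>(\<nu> \<bind> (\<lambda>y. return M (T (x, y))))) = (\<integral>y. (\<integral>z. h z \<partial>return M (T (x, y))) \<partial>\<nu>)"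
      by (rule integral_bind_prob[OF \<nu> _ h]) measurable
  qed
  also have "\<dots> = (\<integral>x. (\<integral>y. h (T (x, y)) \<partial>\<nu>) \<partial>\<mu>)"
    using measurable_space[OF T_measurable] prob_algebraD(3)[OF \<mu>] prob_algebraD(3)[OF \<nu>]
    by (intro Bochner_Integration.integral_cong refl integral_return)
       (auto simp: space_pair_measure)
  finally show ?thesis .
qed

lemma integral_coll_swapped:
  assumes \<mu>: "\<mu> \<in> probs M" and \<nu>: "\<nu> \<in> probs M"
    and h: "h \<in> bounded_meas M B"
  shows "(\<integral>x. h x \<partial>coll \<mu> \<nu>) = (\<integral>y. (\<integral>x. h (T (x, y)) \<partial>\<mu>) \<partial>\<nu>)"
proof -
  interpret \<mu>: prob_space \<mu> using prob_algebraD[OF \<mu>] by simp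
  interpret \<nu>: prob_space \<nu> using prob_algebraD[OF \<nu>] by simp
  interpret pair_prob_space \<nu> \<mu> ..
  have [measurable]: "h \<in> borel_measurable M" using h by (rule bounded_meas_measurable)
  note [measurable_cong] = prob_algebraD(2)[OF \<mu>] prob_algebraD(2)[OF \<nu>]
  have "integrable (\<nu> \<Otimes>\<^sub>M \<mu>) (\<lambda>(y, x). h (T (x, y)))"
    using measurable_space[OF T_measurable] h
    by (intro integrable_const_bound[where B=B])
       (auto simp: space_pair_measure prob_algebraD(3)[OF \<mu>] prob_algebraD(3)[OF \<nu>] bounded_meas_def)
  from Fubini_integral[OF this] show ?thesis by (simp add: integral_coll[OF \<mu> \<nu> h])
qed

text \<open>The \<open>n\<close>-th term of the Wild sum, in a version with two initial laws: it is the law of the root of a random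
  binary tree with \<open>n\<close> collisions, whose marked leaf has law \<open>\<nu>\<close> and whose other leaves have law \<open>\<mu>\<close>. The last
  collision of the marked agent splits the \<open>n\<close> earlier ones uniformly into those in its own past and those in
  the past of its partner. For \<open>\<nu> = \<mu>\<close> this is the classical Wild sum; for a point mass \<open>\<nu>\<close> it follows one tagged
  agent. The else branch is a default value outside the support of the uniform law.\<close>
fun wild :: "'a measure \<Rightarrow> 'a measure \<Rightarrow> nat \<Rightarrow> 'a measure" where
  "wild \<mu> \<nu> 0 = \<nu>"
| "wild \<mu> \<nu> (Suc n) = measure_pmf (pmf_of_set {..n}) \<bind>
     (\<lambda>k. if k \<le> n then coll (wild \<mu> \<nu> k) (wild \<mu> \<mu> (n - k)) else \<nu>)"

lemma wild_measurable:
  assumes f[measurable]: "f \<in> L \<rightarrow>\<^sub>M prob_algebra M" "g \<in> L \<rightarrow>\<^sub>M prob_algebra M"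
  shows "(\<lambda>x. wild (f x) (g x) n) \<in> L \<rightarrow>\<^sub>M prob_algebra M"
  using assms(2)
proof (induction n arbitrary: g rule: less_induct)
  case (less n)
  note [measurable] = less.prems
  show ?case
  proof (cases n)
    case (Suc m)
    have [measurable]: "(\<lambda>x. wild (f x) (g x) k) \<in> L \<rightarrow>\<^sub>M prob_algebra M"
      "(\<lambda>x. wild (f x) (f x) k) \<in> L \<rightarrow>\<^sub>M prob_algebra M" if "k \<le> m" for k
      using less.IH[of k] less.prems f that Suc by auto
    have "(\<lambda>x. if k \<le> m then coll (wild (f x) (g x) k) (wild (f x) (f x) (m - k)) else g x)
      \<in> L \<rightarrow>\<^sub>M prob_algebra M" for k
      by (cases "k \<le> m") simp_all
    then have K[measurable]: "(\<lambda>(k, x). if k \<le> m then coll (wild (f x) (g x) k) (wild (f x) (f x) (m - k)) else g x)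
      \<in> count_space UNIV \<Otimes>\<^sub>M L \<rightarrow>\<^sub>M prob_algebra M"
      by (intro measurable_pair_measure_countable1) auto
    have K': "(\<lambda>(x, k). if k \<le> m then coll (wild (f x) (g x) k) (wild (f x) (f x) (m - k)) else g x)
      \<in> L \<Otimes>\<^sub>M count_space UNIV \<rightarrow>\<^sub>M prob_algebra M"
      using measurable_compose[OF measurable_pair_swap' K] by (simp add: split_beta')
    then show ?thesis unfolding Suc wild.simps
      by (intro measurable_bind_prob_space2[OF measurable_const[OF measure_pmf_in_prob_algebra]])
  qed (use less.prems in simp)
qed

lemma wild_in_prob_algebra:
  assumes "\<mu> \<in> probs M" "\<nu> \<in> probs M"
  shows "wild \<mu> \<nu> n \<in> probs M"
  using wild_measurable[OF measurable_const, OF assms(1) measurable_const, OF assms(2),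
      THEN measurable_space, of undefined "count_space UNIV"] by simp

text \<open>Multiplied by \<open>n + 1\<close>, the uniform average becomes a convolution. The left-hand side is then a coefficient of the
  derivative of the power series, and the right-hand side one of a Cauchy product.\<close>
lemma integral_wild_Suc:
  assumes \<mu>: "\<mu> \<in> probs M" and \<nu>: "\<nu> \<in> probs M"
    and h: "h \<in> bounded_meas M B"
  shows "real (Suc n) * (\<integral>x. h x \<partial>wild \<mu> \<nu> (Suc n)) =
    (\<Sum>k\<le>n. \<integral>x. h x \<partial>coll (wild \<mu> \<nu> k) (wild \<mu> \<mu> (n - k)))"
proof -
  let ?K = "\<lambda>k. if k \<le> n then coll (wild \<mu> \<nu> k) (wild \<mu> \<mu> (n - k)) else \<nu>"
  have K: "?K \<in> count_space UNIV \<rightarrow>\<^sub>M prob_algebra M"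
    using wild_in_prob_algebra[OF \<mu> \<nu>] wild_in_prob_algebra[OF \<mu> \<mu>] \<nu>
    by (auto simp: coll_in_prob_algebra)
  have "(\<integral>x. h x \<partial>wild \<mu> \<nu> (Suc n)) = (\<integral>k. (\<integral>x. h x \<partial>?K k) \<partial>measure_pmf (pmf_of_set {..n}))"
    unfolding wild.simps by (rule integral_bind_prob[OF measure_pmf_in_prob_algebra K h])
  also have "\<dots> = (\<Sum>k\<le>n. \<integral>x. h x \<partial>?K k) / real (Suc n)"
    by (subst integral_pmf_of_set) auto
  finally show ?thesis by (simp del: wild.simps of_nat_Suc)
qed

text \<open>The Wild sum. At time \<open>t\<close> the number of collisions in the tree is geometric with success probability
  \<open>exp (- 2 t)\<close>, as for a Yule process of rate \<open>2\<close>. The flow of the nonlinear equation is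
  \<open>\<lambda>t. evol \<mu> t \<mu>\<close>, and \<open>\<lambda>t. evol \<mu> t \<nu>\<close> is the law of a tagged agent, started in \<open>\<nu>\<close>, in the environment created by
  that flow.\<close>
definition evol :: "'a measure \<Rightarrow> real \<Rightarrow> 'a measure \<Rightarrow> 'a measure" where
  "evol \<mu> t \<nu> = measure_pmf (geometric_pmf (exp (- 2 * t))) \<bind> wild \<mu> \<nu>"

lemma evol_measurable:
  assumes [measurable]: "f \<in> L \<rightarrow>\<^sub>M prob_algebra M" "g \<in> L \<rightarrow>\<^sub>M prob_algebra M"
  shows "(\<lambda>x. evol (f x) t (g x)) \<in> L \<rightarrow>\<^sub>M prob_algebra M"
proof -
  have K: "(\<lambda>(k, x). wild (f x) (g x) k) \<in> count_space UNIV \<Otimes>\<^sub>M L \<rightarrow>\<^sub>M prob_algebra M"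
    by (intro measurable_pair_measure_countable1) (auto intro: wild_measurable)
  have "(\<lambda>(x, k). wild (f x) (g x) k) \<in> L \<Otimes>\<^sub>M count_space UNIV \<rightarrow>\<^sub>M prob_algebra M"
    using measurable_compose[OF measurable_pair_swap' K] by (simp add: split_beta')
  then show ?thesis unfolding evol_def
    by (intro measurable_bind_prob_space2[OF measurable_const[OF measure_pmf_in_prob_algebra]])
qed

lemma evol_in_prob_algebra:
  assumes "\<mu> \<in> probs M" "\<nu> \<in> probs M"
  shows "evol \<mu> t \<nu> \<in> probs M"
  using evol_measurable[OF measurable_const, OF assms(1) measurable_const, OF assms(2),
      THEN measurable_space, of undefined "count_space UNIV"] by simp

lemma integral_evol_sums:
  assumes \<mu>: "\<mu> \<in> probs M" and \<nu>: "\<nu> \<in> probs M"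
    and h: "h \<in> bounded_meas M B" and t: "0 \<le> t"
  shows "(\<lambda>n. exp (-2*t) * (1 - exp (-2*t)) ^ n * (\<integral>x. h x \<partial>wild \<mu> \<nu> n)) sums (\<integral>x. h x \<partial>evol \<mu> t \<nu>)"
proof -
  have "(\<integral>x. h x \<partial>evol \<mu> t \<nu>) = (\<integral>n. (\<integral>x. h x \<partial>wild \<mu> \<nu> n) \<partial>measure_pmf (geometric_pmf (exp (-2*t))))"
    unfolding evol_def
    by (rule integral_bind_prob[OF measure_pmf_in_prob_algebra _ h])
       (use wild_in_prob_algebra[OF \<mu> \<nu>] in auto)
  then show ?thesis
    using geometric_integral_sums[of "exp (-2*t)" "\<lambda>n. \<integral>x. h x \<partial>wild \<mu> \<nu> n" B] t
      bounded_meas_integral[OF wild_in_prob_algebra[OF \<mu> \<nu>] h] by simp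
qed

end

text \<open>A bounded double array need not have product form, so this is not the Cauchy product theorem; but geometric
  weights make the double series absolutely summable, and it may be summed along antidiagonals.\<close>
lemma antidiagonal_power_series:
  fixes b :: "nat \<Rightarrow> nat \<Rightarrow> real"
  assumes q: "0 \<le> q" "q < 1" and b: "\<And>k j. \<bar>b k j\<bar> \<le> B"
    and inner: "\<And>k. (\<lambda>j. q ^ j * b k j) sums s k" and outer: "(\<lambda>k. q ^ k * s k) sums S"
  shows "(\<lambda>n. q ^ n * (\<Sum>k\<le>n. b k (n - k))) sums S"
proof -
  let ?f = "\<lambda>(k, j). q ^ (k + j) * b k j"
  have geo: "((\<lambda>j. q ^ j) has_sum (1 / (1 - q))) UNIV"
    using q by (intro norm_summable_imp_has_sum geometric_sums) (auto simp: summable_geometric_iff)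
  have "(\<lambda>(k, j). B * q ^ k * q ^ j) summable_on UNIV \<times> UNIV"
  proof (rule summable_on_SigmaI)
    show "((\<lambda>j. case (k, j) of (k, j) \<Rightarrow> B * q ^ k * q ^ j) has_sum (B * q ^ k * (1 / (1 - q)))) UNIV" for k
      using has_sum_cmult_right[OF geo, of "B * q ^ k"] by simp
    have "(\<lambda>k. B * (1 / (1 - q)) * q ^ k) summable_on UNIV"
      by (rule summable_on_cmult_right) (use geo in \<open>auto simp: summable_on_def\<close>)
    then show "(\<lambda>k. B * q ^ k * (1 / (1 - q))) summable_on UNIV" by (simp add: mult_ac)
    show "0 \<le> (case (k, j) of (k, j) \<Rightarrow> B * q ^ k * q ^ j)" for k j
      using q b[of 0 0] by (auto intro!: mult_nonneg_nonneg)
  qed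
  then have "Infinite_Sum.abs_summable_on ?f (UNIV \<times> UNIV)"
  proof (rule Infinite_Sum.abs_summable_on_comparison_test')
    show "norm (?f x) \<le> (case x of (k, j) \<Rightarrow> B * q ^ k * q ^ j)" for x
    proof (cases x)
      case (Pair k j)
      have "q ^ (k + j) * \<bar>b k j\<bar> \<le> q ^ (k + j) * B"
        using q b by (intro mult_left_mono) auto
      then show ?thesis using q by (simp add: Pair abs_mult power_add mult_ac)
    qed
  qed
  then have summ: "?f summable_on UNIV \<times> UNIV" by (rule abs_summable_summable)
  then obtain S' where S': "(?f has_sum S') (UNIV \<times> UNIV)" by (auto simp: summable_on_def)
  have nrm: "summable (\<lambda>j. norm (q ^ j * b k j))" for k
  proof (rule summable_comparison_test)
    show "summable (\<lambda>j. B * q ^ j)" using q by (intro summable_mult summable_geometric) auto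
    have "norm (norm (q ^ j * b k j)) \<le> B * q ^ j" for j
      using q b[of k j] mult_left_mono[OF b[of k j], of "q ^ j"] by (simp add: abs_mult mult_ac)
    then show "\<exists>N. \<forall>j\<ge>N. norm (norm (q ^ j * b k j)) \<le> B * q ^ j" by auto
  qed
  have "((\<lambda>k. q ^ k * s k) has_sum S') UNIV"
  proof (rule has_sum_SigmaD[OF S'])
    fix k
    show "((\<lambda>j. ?f (k, j)) has_sum (q ^ k * s k)) UNIV"
      using has_sum_cmult_right[OF norm_summable_imp_has_sum[OF nrm inner], of "q ^ k" k]
      by (simp add: power_add mult_ac)
  qed
  then have "S' = S" using has_sum_imp_sums outer sums_unique2 by blast
  have "((\<lambda>(n, k). q ^ n * b k (n - k)) has_sum S') (Sigma UNIV (\<lambda>n. {..n}))"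
    by (subst has_sum_reindex_bij_witness[where T = "UNIV \<times> UNIV" and j = "\<lambda>(n, k). (k, n - k)"
          and i = "\<lambda>(k, j). (k + j, k)" and h = ?f and s' = S']) (use S' in auto)
  then have "((\<lambda>n. q ^ n * (\<Sum>k\<le>n. b k (n - k))) has_sum S') UNIV"
    by (rule has_sum_SigmaD) (auto simp: sum_distrib_left intro!: has_sum_finiteI)
  then show ?thesis unfolding \<open>S' = S\<close> by (rule has_sum_imp_sums)
qed

section \<open>Total variation\<close>

lemma abs_drift_diff:
  fixes a b a' b' x y :: real
  assumes "\<bar>a - a'\<bar> \<le> x" "\<bar>b - b'\<bar> \<le> y"
  shows "\<bar>2 * (a - b) - 2 * (a' - b')\<bar> \<le> 2 * (x + y)"
  using assms unfolding abs_le_iff by auto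

text \<open>A bound on the total variation distance, stated test function by test function. This avoids suprema, which
  need not be measurable in time when they are integrated in the stability estimate.\<close>
definition tv_close :: "'a measure \<Rightarrow> 'a measure \<Rightarrow> 'a measure \<Rightarrow> real \<Rightarrow> bool" where
  "tv_close M \<mu> \<nu> a \<longleftrightarrow> (\<forall>h\<in>bounded_meas M 1. \<bar>(\<integral>x. h x \<partial>\<mu>) - (\<integral>x. h x \<partial>\<nu>)\<bar> \<le> a)"

lemma tv_close_nonneg: "tv_close M \<mu> \<nu> a \<Longrightarrow> 0 \<le> a"
  unfolding tv_close_def by (drule bspec[where x="\<lambda>_. 0"]) (auto simp: bounded_meas_def)

lemma tv_close_mono: "tv_close M \<mu> \<nu> a \<Longrightarrow> a \<le> b \<Longrightarrow> tv_close M \<mu> \<nu> b"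
  by (force simp: tv_close_def)

lemma tv_close_refl: "0 \<le> a \<Longrightarrow> tv_close M \<mu> \<mu> a"
  by (simp add: tv_close_def)

lemma tv_close_trivial:
  assumes "\<mu> \<in> probs M" "\<nu> \<in> probs M"
  shows "tv_close M \<mu> \<nu> 2"
  unfolding tv_close_def
proof
  fix h assume "h \<in> bounded_meas M 1"
  from bounded_meas_integral[OF assms(1) this] bounded_meas_integral[OF assms(2) this]
  show "\<bar>(\<integral>x. h x \<partial>\<mu>) - (\<integral>x. h x \<partial>\<nu>)\<bar> \<le> 2" by arith
qed

lemma tv_close_scaled:
  assumes close: "tv_close M \<mu> \<nu> a" and h: "h \<in> bounded_meas M B" and B: "0 < B"
  shows "\<bar>(\<integral>x. h x \<partial>\<mu>) - (\<integral>x. h x \<partial>\<nu>)\<bar> \<le> B * a"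
proof -
  have "(\<lambda>x. h x / B) \<in> bounded_meas M 1" using h B by (auto simp: bounded_meas_def)
  with close have "\<bar>(\<integral>x. h x / B \<partial>\<mu>) - (\<integral>x. h x / B \<partial>\<nu>)\<bar> \<le> a" by (auto simp: tv_close_def)
  then have "\<bar>((\<integral>x. h x \<partial>\<mu>) - (\<integral>x. h x \<partial>\<nu>)) / B\<bar> \<le> a" by (simp add: diff_divide_distrib)
  then show ?thesis using B by (simp add: abs_divide field_simps)
qed

lemma prob_measure_eqI:
  assumes \<mu>: "\<mu> \<in> probs M" and \<nu>: "\<nu> \<in> probs M"
    and eq: "\<And>h. h \<in> bounded_meas M 1 \<Longrightarrow> (\<integral>x. h x \<partial>\<mu>) = (\<integral>x. h x \<partial>\<nu>)"
  shows "\<mu> = \<nu>"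
proof (rule measure_eqI)
  interpret \<mu>: prob_space \<mu> using prob_algebraD[OF \<mu>] by simp
  interpret \<nu>: prob_space \<nu> using prob_algebraD[OF \<nu>] by simp
  show "sets \<mu> = sets \<nu>" using \<mu> \<nu> by (simp add: space_prob_algebra)
  fix A assume A: "A \<in> sets \<mu>"
  then have A': "A \<in> sets M" "A \<in> sets \<nu>" using \<mu> \<nu> by (auto simp: space_prob_algebra)
  then have "indicator A \<in> bounded_meas M 1" by (auto simp: bounded_meas_def indicator_def)
  from eq[OF this] A A' show "emeasure \<mu> A = emeasure \<nu> A"
    using sets.sets_into_space[OF A] sets.sets_into_space[OF A'(2)]
    by (simp add: \<mu>.emeasure_eq_measure \<nu>.emeasure_eq_measure Int_absorb2)
qed

lemma tv_close_0_imp_eq: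
  assumes "\<mu> \<in> probs M" "\<nu> \<in> probs M" "tv_close M \<mu> \<nu> 0"
  shows "\<mu> = \<nu>"
  using assms(3) by (intro prob_measure_eqI[OF assms(1,2)]) (auto simp: tv_close_def)

section \<open>Stability of the forward equation\<close>

context collision
begin

text \<open>Collision is bilinear and contracts total variation in each argument: exchange the two factors one
  at a time, and absorb the other factor into the test function.\<close>
lemma tv_close_coll:
  assumes pr: "\<mu> \<in> probs M" "\<mu>' \<in> probs M"
      "\<nu> \<in> probs M" "\<nu>' \<in> probs M"
    and "tv_close M \<mu> \<mu>' a" "tv_close M \<nu> \<nu>' b"
  shows "tv_close M (coll \<mu> \<nu>) (coll \<mu>' \<nu>') (a + b)"
  unfolding tv_close_def
proof
  fix h assume h: "h \<in> bounded_meas M 1"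
  have "\<bar>(\<integral>x. (\<integral>y. h (T (x, y)) \<partial>\<nu>) \<partial>\<mu>) - (\<integral>x. (\<integral>y. h (T (x, y)) \<partial>\<nu>) \<partial>\<mu>')\<bar> \<le> a"
    using assms(5) integrate_partner_bounded_meas[OF pr(3) h] by (auto simp: tv_close_def)
  moreover have "\<bar>(\<integral>y. (\<integral>x. h (T (x, y)) \<partial>\<mu>') \<partial>\<nu>) - (\<integral>y. (\<integral>x. h (T (x, y)) \<partial>\<mu>') \<partial>\<nu>')\<bar> \<le> b"
    using assms(6) integrate_agent_bounded_meas[OF pr(2) h] by (auto simp: tv_close_def)
  moreover have "(\<integral>x. h x \<partial>coll \<mu>' \<nu>) = (\<integral>x. (\<integral>y. h (T (x, y)) \<partial>\<nu>) \<partial>\<mu>')"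
    "(\<integral>x. h x \<partial>coll \<mu>' \<nu>) = (\<integral>y. (\<integral>x. h (T (x, y)) \<partial>\<mu>') \<partial>\<nu>)"
    using integral_coll[OF pr(2,3) h] integral_coll_swapped[OF pr(2,3) h] by auto
  ultimately show "\<bar>(\<integral>x. h x \<partial>coll \<mu> \<nu>) - (\<integral>x. h x \<partial>coll \<mu>' \<nu>')\<bar> \<le> a + b"
    using integral_coll[OF pr(1,3) h] integral_coll_swapped[OF pr(2,4) h] by linarith
qed

text \<open>The weak forward equation \<open>\<mu>' = 2 (coll \<mu> \<alpha> - \<mu>)\<close> of an agent whose partners have law \<open>\<alpha> t\<close>. The case
  \<open>\<alpha> = \<mu>\<close> is the nonlinear problem; a given environment \<open>\<alpha>\<close> makes the equation linear.\<close>
definition evolves :: "(real \<Rightarrow> 'a measure) \<Rightarrow> (real \<Rightarrow> 'a measure) \<Rightarrow> bool" where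
  "evolves \<alpha> \<mu> \<longleftrightarrow> (\<forall>t\<ge>0. \<mu> t \<in> probs M) \<and>
    (\<forall>B. \<forall>h\<in>bounded_meas M B. \<forall>t\<ge>0.
      set_integrable lborel {0..t} (\<lambda>s. drift h (\<mu> s) (\<alpha> s)) \<and>
      (\<integral>x. h x \<partial>\<mu> t) - (\<integral>x. h x \<partial>\<mu> 0) =
        (LINT s:{0..t}|lborel. drift h (\<mu> s) (\<alpha> s)))"

lemma exp_integral_Icc:
  fixes t C :: real
  assumes "0 \<le> t"
  shows "set_integrable lborel {0..t} (\<lambda>s. 6 * (C * exp (12 * s)))"
    "(LINT s:{0..t}|lborel. 6 * (C * exp (12 * s))) = C / 2 * (exp (12 * t) - 1)"
proof -
  have c: "continuous_on {0..t} (\<lambda>s. 6 * (C * exp (12 * s)))" by (intro continuous_intros)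
  then show "set_integrable lborel {0..t} (\<lambda>s. 6 * (C * exp (12 * s)))"
    by (rule borel_integrable_atLeastAtMost')
  have "((\<lambda>s. C / 2 * exp (12 * s)) has_vector_derivative 6 * (C * exp (12 * x))) (at x within {0..t})" for x
    unfolding has_real_derivative_iff_has_vector_derivative[symmetric]
    by (auto intro!: derivative_eq_intros)
  from integral_FTC_atLeastAtMost[OF assms this c]
  show "(LINT s:{0..t}|lborel. 6 * (C * exp (12 * s))) = C / 2 * (exp (12 * t) - 1)"
    by (simp add: set_lebesgue_integral_def algebra_simps)
qed

text \<open>One Gronwall argument for the linear and the nonlinear equation. If two solutions and their environments
  are \<open>g s\<close>-close at each time \<open>s\<close>, the right-hand sides of the equation differ by at most
  \<open>2 (2 g s + g s) = 6 g s\<close>; hence the solutions are \<open>d + \<integral> 6 g\<close>-close. The assumption on the environments covers both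
  equal environments and environments that are the solutions themselves. The bound is improved by iteration,
  because every step is an estimate for one test function and no supremum has to be measurable.\<close>
lemma evolves_stability:
  assumes \<mu>: "evolves \<alpha> \<mu>" and \<nu>: "evolves \<beta> \<nu>"
    and \<alpha>\<beta>: "\<And>t. 0 \<le> t \<Longrightarrow> \<alpha> t \<in> probs M" "\<And>t. 0 \<le> t \<Longrightarrow> \<beta> t \<in> probs M"
    and link: "\<And>t a. 0 \<le> t \<Longrightarrow> tv_close M (\<mu> t) (\<nu> t) a \<Longrightarrow> tv_close M (\<alpha> t) (\<beta> t) a"
    and init: "tv_close M (\<mu> 0) (\<nu> 0) d" and t: "0 \<le> t"
  shows "tv_close M (\<mu> t) (\<nu> t) (2 * d * exp (12 * t))"
proof -
  have pr: "\<mu> s \<in> probs M" "\<nu> s \<in> probs M" if "0 \<le> s" for s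
    using \<mu> \<nu> that by (auto simp: evolves_def)
  have d: "0 \<le> d" using init by (rule tv_close_nonneg)
  \<comment> \<open>Against the weight \<open>exp (12 t)\<close> one step of the iteration maps the constant \<open>C\<close> to \<open>d + C / 2\<close>: the integral
    of \<open>6 exp (12 s)\<close> is at most \<open>exp (12 t) / 2\<close>. Started at \<open>2 d + 2\<close>, the constants converge to \<open>2 d\<close>.\<close>
  have step: "\<forall>t\<ge>0. tv_close M (\<mu> t) (\<nu> t) ((2 * d + 2 / 2 ^ n) * exp (12 * t))" for n
  proof (induction n)
    case 0
    show ?case
    proof safe
      fix t :: real assume "0 \<le> t"
      have "2 * 1 \<le> (2 * d + 2 / 2 ^ 0) * exp (12 * t)"
        using d \<open>0 \<le> t\<close> by (intro mult_mono) auto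
      with tv_close_trivial[OF pr[OF \<open>0 \<le> t\<close>]]
      show "tv_close M (\<mu> t) (\<nu> t) ((2 * d + 2 / 2 ^ 0) * exp (12 * t))"
        by (auto elim: tv_close_mono)
    qed
  next
    case (Suc n)
    define C where "C = 2 * d + 2 / 2 ^ n"
    have IH: "tv_close M (\<mu> s) (\<nu> s) (C * exp (12 * s))" if "0 \<le> s" for s
      using Suc that by (simp add: C_def)
    show ?case
    proof (intro allI impI)
      fix t :: real assume t: "0 \<le> t"
      have "tv_close M (\<mu> t) (\<nu> t) (d + C / 2 * (exp (12 * t) - 1))"
        unfolding tv_close_def
      proof
        fix h assume h: "h \<in> bounded_meas M 1"
        let ?u = "\<lambda>s. drift h (\<mu> s) (\<alpha> s)"
        let ?v = "\<lambda>s. drift h (\<nu> s) (\<beta> s)"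
        have u: "set_integrable lborel {0..t} ?u" "(\<integral>x. h x \<partial>\<mu> t) - (\<integral>x. h x \<partial>\<mu> 0) = (LINT s:{0..t}|lborel. ?u s)"
          using \<mu> h t by (auto simp: evolves_def)
        have v: "set_integrable lborel {0..t} ?v" "(\<integral>x. h x \<partial>\<nu> t) - (\<integral>x. h x \<partial>\<nu> 0) = (LINT s:{0..t}|lborel. ?v s)"
          using \<nu> h t by (auto simp: evolves_def)
        have bd: "\<bar>?u s - ?v s\<bar> \<le> 6 * (C * exp (12 * s))" if s: "s \<in> {0..t}" for s
        proof -
          from s have s0: "0 \<le> s" by simp
          have "\<bar>(\<integral>x. h x \<partial>coll (\<mu> s) (\<alpha> s)) - (\<integral>x. h x \<partial>coll (\<nu> s) (\<beta> s))\<bar> \<le> C * exp (12 * s) + C * exp (12 * s)"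
            using tv_close_coll[OF pr(1,2) \<alpha>\<beta>(1,2) IH[OF s0] link[OF s0 IH]] s0 h unfolding tv_close_def by blast
          moreover have "\<bar>(\<integral>x. h x \<partial>\<mu> s) - (\<integral>x. h x \<partial>\<nu> s)\<bar> \<le> C * exp (12 * s)"
            using IH[OF s0] h by (auto simp: tv_close_def)
          ultimately show ?thesis using abs_drift_diff by fastforce
        qed
        have uv: "set_integrable lborel {0..t} (\<lambda>s. ?u s - ?v s)" by (rule set_integral_diff(1)[OF u(1) v(1)])
        have "\<bar>LINT s:{0..t}|lborel. ?u s - ?v s\<bar> \<le> (LINT s:{0..t}|lborel. \<bar>?u s - ?v s\<bar>)"
          using set_integral_norm_bound[OF uv] by simp
        also have "\<dots> \<le> (LINT s:{0..t}|lborel. 6 * (C * exp (12 * s)))"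
          by (rule set_integral_mono[OF _ exp_integral_Icc(1)[OF t]])
             (use bd set_integrable_abs[OF uv] in auto)
        also have "\<dots> = C / 2 * (exp (12 * t) - 1)" by (rule exp_integral_Icc(2)[OF t])
        finally have "\<bar>(LINT s:{0..t}|lborel. ?u s) - (LINT s:{0..t}|lborel. ?v s)\<bar> \<le> C / 2 * (exp (12 * t) - 1)"
          using set_integral_diff(2)[OF u(1) v(1)] by simp
        moreover have "\<bar>(\<integral>x. h x \<partial>\<mu> 0) - (\<integral>x. h x \<partial>\<nu> 0)\<bar> \<le> d" using init h by (auto simp: tv_close_def)
        ultimately show "\<bar>(\<integral>x. h x \<partial>\<mu> t) - (\<integral>x. h x \<partial>\<nu> t)\<bar> \<le> d + C / 2 * (exp (12 * t) - 1)"
          using u(2) v(2) by linarith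
      qed
      moreover have "d + C / 2 * (exp (12 * t) - 1) \<le> (d + C / 2) * exp (12 * t)"
      proof -
        have "0 \<le> C" using d by (simp add: C_def)
        moreover have "d \<le> d * exp (12 * t)" using d t by (simp add: mult_le_cancel_left1)
        ultimately show ?thesis by (simp add: algebra_simps)
      qed
      moreover have "d + C / 2 = 2 * d + 2 / 2 ^ Suc n" by (simp add: C_def)
      ultimately show "tv_close M (\<mu> t) (\<nu> t) ((2 * d + 2 / 2 ^ Suc n) * exp (12 * t))"
        by (metis tv_close_mono)
    qed
  qed
  show ?thesis unfolding tv_close_def
  proof
    fix h assume h: "h \<in> bounded_meas M 1"
    have "(\<lambda>n. (2 * d + 2 * (1 / 2) ^ n) * exp (12 * t)) \<longlonglongrightarrow> (2 * d + 2 * 0) * exp (12 * t)"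
      by (intro tendsto_intros LIMSEQ_realpow_zero) auto
    moreover have "\<bar>(\<integral>x. h x \<partial>\<mu> t) - (\<integral>x. h x \<partial>\<nu> t)\<bar> \<le> (2 * d + 2 * (1 / 2) ^ n) * exp (12 * t)" for n
      using step[of n] t h by (auto simp: tv_close_def power_divide)
    ultimately show "\<bar>(\<integral>x. h x \<partial>\<mu> t) - (\<integral>x. h x \<partial>\<nu> t)\<bar> \<le> 2 * d * exp (12 * t)"
      by (intro LIMSEQ_le_const[where X="\<lambda>n. (2 * d + 2 * (1 / 2) ^ n) * exp (12 * t)"]) auto
  qed
qed

lemma evolves_cong:
  assumes "\<And>t. 0 \<le> t \<Longrightarrow> \<alpha> t = \<beta> t"
  shows "evolves \<alpha> \<mu> \<longleftrightarrow> evolves \<beta> \<mu>"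
proof -
  have "set_integrable lborel {0..t} (\<lambda>s. drift h (\<mu> s) (\<alpha> s) :: real) =
      set_integrable lborel {0..t} (\<lambda>s. drift h (\<mu> s) (\<beta> s))"
    "(LINT s:{0..t}|lborel. drift h (\<mu> s) (\<alpha> s) :: real) =
      (LINT s:{0..t}|lborel. drift h (\<mu> s) (\<beta> s))" for h t
    by (rule set_integrable_cong, use assms in auto)
       (rule set_lebesgue_integral_cong, use assms in auto)
  then show ?thesis by (simp only: evolves_def)
qed

lemma evolves_unique:
  assumes "evolves \<alpha> \<mu>" "evolves \<alpha> \<nu>" "\<And>t. 0 \<le> t \<Longrightarrow> \<alpha> t \<in> probs M" "\<mu> 0 = \<nu> 0" "0 \<le> t"
  shows "\<mu> t = \<nu> t"
proof -
  have "tv_close M (\<mu> t) (\<nu> t) (2 * 0 * exp (12 * t))"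
    by (rule evolves_stability[OF assms(1,2)])
       (use assms in \<open>auto intro: tv_close_refl dest: tv_close_nonneg\<close>)
  then show ?thesis using assms by (intro tv_close_0_imp_eq) (auto simp: evolves_def)
qed

lemma self_evolves_stability:
  assumes "evolves \<mu> \<mu>" "evolves \<nu> \<nu>" "tv_close M (\<mu> 0) (\<nu> 0) d" "0 \<le> t"
  shows "tv_close M (\<mu> t) (\<nu> t) (2 * d * exp (12 * t))"
  using assms by (intro evolves_stability) (auto simp: evolves_def)

lemma self_evolves_unique:
  assumes "evolves \<mu> \<mu>" "evolves \<nu> \<nu>" "\<mu> 0 = \<nu> 0" "0 \<le> t"
  shows "\<mu> t = \<nu> t"
proof -
  have "tv_close M (\<mu> t) (\<nu> t) (2 * 0 * exp (12 * t))"
    by (rule self_evolves_stability[OF assms(1,2)]) (use assms in \<open>auto intro: tv_close_refl\<close>)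
  then show ?thesis using assms by (intro tv_close_0_imp_eq) (auto simp: evolves_def)
qed

text \<open>The drift of a test function bounded by \<open>1\<close> is bounded by \<open>4\<close>.\<close>
lemma lipschitz_of_deriv:
  assumes pr: "\<And>t. 0 \<le> t \<Longrightarrow> \<mu> t \<in> probs M" "\<And>t. 0 \<le> t \<Longrightarrow> \<alpha> t \<in> probs M"
    and deriv: "\<And>B h t. h \<in> bounded_meas M B \<Longrightarrow> 0 \<le> t \<Longrightarrow>
      ((\<lambda>t. \<integral>x. h x \<partial>\<mu> t) has_real_derivative drift h (\<mu> t) (\<alpha> t)) (at t within {0..})"
    and st: "0 \<le> s" "0 \<le> t"
  shows "tv_close M (\<mu> s) (\<mu> t) (4 * \<bar>s - t\<bar>)"
  unfolding tv_close_def
proof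
  fix h assume h: "h \<in> bounded_meas M 1"
  have "norm ((\<integral>x. h x \<partial>\<mu> s) - (\<integral>x. h x \<partial>\<mu> t)) \<le> 4 * norm (s - t)"
  proof (rule field_differentiable_bound[of "{0..}"])
    fix r :: real assume r: "r \<in> {0..}"
    then show "((\<lambda>t. \<integral>x. h x \<partial>\<mu> t) has_field_derivative drift h (\<mu> r) (\<alpha> r)) (at r within {0..})"
      using deriv[OF h] by auto
    show "norm (drift h (\<mu> r) (\<alpha> r)) \<le> 4"
    proof -
      have "\<bar>\<integral>x. h x \<partial>coll (\<mu> r) (\<alpha> r)\<bar> \<le> 1" "\<bar>\<integral>x. h x \<partial>\<mu> r\<bar> \<le> 1"
        using bounded_meas_integral[OF coll_in_prob_algebra[OF pr(1,2)] h, of r r]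
          bounded_meas_integral[OF pr(1) h, of r] r by auto
      then show ?thesis using abs_drift_diff[of _ 0 1 _ 0 1] by fastforce
    qed
  qed (use st in auto)
  then show "\<bar>(\<integral>x. h x \<partial>\<mu> s) - (\<integral>x. h x \<partial>\<mu> t)\<bar> \<le> 4 * \<bar>s - t\<bar>" by simp
qed

text \<open>The differential form of the equation implies the integral form: by \<open>lipschitz_of_deriv\<close> and
  \<open>tv_close_coll\<close> the right-hand side is Lipschitz in time, hence continuous, and the fundamental theorem of
  calculus applies.\<close>
lemma evolvesI:
  assumes pr: "\<And>t. 0 \<le> t \<Longrightarrow> \<mu> t \<in> probs M" "\<And>t. 0 \<le> t \<Longrightarrow> \<alpha> t \<in> probs M"
    and deriv: "\<And>B h t. h \<in> bounded_meas M B \<Longrightarrow> 0 \<le> t \<Longrightarrow>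
      ((\<lambda>t. \<integral>x. h x \<partial>\<mu> t) has_real_derivative drift h (\<mu> t) (\<alpha> t)) (at t within {0..})"
    and lip: "\<And>s t. 0 \<le> s \<Longrightarrow> 0 \<le> t \<Longrightarrow> tv_close M (\<alpha> s) (\<alpha> t) (4 * \<bar>s - t\<bar>)"
  shows "evolves \<alpha> \<mu>"
  unfolding evolves_def
proof (intro conjI allI impI ballI)
  fix B :: real and h and t :: real assume h: "h \<in> bounded_meas M B" and t: "0 \<le> t"
  let ?G = "\<lambda>t. drift h (\<mu> t) (\<alpha> t)"
  define B' where "B' = \<bar>B\<bar> + 1"
  have B': "0 < B'" "h \<in> bounded_meas M B'" using h by (auto simp: B'_def bounded_meas_def intro: order_trans)
  have "(12 * 2 * B')-lipschitz_on {0..t} ?G"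
  proof (rule lipschitz_onI)
    fix r s assume rs: "r \<in> {0..t}" "s \<in> {0..t}"
    note lip\<mu> = lipschitz_of_deriv[OF pr deriv, where s=r and t=s]
    have "\<bar>(\<integral>x. h x \<partial>\<mu> r) - (\<integral>x. h x \<partial>\<mu> s)\<bar> \<le> B' * (4 * \<bar>r - s\<bar>)"
      by (rule tv_close_scaled[OF _ B'(2,1)]) (use rs lip\<mu> in auto)
    moreover have "\<bar>(\<integral>x. h x \<partial>coll (\<mu> r) (\<alpha> r)) - (\<integral>x. h x \<partial>coll (\<mu> s) (\<alpha> s))\<bar> \<le> B' * (4 * \<bar>r - s\<bar> + 4 * \<bar>r - s\<bar>)"
      by (rule tv_close_scaled[OF _ B'(2,1)], rule tv_close_coll) (use rs lip\<mu> lip pr in auto)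
    ultimately have "\<bar>?G r - ?G s\<bar> \<le> 2 * (B' * (4 * \<bar>r - s\<bar> + 4 * \<bar>r - s\<bar>) + B' * (4 * \<bar>r - s\<bar>))"
      by (rule abs_drift_diff[rotated])
    then show "dist (?G r) (?G s) \<le> 12 * 2 * B' * dist r s"
      unfolding dist_real_def by (simp add: algebra_simps)
  qed (use B' in auto)
  then have cont: "continuous_on {0..t} ?G" by (rule lipschitz_on_continuous_on)
  then show "set_integrable lborel {0..t} ?G" by (rule borel_integrable_atLeastAtMost')
  have "((\<lambda>t. \<integral>x. h x \<partial>\<mu> t) has_vector_derivative ?G s) (at s within {0..t})" if "0 \<le> s" "s \<le> t" for s
    unfolding has_real_derivative_iff_has_vector_derivative[symmetric]
    by (rule DERIV_subset[OF deriv[OF h that(1)]]) auto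
  from integral_FTC_atLeastAtMost[OF t this cont]
  show "(\<integral>x. h x \<partial>\<mu> t) - (\<integral>x. h x \<partial>\<mu> 0) = (LINT s:{0..t}|lborel. ?G s)"
    by (simp add: set_lebesgue_integral_def)
qed (use pr in auto)

section \<open>The Wild sum solves the forward equation\<close>

text \<open>Why the Wild sum solves the equation. With \<open>p = exp (- 2 t)\<close> and \<open>q = 1 - p\<close> the integral is \<open>p f(q)\<close> for a power
  series \<open>f\<close>, so its derivative is \<open>- 2 p f(q) + 2 p\<^sup>2 f'(q)\<close>. By \<open>integral_wild_Suc\<close> the coefficients of \<open>f'\<close> are
  antidiagonal sums, and so \<open>p\<^sup>2 f'(q)\<close> is the collision of the two Wild sums.\<close>
lemma evol_deriv:
  assumes \<mu>: "\<mu> \<in> probs M" and \<nu>: "\<nu> \<in> probs M"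
    and h: "h \<in> bounded_meas M B" and t: "0 \<le> t"
  shows "((\<lambda>t. \<integral>x. h x \<partial>evol \<mu> t \<nu>) has_real_derivative
    drift h (evol \<mu> t \<nu>) (evol \<mu> t \<mu>)) (at t within {0..})"
proof -
  define a where "a n = (\<integral>x. h x \<partial>wild \<mu> \<nu> n)" for n
  define b where "b k j = (\<integral>x. h x \<partial>coll (wild \<mu> \<nu> k) (wild \<mu> \<mu> j))" for k j
  define f where "f q = (\<Sum>n. a n * q ^ n)" for q :: real
  define p where "p = exp (-2 * t)"
  define q where "q = 1 - p"
  have p: "0 < p" "p \<le> 1" using t by (auto simp: p_def)
  then have q: "0 \<le> q" "q < 1" by (auto simp: q_def)
  note prob = wild_in_prob_algebra[OF \<mu> \<nu>] wild_in_prob_algebra[OF \<mu> \<mu>]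
    evol_in_prob_algebra[OF \<mu> \<nu>, of t] evol_in_prob_algebra[OF \<mu> \<mu>, of t]
  have a: "\<bar>a n\<bar> \<le> B" for n unfolding a_def by (rule bounded_meas_integral[OF prob(1) h])
  have b: "\<bar>b k j\<bar> \<le> B" for k j
    unfolding b_def by (rule bounded_meas_integral[OF coll_in_prob_algebra[OF prob(1,2)] h])
  have summ: "summable (\<lambda>n. a n * z ^ n)" if "norm z < 1" for z :: real
  proof (rule summable_comparison_test)
    show "summable (\<lambda>n. B * \<bar>z\<bar> ^ n)" using that by (intro summable_mult summable_geometric) auto
    show "\<exists>N. \<forall>n\<ge>N. norm (a n * z ^ n) \<le> B * \<bar>z\<bar> ^ n"
      using a by (auto simp: abs_mult power_abs intro!: mult_right_mono)
  qed
  have evol_eq: "(\<integral>x. h x \<partial>evol \<mu> r \<nu>) = exp (-2 * r) * f (1 - exp (-2 * r))" if "0 \<le> r" for r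
  proof -
    have "(\<lambda>n. exp (-2*r) * (a n * (1 - exp (-2*r)) ^ n)) sums (\<integral>x. h x \<partial>evol \<mu> r \<nu>)"
      using integral_evol_sums[OF \<mu> \<nu> h that] by (simp add: a_def mult_ac)
    moreover have "(\<lambda>n. exp (-2*r) * (a n * (1 - exp (-2*r)) ^ n)) sums (exp (-2*r) * f (1 - exp (-2 * r)))"
      unfolding f_def using that by (intro sums_mult summable_sums summ) auto
    ultimately show ?thesis by (rule sums_unique2)
  qed
  have diffs: "diffs a n = (\<Sum>k\<le>n. b k (n - k))" for n
    using integral_wild_Suc[OF \<mu> \<nu> h, of n] unfolding diffs_def a_def b_def by simp
  have "DERIV f q :> (\<Sum>n. diffs a n * q ^ n)"
    unfolding f_def[abs_def] by (rule termdiffs_strong'[where K=1, OF summ]) (use q in auto)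
  moreover have "(\<lambda>n. q ^ n * (\<Sum>k\<le>n. b k (n - k))) sums ((\<integral>x. h x \<partial>coll (evol \<mu> t \<nu>) (evol \<mu> t \<mu>)) / p\<^sup>2)"
  proof (rule antidiagonal_power_series[OF q b])
    fix k
    let ?h = "\<lambda>y. \<integral>x. h (T (x, y)) \<partial>wild \<mu> \<nu> k"
    have h': "?h \<in> bounded_meas M B" by (rule integrate_agent_bounded_meas[OF prob(1) h])
    have "(\<lambda>j. p * q ^ j * b k j) sums (\<integral>x. h x \<partial>coll (wild \<mu> \<nu> k) (evol \<mu> t \<mu>))"
      using integral_evol_sums[OF \<mu> \<mu> h' t]
      unfolding b_def integral_coll_swapped[OF prob(1,2) h] integral_coll_swapped[OF prob(1,4) h] p_def q_def .
    from sums_mult[OF this, of "1/p"]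
    show "(\<lambda>j. q ^ j * b k j) sums ((\<integral>x. h x \<partial>coll (wild \<mu> \<nu> k) (evol \<mu> t \<mu>)) / p)"
      using p by (simp add: mult_ac)
  next
    let ?h = "\<lambda>x. \<integral>y. h (T (x, y)) \<partial>evol \<mu> t \<mu>"
    have h': "?h \<in> bounded_meas M B" by (rule integrate_partner_bounded_meas[OF prob(4) h])
    have "(\<lambda>k. p * q ^ k * (\<integral>x. h x \<partial>coll (wild \<mu> \<nu> k) (evol \<mu> t \<mu>))) sums
       (\<integral>x. h x \<partial>coll (evol \<mu> t \<nu>) (evol \<mu> t \<mu>))"
      using integral_evol_sums[OF \<mu> \<nu> h' t]
      unfolding integral_coll[OF prob(1,4) h] integral_coll[OF prob(3,4) h] p_def q_def .
    from sums_mult[OF this, of "1/p^2"]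
    show "(\<lambda>k. q ^ k * ((\<integral>x. h x \<partial>coll (wild \<mu> \<nu> k) (evol \<mu> t \<mu>)) / p)) sums
       ((\<integral>x. h x \<partial>coll (evol \<mu> t \<nu>) (evol \<mu> t \<mu>)) / p\<^sup>2)"
      using p by (simp add: mult_ac power2_eq_square)
  qed
  ultimately have "DERIV f q :> (\<integral>x. h x \<partial>coll (evol \<mu> t \<nu>) (evol \<mu> t \<mu>)) / p\<^sup>2"
    by (simp add: diffs mult.commute sums_iff)
  moreover have "DERIV (\<lambda>t. 1 - exp (-2 * t)) t :> 2 * p"
    unfolding p_def by (auto intro!: derivative_eq_intros)
  ultimately have "DERIV (\<lambda>t. f (1 - exp (-2 * t))) t :> (\<integral>x. h x \<partial>coll (evol \<mu> t \<nu>) (evol \<mu> t \<mu>)) / p\<^sup>2 * (2 * p)"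
    unfolding q_def p_def by (rule DERIV_chain2)
  then have "DERIV (\<lambda>t. exp (-2 * t) * f (1 - exp (-2 * t))) t :>
      (-2 * exp (-2 * t)) * f (1 - exp (-2 * t)) + (\<integral>x. h x \<partial>coll (evol \<mu> t \<nu>) (evol \<mu> t \<mu>)) / p\<^sup>2 * (2 * p) * exp (-2 * t)"
    by (rule DERIV_mult[rotated]) (auto intro!: derivative_eq_intros)
  also have "(-2 * exp (-2 * t)) * f (1 - exp (-2 * t)) + (\<integral>x. h x \<partial>coll (evol \<mu> t \<nu>) (evol \<mu> t \<mu>)) / p\<^sup>2 * (2 * p) * exp (-2 * t)
      = drift h (evol \<mu> t \<nu>) (evol \<mu> t \<mu>)"
    using p unfolding evol_eq[OF t] p_def[symmetric] by (simp add: power2_eq_square field_simps)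
  finally have "((\<lambda>t. exp (-2 * t) * f (1 - exp (-2 * t))) has_real_derivative
     drift h (evol \<mu> t \<nu>) (evol \<mu> t \<mu>)) (at t within {0..})"
    by (rule DERIV_subset) simp
  then show ?thesis
    by (rule has_field_derivative_transform_within[where d=1]) (use t evol_eq in auto)
qed

lemma evol_0:
  assumes "\<mu> \<in> probs M" "\<nu> \<in> probs M"
  shows "evol \<mu> 0 \<nu> = \<nu>"
proof (rule prob_measure_eqI[OF evol_in_prob_algebra[OF assms] assms(2)])
  fix h assume h: "h \<in> bounded_meas M 1"
  have "(\<lambda>n. exp (-2*0) * (1 - exp (-2*0)) ^ n * (\<integral>x. h x \<partial>wild \<mu> \<nu> n)) sums (\<integral>x. h x \<partial>evol \<mu> 0 \<nu>)"
    by (rule integral_evol_sums[OF assms h]) simp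
  moreover have "(\<lambda>n. exp (-2*0) * (1 - exp (-2*0)) ^ n * (\<integral>x. h x \<partial>wild \<mu> \<nu> n)) sums (\<integral>x. h x \<partial>wild \<mu> \<nu> 0)"
    using powser_sums_zero[of "\<lambda>n. \<integral>x. h x \<partial>wild \<mu> \<nu> n"] by (simp add: mult.commute)
  ultimately show "(\<integral>x. h x \<partial>evol \<mu> 0 \<nu>) = (\<integral>x. h x \<partial>\<nu>)" by (simp add: sums_unique2)
qed

lemma evol_lipschitz:
  assumes "\<mu> \<in> probs M" "\<nu> \<in> probs M" "0 \<le> s" "0 \<le> t"
  shows "tv_close M (evol \<mu> s \<nu>) (evol \<mu> t \<nu>) (4 * \<bar>s - t\<bar>)"
  using assms by (intro lipschitz_of_deriv[where \<alpha>="\<lambda>t. evol \<mu> t \<mu>"]) (auto intro: evol_deriv evol_in_prob_algebra simp del: right_diff_distrib_numeral)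

lemma evolves_evol_shift:
  assumes \<mu>: "\<mu> \<in> probs M" and \<nu>: "\<nu> \<in> probs M" and s: "0 \<le> s"
  shows "evolves (\<lambda>t. evol \<mu> (s + t) \<mu>) (\<lambda>t. evol \<mu> (s + t) \<nu>)"
proof (rule evolvesI)
  fix B :: real and h and t :: real assume h: "h \<in> bounded_meas M B" and t: "0 \<le> t"
  have "((\<lambda>t. \<integral>x. h x \<partial>evol \<mu> t \<nu>) has_real_derivative
    2 * ((\<integral>x. h x \<partial>coll (evol \<mu> (s + t) \<nu>) (evol \<mu> (s + t) \<mu>)) - (\<integral>x. h x \<partial>evol \<mu> (s + t) \<nu>)))
    (at (s + t) within (\<lambda>t. s + t) ` {0..})"
    using s t by (intro DERIV_subset[OF evol_deriv[OF \<mu> \<nu> h]]) auto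
  moreover have "((\<lambda>t. s + t) has_real_derivative 1) (at t within {0..})"
    by (auto intro!: derivative_eq_intros)
  ultimately show "((\<lambda>t. \<integral>x. h x \<partial>evol \<mu> (s + t) \<nu>) has_real_derivative
    2 * ((\<integral>x. h x \<partial>coll (evol \<mu> (s + t) \<nu>) (evol \<mu> (s + t) \<mu>)) - (\<integral>x. h x \<partial>evol \<mu> (s + t) \<nu>)))
    (at t within {0..})"
    using DERIV_image_chain[of "\<lambda>t. \<integral>x. h x \<partial>evol \<mu> t \<nu>" _ "\<lambda>t. s + t" t "{0..}" 1]
    by (simp add: o_def)
next
  fix r t :: real assume "0 \<le> r" "0 \<le> t"
  then show "tv_close M (evol \<mu> (s + r) \<mu>) (evol \<mu> (s + t) \<mu>) (4 * \<bar>r - t\<bar>)"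
    using evol_lipschitz[OF \<mu> \<mu>, of "s + r" "s + t"] s by simp
qed (use \<mu> \<nu> in \<open>auto intro: evol_in_prob_algebra\<close>)

lemma evolves_evol:
  assumes "\<mu> \<in> probs M" "\<nu> \<in> probs M"
  shows "evolves (\<lambda>t. evol \<mu> t \<mu>) (\<lambda>t. evol \<mu> t \<nu>)"
  using evolves_evol_shift[OF assms, of 0] by simp

text \<open>Both sides solve the nonlinear equation with the same initial value.\<close>
lemma evol_self_add:
  assumes \<mu>: "\<mu> \<in> probs M" and "0 \<le> s" "0 \<le> t"
  shows "evol \<mu> (s + t) \<mu> = evol (evol \<mu> s \<mu>) t (evol \<mu> s \<mu>)"
  by (rule self_evolves_unique[where \<mu>="\<lambda>t. evol \<mu> (s + t) \<mu>"])
     (use assms in \<open>auto intro!: evolves_evol_shift evolves_evol evol_in_prob_algebra simp: evol_0 evol_in_prob_algebra\<close>)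

text \<open>Both sides solve the same linear equation, by \<open>evol_self_add\<close>, with the same initial value. Specialised to point
  masses this is the Chapman-Kolmogorov equation.\<close>
lemma evol_add:
  assumes \<mu>: "\<mu> \<in> probs M" and \<nu>: "\<nu> \<in> probs M" and st: "0 \<le> s" "0 \<le> t"
  shows "evol \<mu> (s + t) \<nu> = evol (evol \<mu> s \<mu>) t (evol \<mu> s \<nu>)"
proof (rule evolves_unique[where \<alpha>="\<lambda>t. evol \<mu> (s + t) \<mu>" and \<mu>="\<lambda>t. evol \<mu> (s + t) \<nu>"])
  have S: "evol \<mu> s \<mu> \<in> probs M" "evol \<mu> s \<nu> \<in> probs M"
    using \<mu> \<nu> by (auto intro: evol_in_prob_algebra)
  have "evolves (\<lambda>t. evol (evol \<mu> s \<mu>) t (evol \<mu> s \<mu>)) (\<lambda>t. evol (evol \<mu> s \<mu>) t (evol \<mu> s \<nu>))"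
    by (rule evolves_evol[OF S])
  then show "evolves (\<lambda>t. evol \<mu> (s + t) \<mu>) (\<lambda>t. evol (evol \<mu> s \<mu>) t (evol \<mu> s \<nu>))"
    using evol_self_add[OF \<mu> st(1)] by (subst evolves_cong) auto
  show "evol \<mu> (s + 0) \<nu> = evol (evol \<mu> s \<mu>) 0 (evol \<mu> s \<nu>)" using S by (simp add: evol_0)
qed (use assms in \<open>auto intro!: evolves_evol_shift evol_in_prob_algebra\<close>)

section \<open>Transition kernels of a tagged agent\<close>

lemma return_in_prob_algebra: "x \<in> space M \<Longrightarrow> return M x \<in> probs M"
  by (rule measurable_space[OF measurable_return_prob_space])

text \<open>The marked leaf occurs once in each tree, so the Wild sum is linear in its law.\<close>
lemma integral_wild_return:
  assumes \<mu>: "\<mu> \<in> probs M" and \<nu>: "\<nu> \<in> probs M"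
    and h: "h \<in> bounded_meas M B"
  shows "(\<integral>x. h x \<partial>wild \<mu> \<nu> n) = (\<integral>x. (\<integral>y. h y \<partial>wild \<mu> (return M x) n) \<partial>\<nu>)"
  using h
proof (induction n arbitrary: h rule: less_induct)
  case (less n)
  note h = less.prems
  have [measurable]: "h \<in> borel_measurable M" using h by (rule bounded_meas_measurable)
  show ?case
  proof (cases n)
    case 0
    then show ?thesis using prob_algebraD(3)[OF \<nu>]
      by (auto intro!: Bochner_Integration.integral_cong simp: integral_return)
  next
    case (Suc m)
    let ?h = "\<lambda>k x. \<integral>y. h (T (x, y)) \<partial>wild \<mu> \<mu> (m - k)"
    have h': "?h k \<in> bounded_meas M B" for k
      by (rule integrate_partner_bounded_meas[OF wild_in_prob_algebra[OF \<mu> \<mu>] h])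
    have coll: "(\<integral>y. h y \<partial>coll (wild \<mu> \<rho> k) (wild \<mu> \<mu> (m - k))) = (\<integral>y. ?h k y \<partial>wild \<mu> \<rho> k)"
      if "\<rho> \<in> probs M" for \<rho> k
      by (rule integral_coll[OF wild_in_prob_algebra[OF \<mu> that] wild_in_prob_algebra[OF \<mu> \<mu>] h])
    have K: "(\<lambda>x. wild \<mu> (return M x) k) \<in> M \<rightarrow>\<^sub>M prob_algebra M" for k
      by (rule wild_measurable) (use \<mu> in auto)
    have "real (Suc m) * (\<integral>x. h x \<partial>wild \<mu> \<nu> n) = (\<Sum>k\<le>m. \<integral>y. ?h k y \<partial>wild \<mu> \<nu> k)"
      unfolding Suc integral_wild_Suc[OF \<mu> \<nu> h] by (simp add: coll[OF \<nu>])
    also have "\<dots> = (\<Sum>k\<le>m. \<integral>x. (\<integral>y. ?h k y \<partial>wild \<mu> (return M x) k) \<partial>\<nu>)"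
      by (intro sum.cong refl less.IH h') (auto simp: Suc)
    also have "\<dots> = (\<integral>x. (\<Sum>k\<le>m. \<integral>y. ?h k y \<partial>wild \<mu> (return M x) k) \<partial>\<nu>)"
      by (subst Bochner_Integration.integral_sum)
         (auto intro!: bounded_meas_integrable[OF \<nu> bounded_meas_kernel[OF K h']])
    also have "\<dots> = (\<integral>x. real (Suc m) * (\<integral>y. h y \<partial>wild \<mu> (return M x) n) \<partial>\<nu>)"
      unfolding Suc using prob_algebraD(3)[OF \<nu>]
      by (intro Bochner_Integration.integral_cong refl)
         (simp add: integral_wild_Suc[OF \<mu> _ h] coll return_in_prob_algebra del: wild.simps of_nat_Suc)
    finally show ?thesis by (simp del: of_nat_Suc)
  qed
qed

lemma evol_measurable_return:
  assumes \<mu>: "\<mu> \<in> probs M"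
  shows "(\<lambda>x. evol \<mu> t (return M x)) \<in> M \<rightarrow>\<^sub>M prob_algebra M"
  by (rule evol_measurable) (use \<mu> in auto)

lemma bind_evol:
  assumes \<mu>: "\<mu> \<in> probs M" and \<nu>: "\<nu> \<in> probs M"
  shows "\<nu> \<bind> (\<lambda>x. evol \<mu> t (return M x)) = evol \<mu> t \<nu>"
proof (rule prob_measure_eqI)
  note K = evol_measurable_return[OF \<mu>, of t]
  show "\<nu> \<bind> (\<lambda>x. evol \<mu> t (return M x)) \<in> probs M" by (rule bind_in_prob_algebra[OF \<nu> K])
  show "evol \<mu> t \<nu> \<in> probs M" by (rule evol_in_prob_algebra[OF \<mu> \<nu>])
  fix h assume h: "h \<in> bounded_meas M 1"
  let ?g = "measure_pmf (geometric_pmf (exp (-2*t)))"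
  interpret \<nu>: prob_space \<nu> using prob_algebraD[OF \<nu>] by simp
  interpret pair_prob_space \<nu> ?g ..
  note [measurable_cong] = prob_algebraD(2)[OF \<nu>]
  have int: "(\<integral>x. h x \<partial>evol \<mu> t \<rho>) = (\<integral>n. (\<integral>x. h x \<partial>wild \<mu> \<rho> n) \<partial>?g)"
    if "\<rho> \<in> probs M" for \<rho>
    unfolding evol_def
    by (rule integral_bind_prob[OF measure_pmf_in_prob_algebra _ h])
       (use wild_in_prob_algebra[OF \<mu> that] in auto)
  have W: "(\<lambda>x. wild \<mu> (return M x) n) \<in> M \<rightarrow>\<^sub>M prob_algebra M" for n
    by (rule wild_measurable) (use \<mu> in auto)
  note W' = bounded_meas_kernel[OF W h]
  have "(\<lambda>(n, x). \<integral>y. h y \<partial>wild \<mu> (return M x) n) \<in> borel_measurable (count_space UNIV \<Otimes>\<^sub>M M)"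
    by (intro measurable_pair_measure_countable1) (use W' in \<open>auto intro: bounded_meas_measurable\<close>)
  from measurable_compose[OF measurable_pair_swap' this]
  have m: "(\<lambda>(x, n). \<integral>y. h y \<partial>wild \<mu> (return M x) n) \<in> borel_measurable (\<nu> \<Otimes>\<^sub>M ?g)"
    by (simp add: split_beta' cong: measurable_cong_sets sets_pair_measure_cong)
  have "integrable (\<nu> \<Otimes>\<^sub>M ?g) (\<lambda>(x, n). \<integral>y. h y \<partial>wild \<mu> (return M x) n)"
    using W' m by (intro integrable_const_bound[where B=1])
      (auto simp: space_pair_measure prob_algebraD(3)[OF \<nu>] bounded_meas_def)
  from Fubini_integral[OF this]
  have "(\<integral>x. (\<integral>n. (\<integral>y. h y \<partial>wild \<mu> (return M x) n) \<partial>?g) \<partial>\<nu>) = (\<integral>n. (\<integral>x. (\<integral>y. h y \<partial>wild \<mu> (return M x) n) \<partial>\<nu>) \<partial>?g)"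
    by simp
  moreover have "(\<integral>x. h x \<partial>(\<nu> \<bind> (\<lambda>x. evol \<mu> t (return M x)))) = (\<integral>x. (\<integral>n. (\<integral>y. h y \<partial>wild \<mu> (return M x) n) \<partial>?g) \<partial>\<nu>)"
    unfolding integral_bind_prob[OF \<nu> K h] using prob_algebraD(3)[OF \<nu>]
    by (intro Bochner_Integration.integral_cong refl) (simp add: int return_in_prob_algebra)
  ultimately show "(\<integral>x. h x \<partial>(\<nu> \<bind> (\<lambda>x. evol \<mu> t (return M x)))) = (\<integral>x. h x \<partial>evol \<mu> t \<nu>)"
    by (simp add: int[OF \<nu>] integral_wild_return[OF \<mu> \<nu> h])
qed

text \<open>The law at time \<open>t\<close> of an agent that sits at \<open>x\<close> at time \<open>s\<close>, in the environment \<open>\<lambda>t. evol \<mu> t \<mu>\<close>. The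
  flow is autonomous, so from time \<open>s\<close> on the environment is the flow started in \<open>evol \<mu> s \<mu>\<close>.\<close>
definition transition :: "'a measure \<Rightarrow> real \<Rightarrow> real \<Rightarrow> 'a \<Rightarrow> 'a measure" where
  "transition \<mu> s t x = evol (evol \<mu> s \<mu>) (t - s) (return M x)"

context
  fixes \<mu> assumes \<mu>: "\<mu> \<in> probs M"
begin

lemma flow_in_prob_algebra: "evol \<mu> s \<mu> \<in> probs M"
  using \<mu> by (rule evol_in_prob_algebra) (rule \<mu>)

lemma transition_measurable: "transition \<mu> s t \<in> M \<rightarrow>\<^sub>M prob_algebra M"
  unfolding transition_def[abs_def] by (rule evol_measurable_return[OF flow_in_prob_algebra])

lemma transition_in_prob_algebra: "x \<in> space M \<Longrightarrow> transition \<mu> s t x \<in> probs M"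
  by (rule measurable_space[OF transition_measurable])

lemma transition_self: "x \<in> space M \<Longrightarrow> transition \<mu> s s x = return M x"
  by (simp add: transition_def evol_0 flow_in_prob_algebra return_in_prob_algebra)

lemma transition_comp:
  assumes "0 \<le> s" "s \<le> t" "t \<le> u" and x: "x \<in> space M"
  shows "transition \<mu> s u x = transition \<mu> s t x \<bind> transition \<mu> t u"
proof -
  have "evol \<mu> t \<mu> = evol (evol \<mu> s \<mu>) (t - s) (evol \<mu> s \<mu>)"
    using evol_self_add[OF \<mu>, of s "t - s"] assms by simp
  moreover have "transition \<mu> s t x \<bind> transition \<mu> t u = evol (evol \<mu> t \<mu>) (u - t) (transition \<mu> s t x)"
    unfolding transition_def[of \<mu> t u, abs_def]
    by (rule bind_evol[OF flow_in_prob_algebra transition_in_prob_algebra[OF x]])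
  moreover have "evol (evol \<mu> s \<mu>) ((t - s) + (u - t)) (return M x)
      = evol (evol (evol \<mu> s \<mu>) (t - s) (evol \<mu> s \<mu>)) (u - t) (evol (evol \<mu> s \<mu>) (t - s) (return M x))"
    using assms by (intro evol_add flow_in_prob_algebra return_in_prob_algebra) auto
  ultimately show ?thesis by (simp add: transition_def)
qed

lemma bind_transition_0: "0 \<le> t \<Longrightarrow> \<mu> \<bind> transition \<mu> 0 t = evol \<mu> t \<mu>"
  unfolding transition_def[abs_def] evol_0[OF \<mu> \<mu>] using bind_evol[OF \<mu> \<mu>] by simp

lemma transition_close_return:
  assumes "s \<le> t" "x \<in> space M"
  shows "tv_close M (transition \<mu> s t x) (return M x) (4 * (t - s))"
  using evol_lipschitz[OF flow_in_prob_algebra return_in_prob_algebra[OF assms(2)], of "t - s" 0 s] assms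
  by (simp add: transition_def evol_0 flow_in_prob_algebra return_in_prob_algebra)

text \<open>By Chapman-Kolmogorov, starting earlier means averaging over a position that has hardly
  moved.\<close>
lemma transition_close_left:
  assumes st: "0 \<le> s" "s \<le> s'" "s' \<le> t" and x: "x \<in> space M"
  shows "tv_close M (transition \<mu> s t x) (transition \<mu> s' t x) (4 * (s' - s))"
  unfolding tv_close_def
proof
  fix h assume h: "h \<in> bounded_meas M 1"
  let ?g = "\<lambda>y. \<integral>z. h z \<partial>transition \<mu> s' t y"
  have g: "?g \<in> bounded_meas M 1" by (rule bounded_meas_kernel[OF transition_measurable h])
  have "(\<integral>y. h y \<partial>transition \<mu> s t x) = (\<integral>y. ?g y \<partial>transition \<mu> s s' x)"
    unfolding transition_comp[OF st x]
    by (rule integral_bind_prob[OF transition_in_prob_algebra[OF x] transition_measurable h])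
  moreover have "(\<integral>y. ?g y \<partial>return M x) = ?g x"
    using x g by (intro integral_return) (auto intro: bounded_meas_measurable)
  ultimately show "\<bar>(\<integral>y. h y \<partial>transition \<mu> s t x) - (\<integral>y. h y \<partial>transition \<mu> s' t x)\<bar> \<le> 4 * (s' - s)"
    using transition_close_return[OF st(2) x] g by (auto simp: tv_close_def)
qed

lemma transition_lipschitz_aux:
  assumes "0 \<le> s" "s \<le> t" "s \<le> s'" "s' \<le> t'" and x: "x \<in> space M"
  shows "tv_close M (transition \<mu> s t x) (transition \<mu> s' t' x) (4 * (\<bar>s - s'\<bar> + \<bar>t - t'\<bar>))"
  unfolding tv_close_def
proof
  fix h assume h: "h \<in> bounded_meas M 1"
  let ?I = "\<lambda>s t. \<integral>y. h y \<partial>transition \<mu> s t x"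
  show "\<bar>?I s t - ?I s' t'\<bar> \<le> 4 * (\<bar>s - s'\<bar> + \<bar>t - t'\<bar>)"
  proof (cases "s' \<le> t")
    case True
    have "\<bar>?I s t - ?I s' t\<bar> \<le> 4 * (s' - s)"
      using transition_close_left[OF assms(1,3) True x] h by (auto simp: tv_close_def)
    moreover have "\<bar>?I s' t - ?I s' t'\<bar> \<le> 4 * \<bar>t - t'\<bar>"
      using evol_lipschitz[OF flow_in_prob_algebra return_in_prob_algebra[OF x], of "t - s'" "t' - s'" s'] True assms h
      by (auto simp: tv_close_def transition_def)
    ultimately show ?thesis using assms by (auto simp: abs_if split: if_splits)
  next
    case False
    have "\<bar>?I s t - (\<integral>y. h y \<partial>return M x)\<bar> \<le> 4 * (t - s)" "\<bar>?I s' t' - (\<integral>y. h y \<partial>return M x)\<bar> \<le> 4 * (t' - s')"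
      using transition_close_return[OF _ x] assms h by (auto simp: tv_close_def)
    then show ?thesis using False assms by (auto simp: abs_if split: if_splits)
  qed
qed

lemma transition_lipschitz:
  assumes "0 \<le> s" "s \<le> t" "0 \<le> s'" "s' \<le> t'" and x: "x \<in> space M"
  shows "tv_close M (transition \<mu> s t x) (transition \<mu> s' t' x) (4 * (\<bar>s - s'\<bar> + \<bar>t - t'\<bar>))"
proof (cases "s \<le> s'")
  case False
  then have "tv_close M (transition \<mu> s' t' x) (transition \<mu> s t x) (4 * (\<bar>s' - s\<bar> + \<bar>t' - t\<bar>))"
    using assms by (intro transition_lipschitz_aux) auto
  then show ?thesis by (simp add: tv_close_def abs_minus_commute)
qed (use assms in \<open>intro transition_lipschitz_aux\<close>)

text \<open>The derivative of the Wild sum at time \<open>0\<close> is the generator, and the derivative is Lipschitz with a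
  constant that does not depend on \<open>x\<close>. The uniformity in \<open>x\<close> reflects that the total jump rate is bounded.\<close>
lemma transition_generator:
  assumes h: "h \<in> bounded_meas M B" and B: "0 < B" and x: "x \<in> space M" and \<epsilon>: "0 < \<epsilon>" and t: "0 \<le> t"
  shows "\<bar>((\<integral>y. h y \<partial>transition \<mu> t (t + \<epsilon>) x) - h x) / \<epsilon> - 2 * ((\<integral>y. h (T (x, y)) \<partial>evol \<mu> t \<mu>) - h x)\<bar> \<le> 24 * B * \<epsilon>"
proof -
  let ?m = "evol \<mu> t \<mu>" and ?\<delta> = "return M x"
  note pr = flow_in_prob_algebra[of t] return_in_prob_algebra[OF x]
  have [measurable]: "h \<in> borel_measurable M" using h by (rule bounded_meas_measurable)
  define F where "F r = (\<integral>y. h y \<partial>evol ?m r ?\<delta>)" for r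
  define F' where "F' r = drift h (evol ?m r ?\<delta>) (evol ?m r ?m)" for r
  have F0: "F 0 = h x" using x by (simp add: F_def evol_0 pr integral_return)
  have sec: "(\<lambda>x. \<integral>y. h (T (x, y)) \<partial>?m) \<in> bounded_meas M B" by (rule integrate_partner_bounded_meas[OF pr(1) h])
  have F'0: "F' 0 = 2 * ((\<integral>y. h (T (x, y)) \<partial>?m) - h x)"
    using x sec F0 unfolding F_def F'_def
    by (simp add: evol_0 pr integral_coll[OF pr(2,1) h] integral_return bounded_meas_measurable)
  have lip: "\<bar>F' r - F' 0\<bar> \<le> 24 * B * \<epsilon>" if r: "0 \<le> r" "r \<le> \<epsilon>" for r
  proof -
    have e1: "tv_close M (evol ?m r ?\<delta>) (evol ?m 0 ?\<delta>) (4 * r)" "tv_close M (evol ?m r ?m) (evol ?m 0 ?m) (4 * r)"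
      using evol_lipschitz[OF pr, of r 0] evol_lipschitz[OF pr(1) pr(1), of r 0] r by auto
    have "\<bar>F' r - F' 0\<bar> \<le> 2 * (B * (4 * r + 4 * r) + B * (4 * r))"
      unfolding F'_def
      by (intro abs_drift_diff tv_close_scaled[OF _ h B] tv_close_coll e1 evol_in_prob_algebra pr)
    also have "\<dots> = (24 * B) * r" by (simp add: algebra_simps)
    also have "\<dots> \<le> 24 * B * \<epsilon>" using B r by (intro mult_left_mono) auto
    finally show ?thesis .
  qed
  have "norm ((F \<epsilon> - \<epsilon> * F' 0) - (F 0 - 0 * F' 0)) \<le> 24 * B * \<epsilon> * norm (\<epsilon> - 0)"
  proof (rule field_differentiable_bound[of "{0..\<epsilon>}" "\<lambda>r. F r - r * F' 0" "\<lambda>r. F' r - F' 0"])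
    fix r assume r: "r \<in> {0..\<epsilon>}"
    have "(F has_real_derivative F' r) (at r within {0..\<epsilon>})"
      unfolding F_def[abs_def] F'_def using r by (intro DERIV_subset[OF evol_deriv[OF pr h]]) auto
    then show "((\<lambda>r. F r - r * F' 0) has_field_derivative F' r - F' 0) (at r within {0..\<epsilon>})"
      by (auto intro!: derivative_eq_intros)
    show "norm (F' r - F' 0) \<le> 24 * B * \<epsilon>" using lip r by simp
  qed (use \<epsilon> in auto)
  then have "\<bar>F \<epsilon> - F 0 - \<epsilon> * F' 0\<bar> \<le> 24 * B * \<epsilon> * \<epsilon>" using \<epsilon> by (simp add: algebra_simps)
  moreover have "(F \<epsilon> - F 0) / \<epsilon> - F' 0 = (F \<epsilon> - F 0 - \<epsilon> * F' 0) / \<epsilon>" using \<epsilon> by (simp add: field_simps)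
  ultimately have "\<bar>(F \<epsilon> - F 0) / \<epsilon> - F' 0\<bar> \<le> 24 * B * \<epsilon>" using \<epsilon> by (simp add: abs_divide divide_le_eq)
  then show ?thesis unfolding F0 F'0 by (simp add: F_def transition_def)
qed

end

end

section \<open>The opinion model on the unit interval\<close>

lemma bdd_meas_iff: "h \<in> bdd_meas \<longleftrightarrow> (\<exists>B>0. h \<in> bounded_meas unit_borel B)"
proof
  assume h: "h \<in> bdd_meas"
  then obtain B where "\<forall>x\<in>{0..1}. \<bar>h x\<bar> \<le> B" by (auto simp: bdd_meas_def bounded_iff)
  then have "h \<in> bounded_meas unit_borel (max B 1)"
    using h by (auto simp: bdd_meas_def bounded_meas_def space_restrict_space le_max_iff_disj)
  then show "\<exists>B>0. h \<in> bounded_meas unit_borel B" by (intro exI[of _ "max B 1"]) auto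
qed (auto simp: bdd_meas_def bounded_meas_def bounded_iff space_restrict_space)

lemma bdd_meas_bounded_meas: "h \<in> bounded_meas unit_borel B \<Longrightarrow> h \<in> bdd_meas"
  by (auto simp: bdd_meas_def bounded_meas_def bounded_iff space_restrict_space)

lemma tv_dist_set: "{\<phi> \<in> borel_measurable unit_borel. \<forall>x\<in>{0..1}. \<bar>\<phi> x\<bar> \<le> 1} = bounded_meas unit_borel 1"
  by (auto simp: bounded_meas_def space_restrict_space)

lemma zero_bounded_meas: "0 \<le> B \<Longrightarrow> (\<lambda>_. 0) \<in> bounded_meas M B"
  by (simp add: bounded_meas_def)

lemma tv_close_tv_dist:
  assumes pr: "\<mu> \<in> probs unit_borel" "\<nu> \<in> probs unit_borel"
  shows "tv_close unit_borel \<mu> \<nu> (tv_dist \<mu> \<nu>)"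
  unfolding tv_close_def
proof
  fix h assume h: "h \<in> bounded_meas unit_borel 1"
  then have h': "(\<lambda>x. - h x) \<in> bounded_meas unit_borel 1" by (auto simp: bounded_meas_def)
  have bdd: "bdd_above ((\<lambda>\<phi>. (\<integral>x. \<phi> x \<partial>\<mu>) - (\<integral>x. \<phi> x \<partial>\<nu>)) ` bounded_meas unit_borel 1)"
    using tv_close_trivial[OF pr] by (auto intro!: bdd_aboveI2[where M=2] simp: tv_close_def abs_le_iff)
  have "(\<integral>x. h x \<partial>\<mu>) - (\<integral>x. h x \<partial>\<nu>) \<le> tv_dist \<mu> \<nu>"
    unfolding tv_dist_def tv_dist_set by (rule cSUP_upper[OF h bdd])
  moreover have "(\<integral>x. - h x \<partial>\<mu>) - (\<integral>x. - h x \<partial>\<nu>) \<le> tv_dist \<mu> \<nu>"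
    unfolding tv_dist_def tv_dist_set by (rule cSUP_upper[OF h' bdd])
  ultimately show "\<bar>(\<integral>x. h x \<partial>\<mu>) - (\<integral>x. h x \<partial>\<nu>)\<bar> \<le> tv_dist \<mu> \<nu>" by simp
qed

lemma tv_dist_le:
  assumes "tv_close unit_borel \<mu> \<nu> a"
  shows "tv_dist \<mu> \<nu> \<le> a"
  unfolding tv_dist_def tv_dist_set
  using assms zero_bounded_meas[of 1] by (intro cSUP_least) (auto simp: tv_close_def abs_le_iff)

text \<open>Partners that are more than \<open>\<Delta>\<close> apart do not interact. Keeping \<open>x\<close> in that case instead of restricting
  the integral makes the jump rate constant.\<close>
definition collide :: "real \<Rightarrow> real \<Rightarrow> real \<times> real \<Rightarrow> real" where
  "collide \<Delta> w = (\<lambda>(x, y). if \<bar>x - y\<bar> \<le> \<Delta> then w * x + (1 - w) * y else x)"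

lemma collision_collide:
  assumes "0 < w" "w < 1"
  shows "collision unit_borel (collide \<Delta> w)"
proof
  have m: "(\<lambda>x. collide \<Delta> w x) \<in> borel_measurable (borel \<Otimes>\<^sub>M borel)"
    unfolding collide_def by measurable
  have "w * x + (1 - w) * y \<in> {0..1}" if "x \<in> {0..1}" "y \<in> {0..1}" for x y
    using that assms convex_bound_le[of x 1 y w "1 - w"] by auto
  then have "collide \<Delta> w \<in> space (unit_borel \<Otimes>\<^sub>M unit_borel) \<rightarrow> {0..1}"
    by (auto simp: space_pair_measure space_restrict_space collide_def)
  moreover have "collide \<Delta> w \<in> borel_measurable (unit_borel \<Otimes>\<^sub>M unit_borel)"
  proof (rule measurable_compose[OF _ m])
    have "fst \<in> unit_borel \<Otimes>\<^sub>M unit_borel \<rightarrow>\<^sub>M unit_borel" "snd \<in> unit_borel \<Otimes>\<^sub>M unit_borel \<rightarrow>\<^sub>M unit_borel"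
      by (rule measurable_fst measurable_snd)+
    then show "(\<lambda>x. x) \<in> unit_borel \<Otimes>\<^sub>M unit_borel \<rightarrow>\<^sub>M borel \<Otimes>\<^sub>M borel"
      by (simp add: measurable_pair_iff comp_def measurable_restrict_space2_iff)
  qed
  ultimately show "collide \<Delta> w \<in> unit_borel \<Otimes>\<^sub>M unit_borel \<rightarrow>\<^sub>M unit_borel"
    by (rule measurable_restrict_space2)
qed

context
  fixes \<Delta> w :: real
  assumes w: "0 < w" "w < 1"
begin

interpretation collision unit_borel "collide \<Delta> w"
  using w by (rule collision_collide)

lemma gen_eq:
  assumes \<mu>: "\<mu> \<in> probs unit_borel" and h: "h \<in> bounded_meas unit_borel B" and x: "x \<in> {0..1}"
  shows "gen \<Delta> w \<mu> h x = 2 * ((\<integral>y. h (collide \<Delta> w (x, y)) \<partial>\<mu>) - h x)"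
proof -
  interpret \<mu>: prob_space \<mu> using prob_algebraD[OF \<mu>] by simp
  have [measurable]: "h \<in> borel_measurable unit_borel" using h by (rule bounded_meas_measurable)
  have [measurable]: "x \<in> space unit_borel" using x by (simp add: space_restrict_space)
  have "(\<lambda>y. h (collide \<Delta> w (x, y))) \<in> bounded_meas unit_borel B"
    using h x measurable_space[OF T_measurable]
    by (auto simp: bounded_meas_def space_pair_measure space_restrict_space)
  from bounded_meas_integrable[OF \<mu> this]
  have "(\<integral>y. h (collide \<Delta> w (x, y)) - h x \<partial>\<mu>) = (\<integral>y. h (collide \<Delta> w (x, y)) \<partial>\<mu>) - h x"
    by (simp add: \<mu>.prob_space)
  moreover have "(h (w * x + (1 - w) * y) - h x) * indicator {y. \<bar>x - y\<bar> \<le> \<Delta>} y = h (collide \<Delta> w (x, y)) - h x" for y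
    by (simp add: collide_def)
  ultimately show ?thesis unfolding gen_def by simp
qed

lemma gen_bdd_meas:
  assumes \<mu>: "\<mu> \<in> probs unit_borel" and h: "h \<in> bdd_meas"
  shows "gen \<Delta> w \<mu> h \<in> bdd_meas"
proof -
  obtain B where h: "h \<in> bounded_meas unit_borel B" using h by (auto simp: bdd_meas_iff)
  note sec = integrate_partner_bounded_meas[OF \<mu> h]
  have "(\<lambda>x. 2 * ((\<integral>y. h (collide \<Delta> w (x, y)) \<partial>\<mu>) - h x)) \<in> bounded_meas unit_borel (4 * B)"
    unfolding bounded_meas_def mem_Collect_eq
  proof safe
    show "(\<lambda>x. 2 * ((\<integral>y. h (collide \<Delta> w (x, y)) \<partial>\<mu>) - h x)) \<in> borel_measurable unit_borel"
      using bounded_meas_measurable[OF sec] bounded_meas_measurable[OF h] by measurable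
    fix x assume "x \<in> space unit_borel"
    from bounded_meas_bound[OF sec this] bounded_meas_bound[OF h this]
    have "\<bar>(\<integral>y. h (collide \<Delta> w (x, y)) \<partial>\<mu>) - h x\<bar> \<le> 2 * B" by linarith
    then show "\<bar>2 * ((\<integral>y. h (collide \<Delta> w (x, y)) \<partial>\<mu>) - h x)\<bar> \<le> 4 * B" by (simp only: abs_mult) simp
  qed
  then have "gen \<Delta> w \<mu> h \<in> bounded_meas unit_borel (4 * B)"
    using gen_eq[OF \<mu> h] measurable_cong[of unit_borel "gen \<Delta> w \<mu> h" "\<lambda>x. 2 * ((\<integral>y. h (collide \<Delta> w (x, y)) \<partial>\<mu>) - h x)" borel]
    by (simp add: bounded_meas_def space_restrict_space del: right_diff_distrib_numeral)
  then show ?thesis by (rule bdd_meas_bounded_meas)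
qed

lemma integral_gen:
  assumes \<mu>: "\<mu> \<in> probs unit_borel" and \<nu>: "\<nu> \<in> probs unit_borel"
    and h: "h \<in> bounded_meas unit_borel B"
  shows "(\<integral>x. gen \<Delta> w \<mu> h x \<partial>\<nu>) = drift h \<nu> \<mu>"
proof -
  have "(\<integral>x. gen \<Delta> w \<mu> h x \<partial>\<nu>) = (\<integral>x. 2 * ((\<integral>y. h (collide \<Delta> w (x, y)) \<partial>\<mu>) - h x) \<partial>\<nu>)"
    using prob_algebraD(3)[OF \<nu>]
    by (intro Bochner_Integration.integral_cong refl gen_eq[OF \<mu> h]) (auto simp: space_restrict_space)
  also have "\<dots> = 2 * ((\<integral>x. (\<integral>y. h (collide \<Delta> w (x, y)) \<partial>\<mu>) \<partial>\<nu>) - (\<integral>x. h x \<partial>\<nu>))"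
    using bounded_meas_integrable[OF \<nu> integrate_partner_bounded_meas[OF \<mu> h]] bounded_meas_integrable[OF \<nu> h] by simp
  finally show ?thesis by (simp add: integral_coll[OF \<nu> \<mu> h])
qed

text \<open>Averaging the generator over the law itself gives the right-hand side of the forward equation.\<close>
lemma problem1_iff: "problem1 \<Delta> w m0 m \<longleftrightarrow> evolves m m \<and> m 0 = m0"
proof (cases "\<forall>t\<ge>0. m t \<in> probs unit_borel")
  case True
  have eq: "(\<integral>x. gen \<Delta> w (m s) h x \<partial>m s) = drift h (m s) (m s)"
    if "h \<in> bounded_meas unit_borel B" "s \<in> {0..t}" for h B s t
    using True that by (intro integral_gen) auto
  have "set_integrable lborel {0..t} (\<lambda>s. \<integral>x. gen \<Delta> w (m s) h x \<partial>m s) =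
      set_integrable lborel {0..t} (\<lambda>s. drift h (m s) (m s))"
    "(LINT s:{0..t}|lborel. (\<integral>x. gen \<Delta> w (m s) h x \<partial>m s)) =
      (LINT s:{0..t}|lborel. drift h (m s) (m s))"
    if "h \<in> bounded_meas unit_borel B" for h B t
    by (rule set_integrable_cong, use eq[OF that] in auto)
       (rule set_lebesgue_integral_cong, use eq[OF that] in auto)
  note eqs = this
  define P where "P (h :: real \<Rightarrow> real) (t :: real) \<longleftrightarrow> set_integrable lborel {0..t} (\<lambda>s. \<integral>x. gen \<Delta> w (m s) h x \<partial>m s) \<and>
        (\<integral>x. h x \<partial>m t) - (\<integral>x. h x \<partial>m 0) = (LINT s:{0..t}|lborel. (\<integral>x. gen \<Delta> w (m s) h x \<partial>m s))" for h t
  define Q where "Q (h :: real \<Rightarrow> real) (t :: real) \<longleftrightarrow> set_integrable lborel {0..t} (\<lambda>s. drift h (m s) (m s)) \<and>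
        (\<integral>x. h x \<partial>m t) - (\<integral>x. h x \<partial>m 0) =
          (LINT s:{0..t}|lborel. drift h (m s) (m s))" for h t
  have "P h t = Q h t" if "h \<in> bounded_meas unit_borel B" for h B t
    unfolding P_def Q_def eqs[OF that] ..
  then have "(\<forall>h\<in>bdd_meas. \<forall>t\<ge>0. P h t) \<longleftrightarrow> (\<forall>B. \<forall>h\<in>bounded_meas unit_borel B. \<forall>t\<ge>0. Q h t)"
    using bdd_meas_iff bdd_meas_bounded_meas by metis
  moreover have "problem1 \<Delta> w m0 m \<longleftrightarrow> (\<forall>t\<ge>0. m t \<in> probs unit_borel) \<and> m 0 = m0 \<and> (\<forall>h\<in>bdd_meas. \<forall>t\<ge>0. P h t)"
    unfolding problem1_def P_def ..
  moreover have "evolves m m \<longleftrightarrow> (\<forall>t\<ge>0. m t \<in> probs unit_borel) \<and> (\<forall>B. \<forall>h\<in>bounded_meas unit_borel B. \<forall>t\<ge>0. Q h t)"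
    unfolding evolves_def Q_def ..
  ultimately show ?thesis by argo
qed (auto simp: problem1_def evolves_def)

context
  fixes m0 assumes m0: "m0 \<in> probs unit_borel"
begin

lemma problem1_evol: "problem1 \<Delta> w m0 (\<lambda>t. evol m0 t m0)"
  unfolding problem1_iff using evolves_evol[OF m0 m0] by (simp add: evol_0[OF m0 m0])

lemma problem1_unique: "problem1 \<Delta> w m0 m \<Longrightarrow> 0 \<le> t \<Longrightarrow> m t = evol m0 t m0"
  using self_evolves_unique[of m "\<lambda>t. evol m0 t m0"] problem1_evol by (auto simp: problem1_iff)

lemma problem1_tv_continuous:
  assumes t: "0 \<le> t"
  shows "((\<lambda>s. tv_dist (evol m0 s m0) (evol m0 t m0)) \<longlongrightarrow> 0) (at t within {0..})"
proof (rule tendsto_sandwich)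
  show "\<forall>\<^sub>F s in at t within {0..}. 0 \<le> tv_dist (evol m0 s m0) (evol m0 t m0)"
    by (intro always_eventually allI tv_close_nonneg[OF tv_close_tv_dist] evol_in_prob_algebra m0)
  show "\<forall>\<^sub>F s in at t within {0..}. tv_dist (evol m0 s m0) (evol m0 t m0) \<le> 4 * \<bar>s - t\<bar>"
    using t by (auto simp: eventually_at_filter intro!: always_eventually tv_dist_le evol_lipschitz m0)
  have "((\<lambda>s. 4 * \<bar>s - t\<bar>) \<longlongrightarrow> 4 * \<bar>t - t\<bar>) (at t within {0..})" by (intro tendsto_intros)
  then show "((\<lambda>s. 4 * \<bar>s - t\<bar>) \<longlongrightarrow> 0) (at t within {0..})" by simp
qed auto

lemma problem1_stability:
  assumes m0': "m0' \<in> probs unit_borel" and m': "problem1 \<Delta> w m0' m'" and t: "0 \<le> t"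
  shows "tv_dist (m' t) (evol m0 t m0) \<le> 2 * tv_dist m0' m0 * exp (12 * t)"
proof (rule tv_dist_le)
  have "tv_close unit_borel (m' 0) (evol m0 0 m0) (tv_dist m0' m0)"
    using m' tv_close_tv_dist[OF m0' m0] by (simp add: problem1_iff evol_0[OF m0 m0])
  then show "tv_close unit_borel (m' t) (evol m0 t m0) (2 * tv_dist m0' m0 * exp (12 * t))"
    using m' problem1_evol t by (intro self_evolves_stability) (auto simp: problem1_iff)
qed

lemma transition_family_transition: "transition_family (transition m0)"
  unfolding transition_family_def
  by (auto simp: transition_measurable[OF m0] transition_self[OF m0] transition_comp[OF m0] space_restrict_space)

lemma transition_lipschitz_bdd:
  assumes "h \<in> bounded_meas unit_borel B" "0 < B"
    and "0 \<le> s" "s \<le> t" "0 \<le> s'" "s' \<le> t'" and x: "x \<in> {0..1}"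
  shows "\<bar>(\<integral>y. h y \<partial>transition m0 s t x) - (\<integral>y. h y \<partial>transition m0 s' t' x)\<bar> \<le> B * (4 * (\<bar>s - s'\<bar> + \<bar>t - t'\<bar>))"
  by (rule tv_close_scaled[OF transition_lipschitz[OF m0] assms(1,2)]) (use assms in \<open>auto simp: space_restrict_space\<close>)

lemma has_generator_transition: "has_generator (transition m0) (\<lambda>t. gen \<Delta> w (evol m0 t m0))"
  unfolding has_generator_def
proof (intro conjI ballI allI impI)
  fix h and s t :: real assume h: "h \<in> bdd_meas" and st: "0 \<le> s \<and> s \<le> t"
  obtain B where B: "0 < B" "h \<in> bounded_meas unit_borel B" using h by (auto simp: bdd_meas_iff)
  let ?S = "{(s', t'). 0 \<le> s' \<and> s' \<le> (t'::real)}"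
  show "uniform_limit {0..1} (\<lambda>(s', t') x. \<integral>y. h y \<partial>transition m0 s' t' x) (\<lambda>x. \<integral>y. h y \<partial>transition m0 s t x)
          (at (s, t) within ?S)"
  proof (rule uniform_limitI)
    fix e :: real assume e: "0 < e"
    have "((\<lambda>p. B * (4 * (\<bar>fst p - s\<bar> + \<bar>snd p - t\<bar>))) \<longlongrightarrow> B * (4 * (\<bar>fst (s, t) - s\<bar> + \<bar>snd (s, t) - t\<bar>))) (at (s, t) within ?S)"
      by (intro tendsto_intros)
    then have "\<forall>\<^sub>F p in at (s, t) within ?S. B * (4 * (\<bar>fst p - s\<bar> + \<bar>snd p - t\<bar>)) < e"
      using e by (intro order_tendstoD) auto
    moreover have "\<forall>\<^sub>F p in at (s, t) within ?S. p \<in> ?S" by (auto simp: eventually_at_filter)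
    ultimately show "\<forall>\<^sub>F p in at (s, t) within ?S. \<forall>x\<in>{0..1}.
        dist ((case p of (s', t') \<Rightarrow> \<lambda>x. \<integral>y. h y \<partial>transition m0 s' t' x) x) (\<integral>y. h y \<partial>transition m0 s t x) < e"
    proof eventually_elim
      case (elim p)
      obtain s' t' where p: "p = (s', t')" by (cases p)
      show ?case
      proof
        fix x :: real assume x: "x \<in> {0..1}"
        have "\<bar>(\<integral>y. h y \<partial>transition m0 s' t' x) - (\<integral>y. h y \<partial>transition m0 s t x)\<bar> \<le> B * (4 * (\<bar>s' - s\<bar> + \<bar>t' - t\<bar>))"
          using elim st by (intro transition_lipschitz_bdd[OF B(2,1)] x) (auto simp: p)
        then show "dist ((case p of (s', t') \<Rightarrow> \<lambda>x. \<integral>y. h y \<partial>transition m0 s' t' x) x) (\<integral>y. h y \<partial>transition m0 s t x) < e"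
          using elim(1) by (simp add: p dist_real_def)
      qed
    qed
  qed
next
  fix h and t :: real assume h: "h \<in> bdd_meas" and t: "0 \<le> t"
  obtain B where B: "0 < B" "h \<in> bounded_meas unit_borel B" using h by (auto simp: bdd_meas_iff)
  show "uniform_limit {0..1} (\<lambda>\<epsilon> x. ((\<integral>y. h y \<partial>transition m0 t (t + \<epsilon>) x) - h x) / \<epsilon>)
     (gen \<Delta> w (evol m0 t m0) h) (at_right 0)"
  proof (rule uniform_limitI)
    fix e :: real assume e: "0 < e"
    have "((\<lambda>\<epsilon>. 24 * B * \<epsilon>) \<longlongrightarrow> 24 * B * 0) (at_right 0)" by (intro tendsto_intros)
    then have "\<forall>\<^sub>F \<epsilon> in at_right 0. 24 * B * \<epsilon> < e" using e by (intro order_tendstoD) auto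
    moreover have "\<forall>\<^sub>F \<epsilon> in at_right 0. (0::real) < \<epsilon>" by (auto simp: eventually_at_filter)
    ultimately show "\<forall>\<^sub>F \<epsilon> in at_right 0. \<forall>x\<in>{0..1}.
        dist (((\<integral>y. h y \<partial>transition m0 t (t + \<epsilon>) x) - h x) / \<epsilon>) (gen \<Delta> w (evol m0 t m0) h x) < e"
    proof eventually_elim
      case (elim \<epsilon>)
      show ?case
      proof
        fix x :: real assume x: "x \<in> {0..1}"
        then have "x \<in> space unit_borel" by (simp add: space_restrict_space)
        from transition_generator[OF m0 B(2,1) this elim(2) t]
        show "dist (((\<integral>y. h y \<partial>transition m0 t (t + \<epsilon>) x) - h x) / \<epsilon>) (gen \<Delta> w (evol m0 t m0) h x) < e"
          unfolding gen_eq[OF flow_in_prob_algebra[OF m0] B(2) x] dist_real_def using elim(1) by linarith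
      qed
    qed
  qed
qed

end
end

section \<open>The generator determines the transition kernels\<close>

text \<open>The mean value theorem needs a two-sided derivative; with a right derivative only, the slope bound
  \<open>e\<close> is propagated to the right: the set of points up to which it holds has a supremum, at which
  it holds by continuity and beyond which it extends by the assumption on the right derivative.\<close>
lemma right_derivative_zero_imp_eq:
  fixes f :: "real \<Rightarrow> real"
  assumes ab: "a \<le> b" and cont: "continuous_on {a..b} f"
    and deriv: "\<And>x. a \<le> x \<Longrightarrow> x < b \<Longrightarrow> ((\<lambda>\<epsilon>. (f (x + \<epsilon>) - f x) / \<epsilon>) \<longlongrightarrow> 0) (at_right 0)"
  shows "f b = f a"
proof -
  have "\<bar>f b - f a\<bar> \<le> e * (b - a)" if e: "0 < e" for e
  proof -
    define S where "S = {x \<in> {a..b}. \<forall>y\<in>{a..x}. \<bar>f y - f a\<bar> \<le> e * (y - a)}"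
    define c where "c = Sup S"
    have aS: "a \<in> S" using ab by (auto simp: S_def)
    have bdd: "bdd_above S" by (auto simp: S_def bdd_above_def)
    have ac: "a \<le> c" unfolding c_def by (rule cSup_upper[OF aS bdd])
    have cb: "c \<le> b" unfolding c_def using aS by (intro cSup_least) (auto simp: S_def)
    have below: "\<bar>f y - f a\<bar> \<le> e * (y - a)" if "a \<le> y" "y < c" for y
    proof -
      have "y < Sup S" using that by (simp add: c_def)
      then obtain x where "x \<in> S" "y < x" using aS by (auto elim: less_cSupE)
      then show ?thesis using \<open>a \<le> y\<close> by (auto simp: S_def)
    qed
    have at_c: "\<bar>f c - f a\<bar> \<le> e * (c - a)"
    proof (cases "a = c")
      case False
      have "(f \<longlongrightarrow> f c) (at c within {a..c})"
        by (rule tendsto_within_subset[of f _ c "{a..b}"]) (use cont ac cb in \<open>auto simp: continuous_on_def\<close>)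
      then have "((\<lambda>y. e * (y - a) - \<bar>f y - f a\<bar>) \<longlongrightarrow> e * (c - a) - \<bar>f c - f a\<bar>) (at c within {a..c})"
        by (intro tendsto_intros)
      moreover have "\<forall>\<^sub>F y in at c within {a..c}. 0 \<le> e * (y - a) - \<bar>f y - f a\<bar>"
        using below by (auto simp: eventually_at_filter intro!: always_eventually)
      moreover have "at c within {a..c} \<noteq> bot"
        using False ac by (simp add: at_within_Icc_at_left)
      ultimately have "0 \<le> e * (c - a) - \<bar>f c - f a\<bar>" by (rule tendsto_lowerbound)
      then show ?thesis by simp
    qed simp
    have "c = b"
    proof (rule ccontr)
      assume "c \<noteq> b"
      then have "c < b" using cb by simp
      from deriv[OF ac this] have "\<forall>\<^sub>F \<epsilon> in at_right 0. dist ((f (c + \<epsilon>) - f c) / \<epsilon>) 0 < e"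
        using e by (rule tendstoD)
      then obtain d where d: "d > 0" "\<And>\<epsilon>. 0 < \<epsilon> \<Longrightarrow> \<epsilon> < d \<Longrightarrow> \<bar>f (c + \<epsilon>) - f c\<bar> < e * \<epsilon>"
        unfolding eventually_at_right_field dist_real_def by (fastforce simp: abs_divide divide_less_eq)
      define z where "z = min b (c + d / 2)"
      have "z \<in> S" unfolding S_def
      proof safe
        fix y assume y: "y \<in> {a..z}"
        show "\<bar>f y - f a\<bar> \<le> e * (y - a)"
        proof (cases "y \<le> c")
          case True
          then show ?thesis using below at_c y by (cases "y = c") auto
        next
          case False
          then have "\<bar>f (c + (y - c)) - f c\<bar> < e * (y - c)"
            using y d(1) by (intro d(2)) (auto simp: z_def)
          then show ?thesis using at_c by (simp add: algebra_simps)
        qed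
      qed (use \<open>c < b\<close> ac d in \<open>auto simp: z_def\<close>)
      then have "z \<le> c" unfolding c_def by (rule cSup_upper[OF _ bdd])
      then show False using \<open>c < b\<close> d by (auto simp: z_def min_def split: if_splits)
    qed
    then show ?thesis using at_c by simp
  qed
  \<comment> \<open>Any positive slope is allowed, so the difference is below any positive number.\<close>
  note bound = this
  have "\<bar>f b - f a\<bar> \<le> 0 + e" if "0 < e" for e :: real
    using that ab bound[of "e / (b - a)"] by (cases "a = b") auto
  then have "\<bar>f b - f a\<bar> \<le> 0" by (rule field_le_epsilon)
  then show ?thesis by simp
qed

lemma transition_familyD:
  assumes "transition_family P" "0 \<le> s" "s \<le> t"
  shows "P s t \<in> unit_borel \<rightarrow>\<^sub>M prob_algebra unit_borel"
    "x \<in> {0..1} \<Longrightarrow> P s t x \<in> probs unit_borel"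
    "x \<in> {0..1} \<Longrightarrow> P s s x = return unit_borel x"
    "t \<le> u \<Longrightarrow> x \<in> {0..1} \<Longrightarrow> P s u x = P s t x \<bind> P t u"
proof -
  show *: "P s t \<in> unit_borel \<rightarrow>\<^sub>M prob_algebra unit_borel"
    using assms by (auto simp: transition_family_def)
  show "x \<in> {0..1} \<Longrightarrow> P s t x \<in> probs unit_borel"
    by (rule measurable_space[OF *]) (simp add: space_restrict_space)
qed (use assms in \<open>auto simp: transition_family_def\<close>)

lemma has_generator_continuous:
  assumes gen: "has_generator P A" and h: "h \<in> bdd_meas" and x: "x \<in> {0..1}" and s: "0 \<le> s"
  shows "continuous_on {s..} (\<lambda>r. \<integral>y. h y \<partial>P s r x)"
  unfolding continuous_on_def
proof
  fix r assume r: "r \<in> {s..}"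
  let ?S = "{(s', t'). 0 \<le> s' \<and> s' \<le> (t'::real)}"
  have "uniform_limit {0..1} (\<lambda>(s', t') x. \<integral>y. h y \<partial>P s' t' x) (\<lambda>x. \<integral>y. h y \<partial>P s r x) (at (s, r) within ?S)"
    using gen h r s unfolding has_generator_def by auto
  from tendsto_uniform_limitI[OF this x]
  have lim: "((\<lambda>(s', t'). \<integral>y. h y \<partial>P s' t' x) \<longlongrightarrow> (\<integral>y. h y \<partial>P s r x)) (at (s, r) within ?S)"
    by (simp add: split_beta')
  have "filterlim (\<lambda>t'. (s, t')) (at (s, r) within ?S) (at r within {s..})"
    unfolding filterlim_at using s by (auto simp: eventually_at_filter intro!: tendsto_intros)
  from filterlim_compose[OF lim this]
  show "((\<lambda>r. \<integral>y. h y \<partial>P s r x) \<longlongrightarrow> (\<integral>y. h y \<partial>P s r x)) (at r within {s..})" by simp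
qed

lemma has_generator_uniform_right:
  assumes P: "transition_family P" and gen: "has_generator P A" and h: "h \<in> bdd_meas" and r: "0 \<le> r"
  shows "uniform_limit {0..1} (\<lambda>\<epsilon> x. \<integral>y. h y \<partial>P r (r + \<epsilon>) x) h (at_right 0)"
proof -
  let ?S = "{(s', t'). 0 \<le> s' \<and> s' \<le> (t'::real)}"
  have hm: "h \<in> borel_measurable unit_borel" using h by (simp add: bdd_meas_def)
  have "uniform_limit {0..1} (\<lambda>(s', t') x. \<integral>y. h y \<partial>P s' t' x) (\<lambda>x. \<integral>y. h y \<partial>P r r x) (at (r, r) within ?S)"
    using gen h r unfolding has_generator_def by auto
  moreover have "filterlim (\<lambda>\<epsilon>. (r, r + \<epsilon>)) (at (r, r) within ?S) (at_right 0)"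
  proof -
    have "((\<lambda>\<epsilon>. (r, r + \<epsilon>)) \<longlongrightarrow> (r, r + 0)) (at_right 0)" by (intro tendsto_intros)
    then show ?thesis unfolding filterlim_at using r by (auto simp: eventually_at_filter)
  qed
  ultimately have "uniform_limit {0..1} (\<lambda>\<epsilon>. (\<lambda>(s', t') x. \<integral>y. h y \<partial>P s' t' x) (r, r + \<epsilon>)) (\<lambda>x. \<integral>y. h y \<partial>P r r x) (at_right 0)"
    by (rule filterlim_compose)
  moreover have "(\<integral>y. h y \<partial>P r r x) = h x" if "x \<in> {0..1}" for x
    using transition_familyD(3)[OF P r order_refl that] hm that by (simp add: integral_return space_restrict_space)
  ultimately show ?thesis by (simp add: uniform_limit_iff)
qed

text \<open>For \<open>h\<close> bounded measurable the function \<open>r \<mapsto> P'\<^sub>s\<^sub>,\<^sub>r P\<^sub>r\<^sub>,\<^sub>t h (x)\<close> interpolates between \<open>P\<^sub>s\<^sub>,\<^sub>t h (x)\<close> and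
  \<open>P'\<^sub>s\<^sub>,\<^sub>t h (x)\<close>. It is continuous, and its right derivative is \<open>P'\<^sub>s\<^sub>,\<^sub>r (A\<^sub>r - A\<^sub>r) P\<^sub>r\<^sub>,\<^sub>t h (x) = 0\<close>, so it is constant. The
  Lipschitz bound on \<open>P\<close> compensates for the fact that the generator is only a strong limit, while the function
  \<open>P\<^sub>r\<^sub>,\<^sub>t h\<close> to which it is applied varies with \<open>r\<close>.\<close>
lemma generator_determines_transitions:
  assumes P: "transition_family P" "has_generator P A" and P': "transition_family P'" "has_generator P' A"
    and A: "\<And>t h. 0 \<le> t \<Longrightarrow> h \<in> bdd_meas \<Longrightarrow> A t h \<in> bdd_meas"
    and lip: "\<And>h B s t s' t' x. h \<in> bounded_meas unit_borel B \<Longrightarrow> 0 < B \<Longrightarrow> 0 \<le> s \<Longrightarrow> s \<le> t \<Longrightarrow> 0 \<le> s' \<Longrightarrow> s' \<le> t' \<Longrightarrow>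
      x \<in> {0..1} \<Longrightarrow> \<bar>(\<integral>y. h y \<partial>P s t x) - (\<integral>y. h y \<partial>P s' t' x)\<bar> \<le> B * (4 * (\<bar>s - s'\<bar> + \<bar>t - t'\<bar>))"
    and st: "0 \<le> s" "s \<le> t" and x: "x \<in> {0..1}"
  shows "P' s t x = P s t x"
proof (rule prob_measure_eqI)
  show "P' s t x \<in> probs unit_borel" "P s t x \<in> probs unit_borel"
    using transition_familyD(2)[OF P(1) st x] transition_familyD(2)[OF P'(1) st x] by auto
  fix h assume h: "h \<in> bounded_meas unit_borel 1"
  note sp = space_restrict_space
  define g where "g r y = (\<integral>z. h z \<partial>P r t y)" for r y
  have g: "g r \<in> bounded_meas unit_borel 1" if "0 \<le> r" "r \<le> t" for r
    unfolding g_def[abs_def] by (rule bounded_meas_kernel[OF transition_familyD(1)[OF P(1) that] h])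
  note gb = bdd_meas_bounded_meas[OF g]
  have glip: "\<bar>g r y - g r' y\<bar> \<le> 4 * \<bar>r - r'\<bar>" if "0 \<le> r" "r \<le> t" "0 \<le> r'" "r' \<le> t" "y \<in> {0..1}" for r r' y
    using lip[OF h _ that(1,2,3,4,5)] by (simp add: g_def)
  define \<phi> where "\<phi> r = (\<integral>y. g r y \<partial>P' s r x)" for r
  have pr': "P' s r x \<in> probs unit_borel" if "s \<le> r" for r
    by (rule transition_familyD(2)[OF P'(1) st(1) that x])
  have "\<phi> t = \<phi> s"
  proof (rule right_derivative_zero_imp_eq[OF st(2)])
    show "continuous_on {s..t} \<phi>" unfolding continuous_on_def
    proof
      fix r assume r: "r \<in> {s..t}"
      then have r0: "0 \<le> r" "r \<le> t" using st by auto
      have "((\<lambda>r'. \<integral>y. g r y \<partial>P' s r' x) \<longlongrightarrow> (\<integral>y. g r y \<partial>P' s r x)) (at r within {s..t})"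
        by (rule tendsto_within_subset[of _ _ r "{s..}"])
           (use has_generator_continuous[OF P'(2) gb[OF r0] x st(1)] r in \<open>auto simp: continuous_on_def\<close>)
      moreover have "((\<lambda>r'. \<phi> r' - (\<integral>y. g r y \<partial>P' s r' x)) \<longlongrightarrow> 0) (at r within {s..t})"
      proof (rule Lim_null_comparison)
        show "\<forall>\<^sub>F r' in at r within {s..t}. norm (\<phi> r' - (\<integral>y. g r y \<partial>P' s r' x)) \<le> 4 * \<bar>r' - r\<bar>"
          unfolding eventually_at_filter
        proof (intro always_eventually allI impI)
          fix r' assume "r' \<noteq> r" "r' \<in> {s..t}"
          then have r': "0 \<le> r'" "r' \<le> t" "s \<le> r'" using st by auto
          have "\<phi> r' - (\<integral>y. g r y \<partial>P' s r' x) = (\<integral>y. g r' y - g r y \<partial>P' s r' x)"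
            unfolding \<phi>_def
            by (rule Bochner_Integration.integral_diff[symmetric];
                rule bounded_meas_integrable[OF pr'[OF r'(3)] g]) (use r0 r' in auto)
          also have "\<bar>\<dots>\<bar> \<le> 4 * \<bar>r' - r\<bar>"
            by (rule bounded_meas_integral[OF pr'[OF r'(3)]])
               (use glip[OF r'(1,2) r0] bounded_meas_measurable[OF g[OF r'(1,2)]] bounded_meas_measurable[OF g[OF r0]]
                 in \<open>auto simp: bounded_meas_def sp\<close>)
          finally show "norm (\<phi> r' - (\<integral>y. g r y \<partial>P' s r' x)) \<le> 4 * \<bar>r' - r\<bar>" by simp
        qed
        have "((\<lambda>r'. 4 * \<bar>r' - r\<bar>) \<longlongrightarrow> 4 * \<bar>r - r\<bar>) (at r within {s..t})" by (intro tendsto_intros)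
        then show "((\<lambda>r'. 4 * \<bar>r' - r\<bar>) \<longlongrightarrow> 0) (at r within {s..t})" by simp
      qed
      ultimately have "((\<lambda>r'. (\<phi> r' - (\<integral>y. g r y \<partial>P' s r' x)) + (\<integral>y. g r y \<partial>P' s r' x)) \<longlongrightarrow> 0 + (\<integral>y. g r y \<partial>P' s r x)) (at r within {s..t})"
        by (intro tendsto_add)
      then show "(\<phi> \<longlongrightarrow> \<phi> r) (at r within {s..t})" by (simp add: \<phi>_def[abs_def])
    qed
  next
    fix r assume r: "s \<le> r" "r < t"
    then have r0: "0 \<le> r" "r \<le> t" using st by auto
    define a where "a = A r (g r)"
    have a: "a \<in> bdd_meas" unfolding a_def by (rule A[OF r0(1) gb[OF r0]])
    then obtain Ba where Ba: "0 < Ba" "a \<in> bounded_meas unit_borel Ba" by (auto simp: bdd_meas_iff)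
    show "((\<lambda>\<epsilon>. (\<phi> (r + \<epsilon>) - \<phi> r) / \<epsilon>) \<longlongrightarrow> 0) (at_right 0)"
    proof (rule tendstoI)
      fix e' :: real assume e': "0 < e'"
      \<comment> \<open>The difference quotient splits into four parts, each of which is bounded by \<open>e\<close>.\<close>
      define e where "e = e' / 5"
      have e: "0 < e" "4 * e < e'" using e' by (auto simp: e_def)
      have "uniform_limit {0..1} (\<lambda>\<epsilon> z. ((\<integral>y. g r y \<partial>P r (r + \<epsilon>) z) - g r z) / \<epsilon>) a (at_right 0)"
        using P(2) gb[OF r0] r0 unfolding has_generator_def a_def by auto
      from uniform_limitD[OF this e(1)]
      have E1: "\<forall>\<^sub>F \<epsilon> in at_right 0. \<forall>z\<in>{0..1}. \<bar>((\<integral>y. g r y \<partial>P r (r + \<epsilon>) z) - g r z) / \<epsilon> - a z\<bar> < e"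
        by (simp add: dist_real_def)
      have "uniform_limit {0..1} (\<lambda>\<epsilon> z. ((\<integral>y. g r y \<partial>P' r (r + \<epsilon>) z) - g r z) / \<epsilon>) a (at_right 0)"
        using P'(2) gb[OF r0] r0 unfolding has_generator_def a_def by auto
      from uniform_limitD[OF this e(1)]
      have E3: "\<forall>\<^sub>F \<epsilon> in at_right 0. \<forall>z\<in>{0..1}. \<bar>((\<integral>y. g r y \<partial>P' r (r + \<epsilon>) z) - g r z) / \<epsilon> - a z\<bar> < e"
        by (simp add: dist_real_def)
      from uniform_limitD[OF has_generator_uniform_right[OF P' a r0(1)] e(1)]
      have E2: "\<forall>\<^sub>F \<epsilon> in at_right 0. \<forall>z\<in>{0..1}. \<bar>(\<integral>y. a y \<partial>P' r (r + \<epsilon>) z) - a z\<bar> < e"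
        by (simp add: dist_real_def)
      have E4: "\<forall>\<^sub>F \<epsilon> in at_right (0::real). 0 < \<epsilon> \<and> \<epsilon> < e / 16 \<and> \<epsilon> < t - r"
        unfolding eventually_at_right_field using e r by (intro exI[of _ "min (e / 16) (t - r)"]) auto
      show "\<forall>\<^sub>F \<epsilon> in at_right 0. dist ((\<phi> (r + \<epsilon>) - \<phi> r) / \<epsilon>) 0 < e'"
        using E1 E2 E3 E4
      proof eventually_elim
        case (elim \<epsilon>)
        define q where "q = r + \<epsilon>"
        have \<epsilon>: "0 < \<epsilon>" and q: "0 \<le> q" "q \<le> t" "r \<le> q" "s \<le> q" using elim(4) r0 r by (auto simp: q_def)
        note gq = g[OF q(1,2)] and gr = g[OF r0]
        note Pz = transition_familyD(2)[OF P(1) r0(1) q(3)] and P'z = transition_familyD(2)[OF P'(1) r0(1) q(3)]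
        define v where "v z = g q z - g r z" for z
        have v: "v \<in> bounded_meas unit_borel (4 * \<epsilon>)"
          using glip[OF q(1,2) r0] bounded_meas_measurable[OF gq] bounded_meas_measurable[OF gr] \<epsilon>
          by (auto simp: bounded_meas_def sp v_def[abs_def] q_def)
        \<comment> \<open>\<open>u\<close> is the error in the backward equation: the derivative of \<open>r \<mapsto> P\<^sub>r\<^sub>,\<^sub>t h\<close> is \<open>- a\<close>.\<close>
        define u where "u z = v z / \<epsilon> + a z" for z
        have u_bd: "\<bar>u z\<bar> \<le> 2 * e" if z: "z \<in> {0..1}" for z
        proof -
          have zs: "z \<in> space unit_borel" using z by (simp add: sp)
          have "g r z = (\<integral>y. g q y \<partial>P r q z)"
            unfolding g_def[of r] transition_familyD(4)[OF P(1) r0(1) q(3,2) z] g_def[of q, abs_def]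
            by (rule integral_bind_prob[OF Pz[OF z] transition_familyD(1)[OF P(1) q(1,2)] h])
          also have "\<dots> = (\<integral>y. g r y + v y \<partial>P r q z)" by (simp add: v_def)
          also have "\<dots> = (\<integral>y. g r y \<partial>P r q z) + (\<integral>y. v y \<partial>P r q z)"
            by (rule Bochner_Integration.integral_add[OF bounded_meas_integrable[OF Pz[OF z] gr] bounded_meas_integrable[OF Pz[OF z] v]])
          finally have eq: "g r z = (\<integral>y. g r y \<partial>P r q z) + (\<integral>y. v y \<partial>P r q z)" .
          \<comment> \<open>The function \<open>v\<close> and the effect of the kernel on it are both of order \<open>\<epsilon>\<close>, so this term is of second order.\<close>
          have "\<bar>(\<integral>y. v y \<partial>P r q z) - (\<integral>y. v y \<partial>P r r z)\<bar> \<le> (4 * \<epsilon>) * (4 * (\<bar>r - r\<bar> + \<bar>q - r\<bar>))"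
            using \<epsilon> q r0 by (intro lip[OF v]) (use z in auto)
          moreover have "(\<integral>y. v y \<partial>P r r z) = v z"
            using transition_familyD(3)[OF P(1) r0(1) order_refl z] zs bounded_meas_measurable[OF v]
            by (simp add: integral_return)
          ultimately have "\<bar>(\<integral>y. v y \<partial>P r q z) - v z\<bar> \<le> 16 * \<epsilon> * \<epsilon>" using \<epsilon> by (simp add: q_def)
          then have "\<bar>((\<integral>y. v y \<partial>P r q z) - v z) / \<epsilon>\<bar> \<le> 16 * \<epsilon>" using \<epsilon> by (simp add: abs_divide divide_le_eq)
          then have 1: "\<bar>((\<integral>y. v y \<partial>P r q z) - v z) / \<epsilon>\<bar> < e" using elim(4) by linarith
          have 2: "\<bar>((\<integral>y. g r y \<partial>P r q z) - g r z) / \<epsilon> - a z\<bar> < e" using elim(1) z by (simp add: q_def)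
          have "((\<integral>y. g r y \<partial>P r q z) - g r z) / \<epsilon> = - (\<integral>y. v y \<partial>P r q z) / \<epsilon>" using eq by (simp add: field_simps)
          then have "u z = - (((\<integral>y. g r y \<partial>P r q z) - g r z) / \<epsilon> - a z) - (((\<integral>y. v y \<partial>P r q z) - v z) / \<epsilon>)"
            by (simp add: u_def diff_divide_distrib)
          then show ?thesis using 1 2 by linarith
        qed
        have u: "u \<in> bounded_meas unit_borel (2 * e)"
          using u_bd bounded_meas_measurable[OF v] bounded_meas_measurable[OF Ba(2)]
          by (auto simp: bounded_meas_def sp u_def[abs_def])
        define D where "D z = ((\<integral>y. g q y \<partial>P' r q z) - g r z) / \<epsilon>" for z
        have D_bd: "\<bar>D z\<bar> \<le> 4 * e" if z: "z \<in> {0..1}" for z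
        proof -
          have "g q y = g r y + (\<epsilon> * u y - \<epsilon> * a y)" for y using \<epsilon> by (simp add: u_def v_def field_simps)
          then have "(\<integral>y. g q y \<partial>P' r q z) = (\<integral>y. g r y + (\<epsilon> * u y - \<epsilon> * a y) \<partial>P' r q z)" by simp
          also have "\<dots> = (\<integral>y. g r y \<partial>P' r q z) + (\<epsilon> * (\<integral>y. u y \<partial>P' r q z) - \<epsilon> * (\<integral>y. a y \<partial>P' r q z))"
            using bounded_meas_integrable[OF P'z[OF z] gr] bounded_meas_integrable[OF P'z[OF z] u]
              bounded_meas_integrable[OF P'z[OF z] Ba(2)] by simp
          finally have "D z = (((\<integral>y. g r y \<partial>P' r q z) - g r z) / \<epsilon> - a z) + (\<integral>y. u y \<partial>P' r q z) - ((\<integral>y. a y \<partial>P' r q z) - a z)"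
            using \<epsilon> unfolding D_def by (simp add: field_simps)
          moreover have "\<bar>\<integral>y. u y \<partial>P' r q z\<bar> \<le> 2 * e" by (rule bounded_meas_integral[OF P'z[OF z] u])
          moreover have "\<bar>((\<integral>y. g r y \<partial>P' r q z) - g r z) / \<epsilon> - a z\<bar> < e" using elim(3) z by (simp add: q_def)
          moreover have "\<bar>(\<integral>y. a y \<partial>P' r q z) - a z\<bar> < e" using elim(2) z by (simp add: q_def)
          ultimately show ?thesis by linarith
        qed
        note K = bounded_meas_kernel[OF transition_familyD(1)[OF P'(1) r0(1) q(3)] gq]
        have D: "D \<in> bounded_meas unit_borel (4 * e)"
          using D_bd bounded_meas_measurable[OF K] bounded_meas_measurable[OF gr]
          by (auto simp: bounded_meas_def sp D_def[abs_def])
        have "\<phi> q = (\<integral>z. (\<integral>y. g q y \<partial>P' r q z) \<partial>P' s r x)"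
          unfolding \<phi>_def transition_familyD(4)[OF P'(1) st(1) r(1) q(3) x]
          by (rule integral_bind_prob[OF pr'[OF r(1)] transition_familyD(1)[OF P'(1) r0(1) q(3)] gq])
        then have "(\<phi> q - \<phi> r) / \<epsilon> = (\<integral>z. D z \<partial>P' s r x)"
          using bounded_meas_integrable[OF pr'[OF r(1)] K] bounded_meas_integrable[OF pr'[OF r(1)] gr]
          by (simp add: \<phi>_def[of r] D_def)
        then have "\<bar>(\<phi> q - \<phi> r) / \<epsilon>\<bar> \<le> 4 * e" using bounded_meas_integral[OF pr'[OF r(1)] D] by simp
        then show ?case using e(2) by (simp add: q_def)
      qed
    qed
  qed
  moreover have "\<phi> t = (\<integral>y. h y \<partial>P' s t x)"
    unfolding \<phi>_def using st prob_algebraD(3)[OF pr'[OF st(2)]] bounded_meas_measurable[OF h]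
    by (intro Bochner_Integration.integral_cong refl)
       (auto simp: g_def sp transition_familyD(3)[OF P(1) _ order_refl] integral_return)
  moreover have "\<phi> s = (\<integral>y. h y \<partial>P s t x)"
    unfolding \<phi>_def transition_familyD(3)[OF P'(1) st(1) order_refl x]
    using x bounded_meas_measurable[OF g[OF st]] by (subst integral_return) (auto simp: sp g_def)
  ultimately show "(\<integral>y. h y \<partial>P' s t x) = (\<integral>y. h y \<partial>P s t x)" by simp
qed

section \<open>Finite-dimensional distributions and the Markov property\<close>

text \<open>The integral of a product of functions of the positions at the times \<open>ts\<close>, for a Markov process that is at \<open>x\<close>
  at time \<open>s\<close>. The recursion runs backwards in time, so that integrating out the first time is one application of the
  kernel.\<close>
fun fdd_int :: "(real \<Rightarrow> real \<Rightarrow> real \<Rightarrow> real measure) \<Rightarrow> (real \<Rightarrow> real \<Rightarrow> ennreal) \<Rightarrow> real list \<Rightarrow> real \<Rightarrow> real \<Rightarrow> ennreal" where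
  "fdd_int P f [] s x = 1"
| "fdd_int P f (t # ts) s x = (\<integral>\<^sup>+y. f t y * fdd_int P f ts t y \<partial>P s t x)"

lemma nn_integral_prob_cong:
  assumes "\<mu> \<in> probs unit_borel" "\<And>y. y \<in> {0..1} \<Longrightarrow> f y = g y"
  shows "(\<integral>\<^sup>+y. f y \<partial>\<mu>) = (\<integral>\<^sup>+y. g y \<partial>\<mu>)"
  using assms prob_algebraD(3)[OF assms(1)] by (intro nn_integral_cong) (auto simp: space_restrict_space)

lemma kernel_nn_measurable:
  assumes "K \<in> L \<rightarrow>\<^sub>M prob_algebra N" "f \<in> borel_measurable N"
  shows "(\<lambda>x. \<integral>\<^sup>+y. f y \<partial>K x) \<in> borel_measurable L"
  using measurable_compose[OF measurable_prob_algebraD[OF assms(1)] nn_integral_measurable_subprob_algebra[OF assms(2)]] .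

lemma fdd_int_measurable:
  assumes P: "transition_family P"
  shows "0 \<le> s \<Longrightarrow> sorted (s # ts) \<Longrightarrow> (\<And>t. t \<in> set ts \<Longrightarrow> f t \<in> borel_measurable unit_borel) \<Longrightarrow>
    fdd_int P f ts s \<in> borel_measurable unit_borel"
proof (induction ts arbitrary: s)
  case (Cons t ts)
  have [measurable]: "fdd_int P f ts t \<in> borel_measurable unit_borel" "f t \<in> borel_measurable unit_borel"
    using Cons by auto
  have "P s t \<in> unit_borel \<rightarrow>\<^sub>M prob_algebra unit_borel" using transition_familyD(1)[OF P] Cons by auto
  from kernel_nn_measurable[OF this, of "\<lambda>y. f t y * fdd_int P f ts t y"]
  show ?case by (simp add: fun_eq_iff[symmetric] fdd_int.simps(2)[abs_def])
qed (simp add: fdd_int.simps(1)[abs_def])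

lemma fdd_int_cong:
  assumes P: "transition_family P"
    and eq: "\<And>s t x. 0 \<le> s \<Longrightarrow> s \<le> t \<Longrightarrow> x \<in> {0..1} \<Longrightarrow> P' s t x = P s t x"
  shows "0 \<le> s \<Longrightarrow> sorted (s # ts) \<Longrightarrow> x \<in> {0..1} \<Longrightarrow> (\<And>t y. t \<in> set ts \<Longrightarrow> y \<in> {0..1} \<Longrightarrow> f t y = g t y) \<Longrightarrow>
    fdd_int P' f ts s x = fdd_int P g ts s x"
proof (induction ts arbitrary: s x)
  case (Cons t ts)
  have "0 \<le> s" "s \<le> t" using Cons by auto
  from transition_familyD(2)[OF P this Cons.prems(3)] show ?case
    unfolding fdd_int.simps eq[OF \<open>0 \<le> s\<close> \<open>s \<le> t\<close> Cons.prems(3)]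
    by (rule nn_integral_prob_cong) (use Cons in auto)
qed simp

text \<open>A time at which nothing is tested can be dropped, by Chapman-Kolmogorov or, if it is the last
  one, because kernels have mass one. This is the consistency of the finite-dimensional distributions.\<close>
lemma fdd_int_insort:
  assumes P: "transition_family P"
  shows "0 \<le> s \<Longrightarrow> sorted (s # ts) \<Longrightarrow> s \<le> t \<Longrightarrow> x \<in> {0..1} \<Longrightarrow> t \<notin> set ts \<Longrightarrow> (\<And>y. y \<in> {0..1} \<Longrightarrow> f t y = 1) \<Longrightarrow>
    (\<And>t. t \<in> set ts \<Longrightarrow> f t \<in> borel_measurable unit_borel) \<Longrightarrow>
    fdd_int P f (insort t ts) s x = fdd_int P f ts s x"
proof (induction ts arbitrary: s x)
  case Nil
  note pr = transition_familyD(2)[OF P Nil(1,3,4)]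
  have "(\<integral>\<^sup>+y. f t y \<partial>P s t x) = (\<integral>\<^sup>+y. 1 \<partial>P s t x)"
    by (rule nn_integral_prob_cong[OF pr]) (use Nil in auto)
  then show ?case using prob_space.emeasure_space_1[OF prob_algebraD(1)[OF pr]] by simp
next
  case (Cons u us)
  show ?case
  proof (cases "t \<le> u")
    case True
    have "0 \<le> t" using Cons by simp
    have [measurable]: "fdd_int P f us u \<in> borel_measurable unit_borel" "f u \<in> borel_measurable unit_borel"
      using Cons by (auto intro!: fdd_int_measurable[OF P])
    have su: "s \<le> u" using Cons by auto
    note pr = transition_familyD(2)[OF P Cons(2,4,5)]
    have "fdd_int P f (t # u # us) s x = (\<integral>\<^sup>+y. (\<integral>\<^sup>+z. f u z * fdd_int P f us u z \<partial>P t u y) \<partial>P s t x)"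
      unfolding fdd_int.simps by (rule nn_integral_prob_cong[OF pr]) (use Cons in auto)
    also have "\<dots> = (\<integral>\<^sup>+z. f u z * fdd_int P f us u z \<partial>(P s t x \<bind> P t u))"
      using measurable_prob_algebraD[OF transition_familyD(1)[OF P \<open>0 \<le> t\<close> True]] prob_algebraD(2)[OF pr]
      by (intro nn_integral_bind[where B=unit_borel, symmetric]) (auto cong: measurable_cong_sets)
    also have "P s t x \<bind> P t u = P s u x"
      by (rule transition_familyD(4)[OF P Cons(2,4) True Cons(5), symmetric])
    finally show ?thesis using True by simp
  next
    case False
    then have "insort t (u # us) = u # insort t us" by simp
    moreover have "0 \<le> s" "s \<le> u" using Cons by auto
    from transition_familyD(2)[OF P this Cons.prems(4)]
    have "(\<integral>\<^sup>+y. f u y * fdd_int P f (insort t us) u y \<partial>P s u x) = (\<integral>\<^sup>+y. f u y * fdd_int P f us u y \<partial>P s u x)"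
      by (rule nn_integral_prob_cong) (use Cons False in auto)
    ultimately show ?thesis by simp
  qed
qed

text \<open>The Markov property on the level of finite-dimensional distributions: testing at the last time amounts to
  testing the conditional expectation at the time before.\<close>
lemma fdd_int_last:
  assumes "s \<notin> set ts" "t \<notin> set ts" "s \<noteq> t"
  shows "fdd_int P f (ts @ [s, t]) r x = fdd_int P (f(s := \<lambda>y. f s y * (\<integral>\<^sup>+z. f t z \<partial>P s t y))) (ts @ [s]) r x"
  using assms by (induction ts arbitrary: r x) auto

definition has_fdd :: "'b measure \<Rightarrow> (real \<Rightarrow> 'b \<Rightarrow> real) \<Rightarrow> (real \<Rightarrow> real \<Rightarrow> real \<Rightarrow> real measure) \<Rightarrow> real measure \<Rightarrow> bool" where
  "has_fdd Q X P m0 \<longleftrightarrow> (\<forall>J f. finite J \<longrightarrow> J \<subseteq> {0..} \<longrightarrow> (\<forall>j\<in>J. f j \<in> borel_measurable unit_borel) \<longrightarrow>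
    (\<integral>\<^sup>+\<omega>. (\<Prod>j\<in>J. f j (X j \<omega>)) \<partial>Q) = (\<integral>\<^sup>+x. fdd_int P f (sorted_list_of_set J) 0 x \<partial>m0))"

lemma natural_filtration_subalgebra:
  assumes X: "\<And>t. 0 \<le> t \<Longrightarrow> X t \<in> Q \<rightarrow>\<^sub>M unit_borel"
  shows "subalgebra Q (natural_filtration Q X s)"
proof -
  have "{X r -` B \<inter> space Q |r B. 0 \<le> r \<and> r \<le> s \<and> B \<in> sets unit_borel} \<subseteq> sets Q"
    using X by (auto intro!: measurable_sets)
  then show ?thesis
    unfolding subalgebra_def natural_filtration_def
    by (auto simp: space_measure_of_conv sets_measure_of_conv dest: sets.sigma_sets_subset split: if_splits)
qed

lemma natural_filtration_generator:
  "{X r -` B \<inter> space Q |r B. 0 \<le> r \<and> r \<le> s \<and> B \<in> sets unit_borel} \<subseteq> Pow (space Q)"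
  by auto

lemma natural_filtration_measurable:
  assumes X: "\<And>t. 0 \<le> t \<Longrightarrow> X t \<in> Q \<rightarrow>\<^sub>M unit_borel" and r: "0 \<le> r" "r \<le> s"
  shows "X r \<in> natural_filtration Q X s \<rightarrow>\<^sub>M unit_borel"
proof (rule measurableI)
  show "x \<in> space (natural_filtration Q X s) \<Longrightarrow> X r x \<in> space unit_borel" for x
    using measurable_space[OF X[OF r(1)]] by (simp add: natural_filtration_def space_measure_of_conv)
  show "B \<in> sets unit_borel \<Longrightarrow> X r -` B \<inter> space (natural_filtration Q X s) \<in> sets (natural_filtration Q X s)" for B
    using r unfolding natural_filtration_def
    by (simp add: space_measure_of_conv sets_measure_of[OF natural_filtration_generator]) (intro sigma_sets.Basic; blast)
qed

lemma natural_filtration_mono: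
  assumes "r \<le> s"
  shows "sets (natural_filtration Q X r) \<subseteq> sets (natural_filtration Q X s)"
  unfolding natural_filtration_def sets_measure_of[OF natural_filtration_generator]
  by (rule sigma_sets_mono') (use assms in \<open>blast intro: order_trans\<close>)

text \<open>The definition of a Markov process speaks of conditional probabilities of sets. On an event of the past this identifies
  the law at time \<open>t\<close> with the law at time \<open>s\<close> composed with the kernel, as measures, and so extends to
  all nonnegative measurable functions.\<close>
lemma markov_process_kernel:
  assumes mp: "markov_process Q X P" and st: "0 \<le> s" "s \<le> t"
    and A: "A \<in> sets (natural_filtration Q X s)" and g: "g \<in> borel_measurable unit_borel"
  shows "(\<integral>\<^sup>+\<omega>. indicator A \<omega> * g (X t \<omega>) \<partial>Q) = (\<integral>\<^sup>+\<omega>. indicator A \<omega> * (\<integral>\<^sup>+y. g y \<partial>P s t (X s \<omega>)) \<partial>Q)"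
proof -
  interpret Q: prob_space Q using mp by (simp add: markov_process_def)
  have X: "0 \<le> t \<Longrightarrow> X t \<in> Q \<rightarrow>\<^sub>M unit_borel" for t using mp by (simp add: markov_process_def)
  have P: "transition_family P" using mp by (simp add: markov_process_def)
  let ?F = "natural_filtration Q X s"
  have sub: "subalgebra Q ?F" by (rule natural_filtration_subalgebra) (rule X)
  interpret F: finite_measure_subalgebra Q ?F by unfold_locales (rule sub)
  have [measurable]: "A \<in> sets Q" using A sub by (auto simp: subalgebra_def)
  have [measurable]: "X s \<in> Q \<rightarrow>\<^sub>M unit_borel" "X t \<in> Q \<rightarrow>\<^sub>M unit_borel" using X st by auto
  note K[measurable] = transition_familyD(1)[OF P st]
  have [measurable]: "P s t \<in> unit_borel \<rightarrow>\<^sub>M subprob_algebra unit_borel" by (rule measurable_prob_algebraD[OF K])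
  let ?D = "density Q (indicator A)"
  have "distr ?D unit_borel (X t) = distr ?D unit_borel (X s) \<bind> P s t"
  proof (rule measure_eqI)
    show sets: "sets (distr ?D unit_borel (X t)) = sets (distr ?D unit_borel (X s) \<bind> P s t)"
      by (subst sets_bind[where N=unit_borel]) (auto simp: space_restrict_space transition_familyD(2)[OF P st, THEN prob_algebraD(2)])
    fix B assume "B \<in> sets (distr ?D unit_borel (X t))"
    then have B[measurable]: "B \<in> sets unit_borel" by simp
    have pr: "prob_space (P s t (X s \<omega>))" if "\<omega> \<in> space Q" for \<omega>
      using measurable_space[OF measurable_compose[OF \<open>X s \<in> Q \<rightarrow>\<^sub>M unit_borel\<close> K] that] by (simp add: space_prob_algebra)
    have int1: "integrable Q (\<lambda>\<omega>. indicator B (X t \<omega>) :: real)"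
      by (rule Q.integrable_const_bound[where B=1]) auto
    have int2: "integrable Q (\<lambda>\<omega>. measure (P s t (X s \<omega>)) B)"
      by (rule Q.integrable_const_bound[where B=1]) (auto intro!: AE_I2 prob_space.prob_le_1[OF pr])
    have "(\<integral>\<omega>\<in>A. indicator B (X t \<omega>) \<partial>Q) = (\<integral>\<omega>\<in>A. real_cond_exp Q ?F (\<lambda>\<omega>. indicator B (X t \<omega>)) \<omega> \<partial>Q)"
      by (rule F.real_cond_exp_intA[OF int1 A])
    also have "\<dots> = (\<integral>\<omega>\<in>A. measure (P s t (X s \<omega>)) B \<partial>Q)"
      unfolding set_lebesgue_integral_def
    proof (rule integral_cong_AE)
      have "AE \<omega> in Q. real_cond_exp Q ?F (\<lambda>\<omega>. indicator B (X t \<omega>)) \<omega> = measure (P s t (X s \<omega>)) B"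
        using mp st B unfolding markov_process_def by blast
      then show "AE \<omega> in Q. indicator A \<omega> *\<^sub>R real_cond_exp Q ?F (\<lambda>\<omega>. indicator B (X t \<omega>)) \<omega> =
          indicator A \<omega> *\<^sub>R measure (P s t (X s \<omega>)) B"
        by eventually_elim simp
    qed measurable
    finally have eq: "(\<integral>\<omega>. indicator A \<omega> * indicator B (X t \<omega>) \<partial>Q) = (\<integral>\<omega>. indicator A \<omega> * measure (P s t (X s \<omega>)) B \<partial>Q)"
      by (simp add: set_lebesgue_integral_def)
    have "emeasure (distr ?D unit_borel (X t)) B = (\<integral>\<^sup>+x. indicator B x \<partial>distr ?D unit_borel (X t))" by simp
    also have "\<dots> = (\<integral>\<^sup>+\<omega>. indicator B (X t \<omega>) \<partial>?D)" by (rule nn_integral_distr) auto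
    also have "\<dots> = (\<integral>\<^sup>+\<omega>. ennreal (indicator A \<omega> * indicator B (X t \<omega>)) \<partial>Q)"
      by (subst nn_integral_density) (auto simp: ennreal_mult ennreal_indicator)
    also have "\<dots> = ennreal (\<integral>\<omega>. indicator A \<omega> * indicator B (X t \<omega>) \<partial>Q)"
      using integrable_mult_indicator[OF \<open>A \<in> sets Q\<close> int1] by (intro nn_integral_eq_integral) auto
    also have "\<dots> = (\<integral>\<^sup>+\<omega>. ennreal (indicator A \<omega> * measure (P s t (X s \<omega>)) B) \<partial>Q)"
      unfolding eq using integrable_mult_indicator[OF \<open>A \<in> sets Q\<close> int2] by (intro nn_integral_eq_integral[symmetric]) auto
    also have "\<dots> = (\<integral>\<^sup>+\<omega>. indicator A \<omega> * emeasure (P s t (X s \<omega>)) B \<partial>Q)"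
      using pr by (intro nn_integral_cong)
        (simp add: ennreal_mult ennreal_indicator finite_measure.emeasure_eq_measure prob_space.finite_measure)
    also have "\<dots> = (\<integral>\<^sup>+x. emeasure (P s t x) B \<partial>distr ?D unit_borel (X s))"
      by (subst nn_integral_distr) (auto simp: nn_integral_density)
    also have "\<dots> = emeasure (distr ?D unit_borel (X s) \<bind> P s t) B"
      by (rule emeasure_bind[symmetric, where N=unit_borel]) (auto simp: space_restrict_space)
    finally show "emeasure (distr ?D unit_borel (X t)) B = emeasure (distr ?D unit_borel (X s) \<bind> P s t) B" .
  qed
  note law = this
  note [measurable] = g
  have "(\<integral>\<^sup>+\<omega>. indicator A \<omega> * g (X t \<omega>) \<partial>Q) = (\<integral>\<^sup>+y. g y \<partial>distr ?D unit_borel (X t))"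
    by (subst nn_integral_distr) (auto simp: nn_integral_density)
  also have "\<dots> = (\<integral>\<^sup>+x. (\<integral>\<^sup>+y. g y \<partial>P s t x) \<partial>distr ?D unit_borel (X s))"
    unfolding law by (rule nn_integral_bind[where B=unit_borel]) auto
  also have "\<dots> = (\<integral>\<^sup>+\<omega>. indicator A \<omega> * (\<integral>\<^sup>+y. g y \<partial>P s t (X s \<omega>)) \<partial>Q)"
    by (subst nn_integral_distr) (auto simp: nn_integral_density)
  finally show ?thesis .
qed

text \<open>Each time of the list is absorbed into the event of the past, which requires indicators instead of general
  functions.\<close>
lemma markov_process_rectangle:
  assumes mp: "markov_process Q X P"
  shows "0 \<le> s \<Longrightarrow> sorted (s # ts) \<Longrightarrow> distinct ts \<Longrightarrow> A \<in> sets (natural_filtration Q X s) \<Longrightarrow>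
    (\<And>t. t \<in> set ts \<Longrightarrow> B t \<in> sets unit_borel) \<Longrightarrow>
    (\<integral>\<^sup>+\<omega>. indicator A \<omega> * (\<Prod>t\<in>set ts. indicator (B t) (X t \<omega>)) \<partial>Q) =
    (\<integral>\<^sup>+\<omega>. indicator A \<omega> * fdd_int P (\<lambda>t. indicator (B t)) ts s (X s \<omega>) \<partial>Q)"
proof (induction ts arbitrary: s A)
  case (Cons t ts)
  have X: "0 \<le> t \<Longrightarrow> X t \<in> Q \<rightarrow>\<^sub>M unit_borel" for t using mp by (simp add: markov_process_def)
  have P: "transition_family P" using mp by (simp add: markov_process_def)
  let ?f = "\<lambda>t. indicator (B t) :: real \<Rightarrow> ennreal"
  have st: "0 \<le> s" "s \<le> t" "0 \<le> t" using Cons.prems by auto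
  let ?A = "A \<inter> (X t -` B t \<inter> space Q)"
  have "X t -` B t \<inter> space (natural_filtration Q X t) \<in> sets (natural_filtration Q X t)"
    using Cons.prems st by (intro measurable_sets[OF natural_filtration_measurable[OF X]]) auto
  then have A: "?A \<in> sets (natural_filtration Q X t)"
    using natural_filtration_mono[OF st(2)] Cons.prems(4)
    by (auto simp: natural_filtration_def space_measure_of_conv)
  have "(\<integral>\<^sup>+\<omega>. indicator A \<omega> * (\<Prod>t\<in>set (t # ts). ?f t (X t \<omega>)) \<partial>Q) = (\<integral>\<^sup>+\<omega>. indicator ?A \<omega> * (\<Prod>t\<in>set ts. ?f t (X t \<omega>)) \<partial>Q)"
    using Cons.prems by (intro nn_integral_cong) (auto split: split_indicator)
  also have "\<dots> = (\<integral>\<^sup>+\<omega>. indicator ?A \<omega> * fdd_int P ?f ts t (X t \<omega>) \<partial>Q)"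
    using Cons.prems st by (intro Cons.IH A) auto
  also have "\<dots> = (\<integral>\<^sup>+\<omega>. indicator A \<omega> * (?f t (X t \<omega>) * fdd_int P ?f ts t (X t \<omega>)) \<partial>Q)"
    by (intro nn_integral_cong) (auto split: split_indicator)
  also have "\<dots> = (\<integral>\<^sup>+\<omega>. indicator A \<omega> * fdd_int P ?f (t # ts) s (X s \<omega>) \<partial>Q)"
    unfolding fdd_int.simps using Cons.prems st
    by (intro markov_process_kernel[OF mp st(1,2)] borel_measurable_times_ennreal fdd_int_measurable[OF P]) auto
  finally show ?case .
qed simp

lemma markov_process_fdd:
  assumes mp: "markov_process Q X P" and init: "distr Q unit_borel (X 0) = m0"
    and J: "finite J" "J \<subseteq> {0..}" and B: "\<And>j. j \<in> J \<Longrightarrow> B j \<in> sets unit_borel"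
  shows "(\<integral>\<^sup>+\<omega>. (\<Prod>j\<in>J. indicator (B j) (X j \<omega>)) \<partial>Q) = (\<integral>\<^sup>+x. fdd_int P (\<lambda>t. indicator (B t)) (sorted_list_of_set J) 0 x \<partial>m0)"
proof -
  have X: "0 \<le> t \<Longrightarrow> X t \<in> Q \<rightarrow>\<^sub>M unit_borel" for t using mp by (simp add: markov_process_def)
  have P: "transition_family P" using mp by (simp add: markov_process_def)
  let ?ts = "sorted_list_of_set J"
  have ts: "sorted (0 # ?ts)" "set ?ts = J" "distinct ?ts" using J by auto
  have "space Q \<in> sets (natural_filtration Q X 0)"
    using sets.top[of "natural_filtration Q X 0"] by (simp add: natural_filtration_def space_measure_of_conv)
  from markov_process_rectangle[OF mp order_refl ts(1,3) this, of B] B ts(2)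
  have "(\<integral>\<^sup>+\<omega>. (\<Prod>j\<in>J. indicator (B j) (X j \<omega>)) \<partial>Q) = (\<integral>\<^sup>+\<omega>. fdd_int P (\<lambda>t. indicator (B t)) ?ts 0 (X 0 \<omega>) \<partial>Q)"
    by (simp cong: nn_integral_cong)
  also have "\<dots> = (\<integral>\<^sup>+x. fdd_int P (\<lambda>t. indicator (B t)) ?ts 0 x \<partial>m0)"
  proof -
    have "fdd_int P (\<lambda>t. indicator (B t)) ?ts 0 \<in> borel_measurable unit_borel"
      by (rule fdd_int_measurable[OF P _ ts(1)]) (use B ts(2) in auto)
    then show ?thesis unfolding init[symmetric] using X[of 0] by (subst nn_integral_distr) auto
  qed
  finally show ?thesis .
qed

lemma sorted_list_of_set_last_two:
  fixes s t :: real
  assumes "finite J" "\<And>j. j \<in> J \<Longrightarrow> j < s" "s < t"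
  shows "sorted_list_of_set (insert s J) = sorted_list_of_set J @ [s]"
    "sorted_list_of_set (insert t (insert s J)) = sorted_list_of_set J @ [s, t]"
proof -
  have lt: "s < t" "\<And>j. j \<in> J \<Longrightarrow> j < t" using assms by force+
  show "sorted_list_of_set (insert s J) = sorted_list_of_set J @ [s]"
    by (rule sorted_distinct_set_unique) (use assms lt in \<open>auto simp: sorted_append less_imp_le simp del: sorted_list_of_set_insert_remove\<close>)
  show "sorted_list_of_set (insert t (insert s J)) = sorted_list_of_set J @ [s, t]"
    by (rule sorted_distinct_set_unique) (use assms lt in \<open>auto simp: sorted_append less_imp_le simp del: sorted_list_of_set_insert_remove\<close>)
qed

text \<open>This is \<open>fdd_int_last\<close> for the times in \<open>J\<close> together with \<open>s\<close> and \<open>t\<close>; if \<open>s\<close> is not in \<open>J\<close>, the function tested there is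
  \<open>1\<close>.\<close>
lemma has_fdd_markov_rectangle:
  assumes fdd: "has_fdd Q X P m0" and P: "transition_family P"
    and st: "0 \<le> s" "s < t" and J: "finite J" "J \<subseteq> {0..s}"
    and B: "\<And>j. j \<in> J \<Longrightarrow> B j \<in> sets unit_borel" and C: "C \<in> sets unit_borel"
    and X: "\<And>\<omega>. \<omega> \<in> space Q \<Longrightarrow> X s \<omega> \<in> {0..1}"
  shows "(\<integral>\<^sup>+\<omega>. (\<Prod>j\<in>J. indicator (B j) (X j \<omega>)) * indicator C (X t \<omega>) \<partial>Q) =
    (\<integral>\<^sup>+\<omega>. (\<Prod>j\<in>J. indicator (B j) (X j \<omega>)) * emeasure (P s t (X s \<omega>)) C \<partial>Q)"
proof -
  let ?J = "J - {s}"
  define f :: "real \<Rightarrow> real \<Rightarrow> ennreal" where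
    "f j = (if j = t then indicator C else if j \<in> J then indicator (B j) else (\<lambda>_. 1))" for j
  \<comment> \<open>The event at time \<open>t\<close> is replaced by its conditional probability given the position at time \<open>s\<close>.\<close>
  define g where "g = f(s := \<lambda>y. f s y * (\<integral>\<^sup>+z. f t z \<partial>P s t y))"
  have J': "finite ?J" "\<And>j. j \<in> ?J \<Longrightarrow> j < s" "s \<notin> ?J" "t \<notin> ?J" using J st by force+
  have s_ne: "s \<noteq> t" "t \<notin> J" using st J by auto
  have fm: "f j \<in> borel_measurable unit_borel" for j unfolding f_def using B C by auto
  have J0: "?J \<subseteq> {0..}" using J by auto
  have l1: "sorted_list_of_set (insert s ?J) = sorted_list_of_set ?J @ [s]"
    by (rule sorted_list_of_set_last_two(1)[OF J'(1,2) st(2)])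
  have l2: "sorted_list_of_set (insert t (insert s ?J)) = sorted_list_of_set ?J @ [s, t]"
    by (rule sorted_list_of_set_last_two(2)[OF J'(1,2) st(2)])
  have ft: "(\<integral>\<^sup>+z. f t z \<partial>P s t y) = emeasure (P s t y) C" if "y \<in> {0..1}" for y
    using C prob_algebraD(2)[OF transition_familyD(2)[OF P st(1) less_imp_le[OF st(2)] that]] by (simp add: f_def)
  have gm: "g j \<in> borel_measurable unit_borel" for j
    unfolding g_def using fm kernel_nn_measurable[OF transition_familyD(1)[OF P st(1) less_imp_le[OF st(2)]] fm]
    by (cases "j = s") (auto intro!: borel_measurable_times_ennreal)
  have prodf: "(\<Prod>j\<in>insert t (insert s ?J). f j (X j \<omega>)) = (\<Prod>j\<in>J. indicator (B j) (X j \<omega>)) * indicator C (X t \<omega>)" for \<omega>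
  proof -
    have "(\<Prod>j\<in>insert s ?J. f j (X j \<omega>)) = (\<Prod>j\<in>J. indicator (B j) (X j \<omega>))"
    proof (cases "s \<in> J")
      case True
      then have insJ: "insert s ?J = J" by auto
      show ?thesis unfolding insJ using s_ne by (intro prod.cong) (auto simp: f_def)
    next
      case False
      then have "J - {s} = J" by auto
      then show ?thesis using s_ne J False by (auto simp: f_def intro!: prod.cong)
    qed
    then show ?thesis using J' s_ne by (simp add: f_def mult.commute)
  qed
  have prodg: "(\<Prod>j\<in>insert s ?J. g j (X j \<omega>)) = (\<Prod>j\<in>J. indicator (B j) (X j \<omega>)) * emeasure (P s t (X s \<omega>)) C"
    if Xs: "X s \<omega> \<in> {0..1}" for \<omega>
  proof -
    have a: "(\<Prod>j\<in>?J. g j (X j \<omega>)) = (\<Prod>j\<in>?J. indicator (B j) (X j \<omega>))"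
      using s_ne by (intro prod.cong) (auto simp: g_def f_def)
    have b: "g s (X s \<omega>) = (if s \<in> J then indicator (B s) (X s \<omega>) else 1) * emeasure (P s t (X s \<omega>)) C"
      using s_ne ft[OF Xs] by (simp add: g_def f_def)
    have c: "(\<Prod>j\<in>J. indicator (B j) (X j \<omega>)) = (if s \<in> J then indicator (B s) (X s \<omega>) else 1) * (\<Prod>j\<in>?J. indicator (B j) (X j \<omega>) :: ennreal)"
      using prod.remove[OF J(1), of s "\<lambda>j. indicator (B j) (X j \<omega>) :: ennreal"] by (cases "s \<in> J") auto
    show ?thesis unfolding prod.insert[OF J'(1,3)] a b c by (simp only: mult_ac)
  qed
  have eq: "(\<integral>\<^sup>+\<omega>. (\<Prod>j\<in>J'. h j (X j \<omega>)) \<partial>Q) = (\<integral>\<^sup>+x. fdd_int P h (sorted_list_of_set J') 0 x \<partial>m0)"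
    if "finite J'" "J' \<subseteq> {0..}" "\<And>j. h j \<in> borel_measurable unit_borel" for J' h
    using fdd that unfolding has_fdd_def by blast
  have "(\<integral>\<^sup>+\<omega>. (\<Prod>j\<in>J. indicator (B j) (X j \<omega>)) * indicator C (X t \<omega>) \<partial>Q) =
      (\<integral>\<^sup>+\<omega>. (\<Prod>j\<in>insert t (insert s ?J). f j (X j \<omega>)) \<partial>Q)"
    by (simp only: prodf)
  also have "\<dots> = (\<integral>\<^sup>+x. fdd_int P f (sorted_list_of_set ?J @ [s, t]) 0 x \<partial>m0)"
    using eq[of "insert t (insert s ?J)" f, unfolded l2] J J0 st fm by (auto simp del: insert_Diff_single)
  also have "\<dots> = (\<integral>\<^sup>+x. fdd_int P g (sorted_list_of_set ?J @ [s]) 0 x \<partial>m0)"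
    unfolding g_def using J' s_ne by (subst fdd_int_last) auto
  also have "\<dots> = (\<integral>\<^sup>+\<omega>. (\<Prod>j\<in>insert s ?J. g j (X j \<omega>)) \<partial>Q)"
    using eq[of "insert s ?J" g, unfolded l1] J J0 st gm by (auto simp del: insert_Diff_single)
  also have "\<dots> = (\<integral>\<^sup>+\<omega>. (\<Prod>j\<in>J. indicator (B j) (X j \<omega>)) * emeasure (P s t (X s \<omega>)) C \<partial>Q)"
    by (intro nn_integral_cong prodg X)
  finally show ?thesis .
qed

abbreviation unit_product :: "real set \<Rightarrow> (real \<Rightarrow> real) measure" where
  "unit_product J \<equiv> Pi\<^sub>M J (\<lambda>_. unit_borel)"

abbreviation real_product :: "real set \<Rightarrow> (real \<Rightarrow> real) measure" where
  "real_product J \<equiv> Pi\<^sub>M J (\<lambda>_. borel)"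

text \<open>Two finite measures on the space of paths up to time \<open>s\<close> have to agree: the paths weighted with the
  event at time \<open>t\<close>, and the paths weighted with its conditional probability given the position at \<open>s\<close>. They agree on
  cylinders by \<open>has_fdd_markov_rectangle\<close>, and each event of the natural filtration is a preimage of a
  measurable set of such paths.\<close>
lemma has_fdd_imp_markov_process:
  assumes Q: "prob_space Q" and X: "\<And>t. 0 \<le> t \<Longrightarrow> X t \<in> Q \<rightarrow>\<^sub>M unit_borel"
    and P: "transition_family P" and fdd: "has_fdd Q X P m0"
  shows "markov_process Q X P"
  unfolding markov_process_def
proof (intro conjI Q allI impI ballI P)
  show "0 \<le> t \<Longrightarrow> X t \<in> Q \<rightarrow>\<^sub>M unit_borel" for t by (rule X)
  interpret Q: prob_space Q by (rule Q)
  fix s t :: real and C assume st': "0 \<le> s \<and> s \<le> t" and C[measurable]: "C \<in> sets unit_borel"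
  then have st: "0 \<le> s" "s \<le> t" by auto
  let ?F = "natural_filtration Q X s"
  have sub: "subalgebra Q ?F" by (rule natural_filtration_subalgebra) (rule X)
  interpret F: finite_measure_subalgebra Q ?F by unfold_locales (rule sub)
  have [measurable]: "X s \<in> Q \<rightarrow>\<^sub>M unit_borel" "X t \<in> Q \<rightarrow>\<^sub>M unit_borel" using X st by auto
  have XsF[measurable]: "X s \<in> ?F \<rightarrow>\<^sub>M unit_borel" by (rule natural_filtration_measurable) (use X st in auto)
  note K[measurable] = transition_familyD(1)[OF P st]
  have [measurable]: "P s t \<in> unit_borel \<rightarrow>\<^sub>M subprob_algebra unit_borel" by (rule measurable_prob_algebraD[OF K])
  have Xs01: "X r \<omega> \<in> {0..1}" if "\<omega> \<in> space Q" "0 \<le> r" for r \<omega>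
    using measurable_space[OF X that(1)] that(2) by (simp add: space_restrict_space)
  have pr: "prob_space (P s t (X s \<omega>))" if "\<omega> \<in> space Q" for \<omega>
    using prob_algebraD(1)[OF transition_familyD(2)[OF P st Xs01]] that st by auto
  let ?u = "\<lambda>\<omega>. indicator C (X t \<omega>) :: ennreal" and ?v = "\<lambda>\<omega>. emeasure (P s t (X s \<omega>)) C"
  let ?S = "unit_product {0..s}"
  let ?R = "\<lambda>\<omega>. \<lambda>r\<in>{0..s}. X r \<omega>"
  have R[measurable]: "?R \<in> Q \<rightarrow>\<^sub>M ?S" using X by (intro measurable_restrict) auto
  have v1: "?v \<omega> \<le> 1" if "\<omega> \<in> space Q" for \<omega>
    using prob_space.emeasure_le_1[OF pr[OF that]] .
  have eq: "distr (density Q ?u) ?S ?R = distr (density Q ?v) ?S ?R"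
  proof (rule measure_eqI_PiM_infinite)
    have "(\<integral>\<^sup>+\<omega>. ?u \<omega> \<partial>Q) \<le> (\<integral>\<^sup>+\<omega>. 1 \<partial>Q)"
      by (intro nn_integral_mono) (auto split: split_indicator)
    moreover have "emeasure (density Q ?u) (space Q) = (\<integral>\<^sup>+\<omega>. ?u \<omega> \<partial>Q)"
      by (subst emeasure_density) (auto cong: nn_integral_cong)
    ultimately have "finite_measure (density Q ?u)"
      by (intro finite_measureI) (auto simp: Q.emeasure_space_1 top_unique)
    then show "finite_measure (distr (density Q ?u) ?S ?R)"
      by (rule finite_measure.finite_measure_distr) simp
    fix B J assume J: "finite J" "J \<subseteq> {0..s}" and B: "\<And>j. j \<in> J \<Longrightarrow> B j \<in> sets unit_borel"
    have emb: "prod_emb {0..s} (\<lambda>_. unit_borel) J (Pi\<^sub>E J B) \<in> sets ?S"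
      using J B by (intro measurable_prod_emb sets_PiM_I_finite) auto
    have ind: "indicator (?R -` prod_emb {0..s} (\<lambda>_. unit_borel) J (Pi\<^sub>E J B) \<inter> space Q) \<omega> = (\<Prod>j\<in>J. indicator (B j) (X j \<omega>) :: ennreal)"
      if \<omega>: "\<omega> \<in> space Q" for \<omega>
    proof -
      have "?R \<omega> \<in> prod_emb {0..s} (\<lambda>_. unit_borel) J (Pi\<^sub>E J B) \<longleftrightarrow> (\<forall>j\<in>J. X j \<omega> \<in> B j)"
        using J Xs01[OF \<omega>] by (auto simp: prod_emb_def PiE_iff space_restrict_space restrict_def extensional_def)
      then show ?thesis using \<omega> J(1) by (auto simp: indicator_def prod_zero_iff)
    qed
    have meas: "emeasure (distr (density Q h) ?S ?R) (prod_emb {0..s} (\<lambda>_. unit_borel) J (Pi\<^sub>E J B)) =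
        (\<integral>\<^sup>+\<omega>. (\<Prod>j\<in>J. indicator (B j) (X j \<omega>)) * h \<omega> \<partial>Q)" if [measurable]: "h \<in> borel_measurable Q" for h
      using measurable_sets[OF R emb]
      by (subst emeasure_distr[OF _ emb]) (auto simp: emeasure_density ind mult.commute cong: nn_integral_cong)
    have "(\<integral>\<^sup>+\<omega>. (\<Prod>j\<in>J. indicator (B j) (X j \<omega>)) * ?u \<omega> \<partial>Q) = (\<integral>\<^sup>+\<omega>. (\<Prod>j\<in>J. indicator (B j) (X j \<omega>)) * ?v \<omega> \<partial>Q)"
    proof (cases "s = t")
      case True
      have "?v \<omega> = ?u \<omega>" if "\<omega> \<in> space Q" for \<omega>
        using transition_familyD(3)[OF P st(1) order_refl Xs01[OF that st(1)]] C by (simp add: True)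
      then show ?thesis by (simp cong: nn_integral_cong)
    next
      case False
      then show ?thesis using st J B C Xs01 by (intro has_fdd_markov_rectangle[OF fdd P]) auto
    qed
    then show "emeasure (distr (density Q ?u) ?S ?R) (prod_emb {0..s} (\<lambda>_. unit_borel) J (Pi\<^sub>E J B)) =
      emeasure (distr (density Q ?v) ?S ?R) (prod_emb {0..s} (\<lambda>_. unit_borel) J (Pi\<^sub>E J B))"
      by (subst (1 2) meas) auto
  qed auto
  have int1: "integrable Q (\<lambda>\<omega>. indicator C (X t \<omega>) :: real)"
    by (rule Q.integrable_const_bound[where B=1]) auto
  have int2: "integrable Q (\<lambda>\<omega>. measure (P s t (X s \<omega>)) C)"
    by (rule Q.integrable_const_bound[where B=1]) (auto intro!: AE_I2 prob_space.prob_le_1[OF pr])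
  show "AE \<omega> in Q. real_cond_exp Q ?F (\<lambda>\<omega>. indicator C (X t \<omega>)) \<omega> = measure (P s t (X s \<omega>)) C"
  proof (rule F.real_cond_exp_charact[OF _ int1 int2])
    show "(\<lambda>\<omega>. measure (P s t (X s \<omega>)) C) \<in> borel_measurable ?F" by measurable
    fix A assume A: "A \<in> sets ?F"
    then have [measurable]: "A \<in> sets Q" using sub by (auto simp: subalgebra_def)
    have "sets ?F \<subseteq> sets (vimage_algebra (space Q) ?R ?S)"
      unfolding natural_filtration_def sets_measure_of[OF natural_filtration_generator]
    proof (rule sigma_algebra.sigma_sets_subset)
      show "sigma_algebra (space Q) (sets (vimage_algebra (space Q) ?R ?S))"
        using sets.sigma_algebra_axioms[of "vimage_algebra (space Q) ?R ?S"] by simp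
      show "{X r -` B \<inter> space Q |r B. 0 \<le> r \<and> r \<le> s \<and> B \<in> sets unit_borel} \<subseteq> sets (vimage_algebra (space Q) ?R ?S)"
      proof safe
        fix r B assume r: "0 \<le> r" "r \<le> s" and B: "B \<in> sets unit_borel"
        have "(\<lambda>\<omega>. \<omega> r) -` B \<inter> space ?S \<in> sets ?S"
          using measurable_component_singleton[of r "{0..s}" "\<lambda>_. unit_borel"] r by (intro measurable_sets[OF _ B]) auto
        then have "?R -` ((\<lambda>\<omega>. \<omega> r) -` B \<inter> space ?S) \<inter> space Q \<in> sets (vimage_algebra (space Q) ?R ?S)"
          by (rule in_vimage_algebra)
        moreover have "?R -` ((\<lambda>\<omega>. \<omega> r) -` B \<inter> space ?S) \<inter> space Q = X r -` B \<inter> space Q"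
          using r measurable_space[OF R] by auto
        ultimately show "X r -` B \<inter> space Q \<in> sets (vimage_algebra (space Q) ?R ?S)" by simp
      qed
    qed
    with A obtain A' where A': "A' \<in> sets ?S" "A = ?R -` A' \<inter> space Q"
      using measurable_space[OF R] by (subst (asm) sets_vimage_algebra2) auto
    have "(\<integral>\<^sup>+\<omega>. h \<omega> * indicator A \<omega> \<partial>Q) = emeasure (distr (density Q h) ?S ?R) A'"
      if [measurable]: "h \<in> borel_measurable Q" for h
      using A' by (subst emeasure_distr) (auto simp: emeasure_density)
    then have nn: "(\<integral>\<^sup>+\<omega>. ?u \<omega> * indicator A \<omega> \<partial>Q) = (\<integral>\<^sup>+\<omega>. ?v \<omega> * indicator A \<omega> \<partial>Q)"
      by (simp add: eq)
    have "ennreal (\<integral>\<omega>. indicator A \<omega> * indicator C (X t \<omega>) \<partial>Q) = (\<integral>\<^sup>+\<omega>. ennreal (indicator A \<omega> * indicator C (X t \<omega>)) \<partial>Q)"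
      using integrable_mult_indicator[OF \<open>A \<in> sets Q\<close> int1] by (intro nn_integral_eq_integral[symmetric]) auto
    also have "\<dots> = (\<integral>\<^sup>+\<omega>. ?u \<omega> * indicator A \<omega> \<partial>Q)"
      by (intro nn_integral_cong) (auto split: split_indicator)
    also have "\<dots> = (\<integral>\<^sup>+\<omega>. ennreal (indicator A \<omega> * measure (P s t (X s \<omega>)) C) \<partial>Q)"
      unfolding nn using pr by (intro nn_integral_cong)
        (simp add: ennreal_mult ennreal_indicator finite_measure.emeasure_eq_measure prob_space.finite_measure mult.commute)
    also have "\<dots> = ennreal (\<integral>\<omega>. indicator A \<omega> * measure (P s t (X s \<omega>)) C \<partial>Q)"
      using integrable_mult_indicator[OF \<open>A \<in> sets Q\<close> int2] by (intro nn_integral_eq_integral) auto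
    finally show "(\<integral>\<omega>\<in>A. indicator C (X t \<omega>) \<partial>Q) = (\<integral>\<omega>\<in>A. measure (P s t (X s \<omega>)) C \<partial>Q)"
      unfolding set_lebesgue_integral_def by (subst (asm) ennreal_inj) (auto intro!: integral_nonneg_AE)
  qed
qed

section \<open>Step paths from their values at dyadic times\<close>

definition dyadic :: "real set" where
  "dyadic = {real i / 2 ^ n |i n. True}"

lemma dyadicI: "real i / 2 ^ n \<in> dyadic"
  by (auto simp: dyadic_def)

lemma dyadic_nonneg: "d \<in> dyadic \<Longrightarrow> 0 \<le> d"
  by (auto simp: dyadic_def)

lemma dyadic_common_level:
  assumes "d \<in> dyadic" "e \<in> dyadic"
  obtains n0 where "\<And>n. n0 \<le> n \<Longrightarrow> \<exists>i j. d = real i / 2 ^ n \<and> e = real j / 2 ^ n"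
proof -
  obtain i k j l where d: "d = real i / 2 ^ k" and e: "e = real j / 2 ^ l"
    using assms by (auto simp: dyadic_def)
  have up: "real i / 2 ^ k = real (i * 2 ^ (n - k)) / 2 ^ n" if "k \<le> n" for i k n :: nat
    using that by (simp add: field_simps flip: power_add)
  show thesis
  proof (rule that[of "max k l"])
    fix n assume "max k l \<le> n"
    then show "\<exists>i j. d = real i / 2 ^ n \<and> e = real j / 2 ^ n"
      unfolding d e using up[of k n i] up[of l n j] by (metis max.bounded_iff)
  qed
qed

text \<open>The least point of the grid of level \<open>n\<close> that is strictly greater than \<open>t\<close>.\<close>
definition next_grid :: "nat \<Rightarrow> real \<Rightarrow> real" where
  "next_grid n t = (of_int \<lfloor>2 ^ n * t\<rfloor> + 1) / 2 ^ n"

lemma next_grid_dyadic: "0 \<le> t \<Longrightarrow> next_grid n t \<in> dyadic"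
proof -
  assume "0 \<le> t"
  then have "of_int \<lfloor>2 ^ n * t\<rfloor> + 1 = real (Suc (nat \<lfloor>2 ^ n * t\<rfloor>))" by simp
  then show ?thesis unfolding next_grid_def by (simp only: dyadicI)
qed

lemma next_grid_gt: "t < next_grid n t"
proof -
  have "2 ^ n * t < of_int \<lfloor>2 ^ n * t\<rfloor> + 1" by linarith
  then show ?thesis by (simp add: next_grid_def field_simps)
qed

lemma next_grid_le: "next_grid n t \<le> t + 1 / 2 ^ n"
proof -
  have "of_int \<lfloor>2 ^ n * t\<rfloor> + 1 \<le> 2 ^ n * t + 1" by linarith
  then show ?thesis by (simp add: next_grid_def field_simps)
qed

lemma next_grid_eventually: 
  assumes "t < u"
  shows "\<forall>\<^sub>F n in sequentially. next_grid n t < u"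
proof -
  have "(\<lambda>n. t + (1 / 2) ^ n) \<longlonglongrightarrow> t + 0" by (intro tendsto_intros LIMSEQ_realpow_zero) auto
  then have "\<forall>\<^sub>F n in sequentially. t + (1 / 2) ^ n < u" using assms by (intro order_tendstoD) auto
  then show ?thesis
    by eventually_elim (use next_grid_le in \<open>auto simp: power_divide intro: le_less_trans\<close>)
qed

lemma dyadic_dense: "0 \<le> t \<Longrightarrow> t < u \<Longrightarrow> \<exists>d\<in>dyadic. t < d \<and> d < u"
  using next_grid_eventually[of t u] next_grid_dyadic[of t] next_grid_gt[of t]
  by (auto simp: eventually_sequentially)

text \<open>The number of these grid intervals is the variation of the path along the grid with respect to the discrete
  metric, which suits paths that move by jumps only.\<close>
definition jumps :: "(real \<Rightarrow> 'a) \<Rightarrow> nat \<Rightarrow> real \<Rightarrow> nat set" where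
  "jumps \<omega> n r = {i. real (Suc i) / 2 ^ n \<le> r \<and> \<omega> (real i / 2 ^ n) \<noteq> \<omega> (real (Suc i) / 2 ^ n)}"

lemma finite_jumps: "finite (jumps \<omega> n r)"
proof (rule finite_subset)
  have "i \<le> nat \<lfloor>r * 2 ^ n\<rfloor>" if "real (Suc i) / 2 ^ n \<le> r" for i
  proof -
    have "real i \<le> r * 2 ^ n" using that by (simp add: field_simps)
    then show ?thesis by linarith
  qed
  then show "jumps \<omega> n r \<subseteq> {..nat \<lfloor>r * 2 ^ n\<rfloor>}" by (auto simp: jumps_def)
qed simp

lemma card_jumps_mono: "r \<le> r' \<Longrightarrow> card (jumps \<omega> n r) \<le> card (jumps \<omega> n r')"
  by (intro card_mono finite_jumps) (auto simp: jumps_def)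

text \<open>A change over an interval forces a change over one of its halves; distinct intervals have
  distinct halves.\<close>
lemma card_jumps_refine: "card (jumps \<omega> n r) \<le> card (jumps \<omega> (Suc n) r)"
proof (rule card_inj_on_le[OF _ _ finite_jumps])
  let ?h = "\<lambda>i. if \<omega> (real (2 * i) / 2 ^ Suc n) \<noteq> \<omega> (real (Suc (2 * i)) / 2 ^ Suc n) then 2 * i else Suc (2 * i)"
  show "inj_on ?h (jumps \<omega> n r)"
    by (rule inj_on_inverseI[where g="\<lambda>m. m div 2"]) simp
  show "?h ` jumps \<omega> n r \<subseteq> jumps \<omega> (Suc n) r"
  proof safe
    fix i assume i: "i \<in> jumps \<omega> n r"
    have eq: "real (2 * i) / 2 ^ Suc n = real i / 2 ^ n" "real (Suc (Suc (2 * i))) / 2 ^ Suc n = real (Suc i) / 2 ^ n"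
      by (auto simp: field_simps)
    have le: "real (Suc (2 * i)) / 2 ^ Suc n \<le> real (Suc (Suc (2 * i))) / 2 ^ Suc n"
      by (intro divide_right_mono) auto
    show "?h i \<in> jumps \<omega> (Suc n) r"
    proof (cases "\<omega> (real (2 * i) / 2 ^ Suc n) \<noteq> \<omega> (real (Suc (2 * i)) / 2 ^ Suc n)")
      case True
      then show ?thesis using i le unfolding jumps_def by (simp only: eq mem_Collect_eq if_True) auto
    next
      case False
      then show ?thesis using i unfolding jumps_def by (simp only: eq mem_Collect_eq if_False) auto
    qed
  qed
qed

lemma card_jumps_less:
  assumes "i < j" and ne: "\<omega> (real i / 2 ^ n) \<noteq> \<omega> (real j / 2 ^ n)"
  shows "card (jumps \<omega> n (real i / 2 ^ n)) < card (jumps \<omega> n (real j / 2 ^ n))"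
proof -
  have "\<exists>k\<ge>i. k < j \<and> \<omega> (real k / 2 ^ n) \<noteq> \<omega> (real (Suc k) / 2 ^ n)"
  proof (rule ccontr)
    assume *: "\<not> ?thesis"
    have "\<omega> (real (i + m) / 2 ^ n) = \<omega> (real i / 2 ^ n)" if "i + m \<le> j" for m
      using that
    proof (induction m)
      case (Suc m)
      then show ?case using * by (metis Suc_leD add_Suc_right le_add1 Suc_le_lessD)
    qed simp
    from this[of "j - i"] ne assms(1) show False by simp
  qed
  then obtain k where k: "i \<le> k" "k < j" "\<omega> (real k / 2 ^ n) \<noteq> \<omega> (real (Suc k) / 2 ^ n)" by blast
  have "k \<in> jumps \<omega> n (real j / 2 ^ n)" using k by (auto simp: jumps_def divide_right_mono)
  moreover have "real i / 2 ^ n < real (Suc k) / 2 ^ n" using k by (intro divide_strict_right_mono) auto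
  then have "k \<notin> jumps \<omega> n (real i / 2 ^ n)" by (auto simp: jumps_def)
  moreover have "jumps \<omega> n (real i / 2 ^ n) \<subseteq> jumps \<omega> n (real j / 2 ^ n)"
  proof -
    have "real i / 2 ^ n \<le> real j / 2 ^ n" using assms(1) by (intro divide_right_mono) auto
    then show ?thesis unfolding jumps_def by (blast intro: order_trans)
  qed
  ultimately show ?thesis by (intro psubset_card_mono finite_jumps) auto
qed

text \<open>What must hold almost surely for the values at dyadic times to extend to a step path.\<close>
definition regular_path :: "(real \<Rightarrow> real) \<Rightarrow> bool" where
  "regular_path \<omega> \<longleftrightarrow> (\<forall>d\<in>dyadic. \<omega> d \<in> {0..1}) \<and> (\<forall>r::nat. \<exists>C. \<forall>n. card (jumps \<omega> n (real r)) \<le> C)"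

definition jump_count :: "(real \<Rightarrow> real) \<Rightarrow> real \<Rightarrow> nat" where
  "jump_count \<omega> r = Sup (range (\<lambda>n. card (jumps \<omega> n r)))"

definition right_limit :: "(real \<Rightarrow> real) \<Rightarrow> real \<Rightarrow> real" where
  "right_limit \<omega> t = lim (\<lambda>n. \<omega> (next_grid n t))"

context
  fixes \<omega> assumes reg: "regular_path \<omega>"
begin

lemma jumps_bounded: "bdd_above (range (\<lambda>n. card (jumps \<omega> n r)))"
proof -
  obtain k :: nat where k: "r \<le> real k" using real_arch_simple by blast
  obtain C where C: "\<And>n. card (jumps \<omega> n (real k)) \<le> C" using reg unfolding regular_path_def by blast
  show ?thesis by (rule bdd_aboveI2) (rule order_trans[OF card_jumps_mono[OF k] C])
qed

lemma jump_count_mono: "r \<le> r' \<Longrightarrow> jump_count \<omega> r \<le> jump_count \<omega> r'"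
  unfolding jump_count_def
  by (rule cSUP_mono[OF _ jumps_bounded]) (auto intro!: exI card_jumps_mono)

lemma jump_count_attained: "\<exists>n0. \<forall>n\<ge>n0. card (jumps \<omega> n r) = jump_count \<omega> r"
proof -
  have "jump_count \<omega> r \<in> range (\<lambda>n. card (jumps \<omega> n r))"
    unfolding jump_count_def Sup_nat_def using Max_in[OF jumps_bounded[of r, unfolded bdd_above_nat]] by auto
  then obtain n0 where n0: "jump_count \<omega> r = card (jumps \<omega> n0 r)" by auto
  have "card (jumps \<omega> n r) = jump_count \<omega> r" if "n0 \<le> n" for n
  proof (rule antisym)
    show "card (jumps \<omega> n r) \<le> jump_count \<omega> r"
      unfolding jump_count_def by (rule cSUP_upper[OF UNIV_I jumps_bounded])
    show "jump_count \<omega> r \<le> card (jumps \<omega> n r)"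
      unfolding n0 using that by (rule lift_Suc_mono_le[of "\<lambda>n. card (jumps \<omega> n r)", OF card_jumps_refine])
  qed
  then show ?thesis by blast
qed

text \<open>At levels that contain both times and at which both counts have become stationary, a change of the path
  between the two times contributes to the larger count only.\<close>
lemma jump_count_less:
  assumes d: "d \<in> dyadic" "e \<in> dyadic" "d < e" and ne: "\<omega> d \<noteq> \<omega> e"
  shows "jump_count \<omega> d < jump_count \<omega> e"
proof -
  obtain n0 where n0: "\<And>n. n0 \<le> n \<Longrightarrow> \<exists>i j. d = real i / 2 ^ n \<and> e = real j / 2 ^ n"
    using dyadic_common_level[OF d(1,2)] by blast
  obtain n1 where n1: "\<And>n. n1 \<le> n \<Longrightarrow> card (jumps \<omega> n d) = jump_count \<omega> d" using jump_count_attained by blast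
  obtain n2 where n2: "\<And>n. n2 \<le> n \<Longrightarrow> card (jumps \<omega> n e) = jump_count \<omega> e" using jump_count_attained by blast
  define n where "n = max n0 (max n1 n2)"
  obtain i j where ij: "d = real i / 2 ^ n" "e = real j / 2 ^ n" using n0[of n] by (auto simp: n_def)
  have "i < j" using d(3) unfolding ij by (simp add: divide_less_cancel)
  from card_jumps_less[OF this, of \<omega> n] ne show ?thesis
    using n1[of n] n2[of n] unfolding ij[symmetric] by (simp add: n_def)
qed

text \<open>The jump count is monotone with values in the natural numbers, so it attains its least value on the dyadic
  times after \<open>t\<close>. From \<open>t\<close> up to a time where it does, the count is constant, and by \<open>jump_count_less\<close> so is the path.\<close>
lemma constant_on_right:
  assumes t: "0 \<le> t"
  shows "\<exists>u>t. \<exists>c\<in>{0..1}. \<forall>d\<in>dyadic. t < d \<longrightarrow> d < u \<longrightarrow> \<omega> d = c"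
proof -
  obtain d1 where d1: "d1 \<in> dyadic \<and> t < d1" using dyadic_dense[OF t, of "t + 1"] by auto
  from ex_has_least_nat[of "\<lambda>d. d \<in> dyadic \<and> t < d", OF d1, of "jump_count \<omega>"]
  obtain d0 where d0: "d0 \<in> dyadic" "t < d0"
    and least: "\<And>d. d \<in> dyadic \<Longrightarrow> t < d \<Longrightarrow> jump_count \<omega> d0 \<le> jump_count \<omega> d"
    by auto
  have "\<omega> d = \<omega> d0" if "d \<in> dyadic" "t < d" "d < d0" for d
    using jump_count_less[OF that(1) d0(1) that(3)] least[OF that(1,2)] by linarith
  moreover have "\<omega> d0 \<in> {0..1}" using reg d0(1) by (simp add: regular_path_def)
  ultimately show ?thesis using d0(2) by blast
qed

text \<open>The same argument with the greatest value of the count on the dyadic times before \<open>t\<close>, which exists because the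
  count at \<open>t\<close> is a bound.\<close>
lemma constant_on_left:
  assumes t: "0 < t"
  shows "\<exists>u\<ge>0. u < t \<and> (\<exists>c. \<forall>d\<in>dyadic. u < d \<longrightarrow> d < t \<longrightarrow> \<omega> d = c)"
proof -
  obtain d1 where d1: "d1 \<in> dyadic \<and> d1 < t" using dyadic_dense[OF order_refl t] by auto
  have "\<forall>d. d \<in> dyadic \<and> d < t \<longrightarrow> jump_count \<omega> d < Suc (jump_count \<omega> t)"
    using jump_count_mono[of _ t] by (auto simp: less_Suc_eq_le)
  from ex_has_greatest_nat[of "\<lambda>d. d \<in> dyadic \<and> d < t", OF d1 this]
  obtain d0 where d0: "d0 \<in> dyadic" "d0 < t"
    and greatest: "\<And>d. d \<in> dyadic \<Longrightarrow> d < t \<Longrightarrow> jump_count \<omega> d \<le> jump_count \<omega> d0"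
    by auto
  have "\<omega> d = \<omega> d0" if "d \<in> dyadic" "d0 < d" "d < t" for d
    using jump_count_less[OF d0(1) that(1,2)] greatest[OF that(1,3)] by fastforce
  then show ?thesis using d0 dyadic_nonneg[OF d0(1)] by blast
qed

lemma right_limit_eq:
  assumes "0 \<le> t" "t < u" and c: "\<And>d. d \<in> dyadic \<Longrightarrow> t < d \<Longrightarrow> d < u \<Longrightarrow> \<omega> d = c"
  shows "right_limit \<omega> t = c"
proof -
  have "\<forall>\<^sub>F n in sequentially. \<omega> (next_grid n t) = c"
    using next_grid_eventually[OF assms(2)]
    by eventually_elim (use assms(1) c next_grid_dyadic next_grid_gt in auto)
  then show ?thesis unfolding right_limit_def by (intro limI tendsto_eventually)
qed

lemma right_limit_eventually:
  assumes "0 \<le> t"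
  shows "\<forall>\<^sub>F n in sequentially. \<omega> (next_grid n t) = right_limit \<omega> t"
proof -
  from constant_on_right[OF assms]
  obtain u c where u: "t < u" and c: "\<And>d. d \<in> dyadic \<Longrightarrow> t < d \<Longrightarrow> d < u \<Longrightarrow> \<omega> d = c"
    by auto
  have "right_limit \<omega> t = c" by (rule right_limit_eq[OF assms u c])
  show ?thesis unfolding \<open>right_limit \<omega> t = c\<close>
    using next_grid_eventually[OF u]
    by eventually_elim (rule c[OF next_grid_dyadic[OF assms] next_grid_gt])
qed

text \<open>The extension is constant on a one-sided neighbourhood of each time, on both sides.\<close>
lemma right_limit_skorohod: "restrict (right_limit \<omega>) {0..} \<in> skorohod_paths"
  unfolding skorohod_paths_def mem_Collect_eq
proof (intro conjI allI impI)
  show "restrict (right_limit \<omega>) {0..} \<in> {0..} \<rightarrow>\<^sub>E {0..1}"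
  proof (rule restrict_PiE_iff[THEN iffD2], rule ballI)
    fix t :: real assume "t \<in> {0..}"
    then have t: "0 \<le> t" by simp
    from constant_on_right[OF t]
    obtain u c where u: "t < u" and c01: "c \<in> {0..1}" and c: "\<And>d. d \<in> dyadic \<Longrightarrow> t < d \<Longrightarrow> d < u \<Longrightarrow> \<omega> d = c"
      by blast
    show "right_limit \<omega> t \<in> {0..1}" using right_limit_eq[OF t u c] c01 by simp
  qed
next
  fix t :: real assume t: "0 \<le> t"
  from constant_on_right[OF t]
  obtain u c where u: "t < u" and c: "\<And>d. d \<in> dyadic \<Longrightarrow> t < d \<Longrightarrow> d < u \<Longrightarrow> \<omega> d = c"
    by auto
  have eq: "right_limit \<omega> s = c" if "t \<le> s" "s < u" for s
    using that t by (intro right_limit_eq[of s u]) (auto intro: c)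
  have "\<forall>\<^sub>F s in at_right t. restrict (right_limit \<omega>) {0..} s = restrict (right_limit \<omega>) {0..} t"
    unfolding eventually_at_right_field using u eq t by (intro exI[of _ u]) auto
  then show "(restrict (right_limit \<omega>) {0..} \<longlongrightarrow> restrict (right_limit \<omega>) {0..} t) (at_right t)"
    by (rule tendsto_eventually)
next
  fix t :: real assume t: "0 < t"
  from constant_on_left[OF t]
  obtain u c where u: "0 \<le> u" "u < t" and c: "\<And>d. d \<in> dyadic \<Longrightarrow> u < d \<Longrightarrow> d < t \<Longrightarrow> \<omega> d = c"
    by auto
  have eq: "right_limit \<omega> s = c" if "u < s" "s < t" for s
    using that u by (intro right_limit_eq[of s t]) (auto intro: c)
  have "\<forall>\<^sub>F s in at_left t. restrict (right_limit \<omega>) {0..} s = c"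
    unfolding eventually_at_left_field using u eq by (intro exI[of _ u]) auto
  then show "\<exists>l. (restrict (right_limit \<omega>) {0..} \<longlongrightarrow> l) (at_left t)"
    by (intro exI[of _ c] tendsto_eventually)
qed

end

section \<open>Kolmogorov extension\<close>

lemma skorohod_paths_subset: "skorohod_paths \<subseteq> space (unit_product {0..})"
  by (auto simp: skorohod_paths_def space_PiM space_restrict_space)

lemma space_skorohod: "space skorohod = skorohod_paths"
  using skorohod_paths_subset by (auto simp: skorohod_def space_restrict_space)

lemma skorohod_coordinate_measurable:
  assumes "0 \<le> t"
  shows "(\<lambda>\<omega>. \<omega> t) \<in> skorohod \<rightarrow>\<^sub>M unit_borel"
  unfolding skorohod_def
  by (intro measurable_restrict_space1 measurable_component_singleton) (use assms in simp)

lemma skorohod_law_eqI: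
  assumes Q: "Q1 \<in> probs skorohod" "Q2 \<in> probs skorohod"
    and eq: "\<And>J B. finite J \<Longrightarrow> J \<subseteq> {0..} \<Longrightarrow> (\<And>j. j \<in> J \<Longrightarrow> B j \<in> sets unit_borel) \<Longrightarrow>
      (\<integral>\<^sup>+\<omega>. (\<Prod>j\<in>J. indicator (B j) (\<omega> j)) \<partial>Q1) = (\<integral>\<^sup>+\<omega>. (\<Prod>j\<in>J. indicator (B j) (\<omega> j)) \<partial>Q2)"
  shows "Q1 = Q2"
proof -
  let ?S = "unit_product {0..}"
  have id: "(\<lambda>\<omega>. \<omega>) \<in> Q \<rightarrow>\<^sub>M ?S" if "Q \<in> probs skorohod" for Q
    using measurable_restrict_space1[OF measurable_ident_sets[OF refl], of ?S skorohod_paths]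
    by (simp add: measurable_cong_sets[OF prob_algebraD(2)[OF that] refl] skorohod_def)
  have ind: "emeasure (distr Q ?S (\<lambda>\<omega>. \<omega>)) (prod_emb {0..} (\<lambda>_. unit_borel) J (Pi\<^sub>E J B)) =
      (\<integral>\<^sup>+\<omega>. (\<Prod>j\<in>J. indicator (B j) (\<omega> j)) \<partial>Q)"
    if Q: "Q \<in> probs skorohod" and J: "finite J" "J \<subseteq> {0..}" and B: "\<And>j. j \<in> J \<Longrightarrow> B j \<in> sets unit_borel"
    for Q J B
  proof -
    have emb: "prod_emb {0..} (\<lambda>_. unit_borel) J (Pi\<^sub>E J B) \<in> sets ?S"
      using J B by (intro measurable_prod_emb sets_PiM_I_finite) auto
    have "indicator (prod_emb {0..} (\<lambda>_. unit_borel) J (Pi\<^sub>E J B)) \<omega> = (\<Prod>j\<in>J. indicator (B j) (\<omega> j) :: ennreal)"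
      if \<omega>: "\<omega> \<in> space Q" for \<omega>
    proof -
      have "\<omega> \<in> space ?S" using \<omega> skorohod_paths_subset prob_algebraD(3)[OF Q] by (auto simp: space_skorohod)
      then have "\<omega> \<in> prod_emb {0..} (\<lambda>_. unit_borel) J (Pi\<^sub>E J B) \<longleftrightarrow> (\<forall>j\<in>J. \<omega> j \<in> B j)"
        using J by (auto simp: prod_emb_def space_PiM PiE_iff)
      then show ?thesis using J(1) by (auto simp: indicator_def prod_zero_iff)
    qed
    then have "(\<integral>\<^sup>+\<omega>. (\<Prod>j\<in>J. indicator (B j) (\<omega> j)) \<partial>Q) = (\<integral>\<^sup>+\<omega>. indicator (prod_emb {0..} (\<lambda>_. unit_borel) J (Pi\<^sub>E J B)) \<omega> \<partial>Q)"
      by (simp cong: nn_integral_cong)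
    also have "\<dots> = (\<integral>\<^sup>+\<omega>. indicator (prod_emb {0..} (\<lambda>_. unit_borel) J (Pi\<^sub>E J B)) \<omega> \<partial>distr Q ?S (\<lambda>\<omega>. \<omega>))"
      using emb by (intro nn_integral_distr[OF id[OF Q], symmetric]) simp
    finally show ?thesis using emb by simp
  qed
  have "distr Q1 ?S (\<lambda>\<omega>. \<omega>) = distr Q2 ?S (\<lambda>\<omega>. \<omega>)"
  proof (rule measure_eqI_PiM_infinite)
    show "finite_measure (distr Q1 ?S (\<lambda>\<omega>. \<omega>))"
      by (rule prob_space.finite_measure[OF prob_space.prob_space_distr[OF prob_algebraD(1)[OF Q(1)] id[OF Q(1)]]])
    fix B :: "real \<Rightarrow> real set" and J :: "real set"
    assume *: "finite J" "J \<subseteq> {0..}" "\<And>j. j \<in> J \<Longrightarrow> B j \<in> sets unit_borel"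
    show "emeasure (distr Q1 ?S (\<lambda>\<omega>. \<omega>)) (prod_emb {0..} (\<lambda>_. unit_borel) J (Pi\<^sub>E J B)) =
        emeasure (distr Q2 ?S (\<lambda>\<omega>. \<omega>)) (prod_emb {0..} (\<lambda>_. unit_borel) J (Pi\<^sub>E J B))"
      using ind[OF Q(1) *(1,2), of B] ind[OF Q(2) *(1,2), of B] eq[OF *(1,2), of B] *(3) by simp
  qed simp_all
  note deq = this
  show ?thesis
  proof (rule measure_eqI)
    show "sets Q1 = sets Q2" using Q by (simp add: prob_algebraD(2))
    fix A assume "A \<in> sets Q1"
    then have "A \<in> sets skorohod" using Q by (simp add: prob_algebraD(2))
    then obtain A' where A': "A' \<in> sets ?S" "A = A' \<inter> skorohod_paths"
      by (auto simp: skorohod_def sets_restrict_space)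
    have "emeasure Q A = emeasure (distr Q ?S (\<lambda>\<omega>. \<omega>)) A'" if "Q \<in> probs skorohod" for Q
      using A' prob_algebraD(3)[OF that]
      by (subst emeasure_distr[OF id[OF that] A'(1)]) (simp add: space_skorohod)
    then show "emeasure Q1 A = emeasure Q2 A" using Q deq by simp
  qed
qed

text \<open>The joint law of the positions at the times \<open>ts\<close>, given position \<open>x\<close> at time \<open>s\<close>. While \<open>fdd_int\<close> integrates product
  functions only, the law also gives the probability that two positions differ.\<close>
fun fdd_law :: "(real \<Rightarrow> real \<Rightarrow> real \<Rightarrow> real measure) \<Rightarrow> real list \<Rightarrow> real \<Rightarrow> real \<Rightarrow> (real \<Rightarrow> real) measure" where
  "fdd_law P [] s x = return (unit_product {}) (\<lambda>_. undefined)"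
| "fdd_law P (t # ts) s x =
     P s t x \<bind> (\<lambda>y. distr (fdd_law P ts t y) (Pi\<^sub>M (insert t (set ts)) (\<lambda>_. unit_borel)) (\<lambda>\<omega>. fun_upd \<omega> t y))"

lemma fun_upd_kernel_measurable:
  "K \<in> M \<rightarrow>\<^sub>M prob_algebra (Pi\<^sub>M I (\<lambda>_. M)) \<Longrightarrow>
    (\<lambda>y. distr (K y) (Pi\<^sub>M (insert t I) (\<lambda>_. M)) (\<lambda>\<omega>. fun_upd \<omega> t y)) \<in> M \<rightarrow>\<^sub>M prob_algebra (Pi\<^sub>M (insert t I) (\<lambda>_. M))"
proof (rule measurable_distr_prob_space2)
  show "(\<lambda>(y, \<omega>). fun_upd \<omega> t y) \<in> M \<Otimes>\<^sub>M Pi\<^sub>M I (\<lambda>_. M) \<rightarrow>\<^sub>M Pi\<^sub>M (insert t I) (\<lambda>_. M)"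
    using measurable_compose[OF measurable_pair_swap' measurable_add_dim[of t I "\<lambda>_. M"]] by (simp add: split_beta')
qed

lemma fdd_law_measurable:
  assumes P: "transition_family P"
  shows "0 \<le> s \<Longrightarrow> sorted (s # ts) \<Longrightarrow> fdd_law P ts s \<in> unit_borel \<rightarrow>\<^sub>M prob_algebra (unit_product (set ts))"
proof (induction ts arbitrary: s)
  case Nil
  show ?case
    by (simp add: fdd_law.simps(1)[abs_def] space_prob_algebra prob_space_return space_PiM)
next
  case (Cons t ts)
  have "P s t \<in> unit_borel \<rightarrow>\<^sub>M prob_algebra unit_borel" using transition_familyD(1)[OF P] Cons by auto
  moreover have "fdd_law P ts t \<in> unit_borel \<rightarrow>\<^sub>M prob_algebra (unit_product (set ts))" using Cons by auto
  ultimately show ?case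
    unfolding fdd_law.simps(2)[abs_def] list.set(2)
    by (rule measurable_bind_prob_space[OF _ fun_upd_kernel_measurable])
qed

lemma nn_integral_fdd_law_Cons:
  assumes P: "transition_family P" and s: "0 \<le> s" "sorted (s # t # ts)" and x: "x \<in> {0..1}"
    and g[measurable]: "g \<in> borel_measurable (Pi\<^sub>M (insert t (set ts)) (\<lambda>_. unit_borel))"
  shows "(\<integral>\<^sup>+\<omega>. g \<omega> \<partial>fdd_law P (t # ts) s x) = (\<integral>\<^sup>+y. (\<integral>\<^sup>+\<omega>. g (fun_upd \<omega> t y) \<partial>fdd_law P ts t y) \<partial>P s t x)"
proof -
  have st: "0 \<le> s" "s \<le> t" "0 \<le> t" "sorted (t # ts)" using s by auto
  note pr = transition_familyD(2)[OF P st(1,2) x]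
  note K = fdd_law_measurable[OF P st(3,4)]
  have "(\<integral>\<^sup>+\<omega>. g \<omega> \<partial>fdd_law P (t # ts) s x) =
      (\<integral>\<^sup>+y. (\<integral>\<^sup>+\<omega>. g \<omega> \<partial>distr (fdd_law P ts t y) (Pi\<^sub>M (insert t (set ts)) (\<lambda>_. unit_borel)) (\<lambda>\<omega>. fun_upd \<omega> t y)) \<partial>P s t x)"
    unfolding fdd_law.simps
    by (rule nn_integral_bind[OF g])
       (simp add: measurable_cong_sets[OF prob_algebraD(2)[OF pr] refl] measurable_prob_algebraD[OF fun_upd_kernel_measurable[OF K]])
  also have "\<dots> = (\<integral>\<^sup>+y. (\<integral>\<^sup>+\<omega>. g (fun_upd \<omega> t y) \<partial>fdd_law P ts t y) \<partial>P s t x)"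
  proof (rule nn_integral_prob_cong[OF pr])
    fix y :: real assume y: "y \<in> {0..1}"
    then have y': "y \<in> space unit_borel" by (simp add: space_restrict_space)
    have "(\<lambda>\<omega>. fun_upd \<omega> t y) \<in> unit_product (set ts) \<rightarrow>\<^sub>M Pi\<^sub>M (insert t (set ts)) (\<lambda>_. unit_borel)"
      using measurable_compose[OF measurable_Pair2'[OF y'] measurable_add_dim[of t "set ts" "\<lambda>_. unit_borel"]]
      by simp
    moreover have "sets (fdd_law P ts t y) = sets (unit_product (set ts))"
      by (rule prob_algebraD(2)[OF measurable_space[OF K y']])
    ultimately have "(\<lambda>\<omega>. fun_upd \<omega> t y) \<in> fdd_law P ts t y \<rightarrow>\<^sub>M Pi\<^sub>M (insert t (set ts)) (\<lambda>_. unit_borel)"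
      by (simp cong: measurable_cong_sets)
    from nn_integral_distr[OF this, of g] g
    show "(\<integral>\<^sup>+\<omega>. g \<omega> \<partial>distr (fdd_law P ts t y) (Pi\<^sub>M (insert t (set ts)) (\<lambda>_. unit_borel)) (\<lambda>\<omega>. fun_upd \<omega> t y)) = (\<integral>\<^sup>+\<omega>. g (fun_upd \<omega> t y) \<partial>fdd_law P ts t y)" by simp
  qed
  finally show ?thesis .
qed

lemma nn_integral_fdd_law:
  assumes P: "transition_family P"
  shows "0 \<le> s \<Longrightarrow> sorted (s # ts) \<Longrightarrow> distinct ts \<Longrightarrow> x \<in> {0..1} \<Longrightarrow> (\<And>j. j \<in> set ts \<Longrightarrow> f j \<in> borel_measurable unit_borel) \<Longrightarrow>
    (\<integral>\<^sup>+\<omega>. (\<Prod>j\<in>set ts. f j (\<omega> j)) \<partial>fdd_law P ts s x) = fdd_int P f ts s x"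
proof (induction ts arbitrary: s x)
  case Nil
  show ?case by (simp add: nn_integral_return space_PiM del: nn_integral_const)
next
  case (Cons t ts)
  have st: "0 \<le> s" "s \<le> t" "0 \<le> t" "sorted (t # ts)" using Cons.prems by auto
  note pr = transition_familyD(2)[OF P st(1,2) Cons.prems(4)]
  have pm: "(\<lambda>\<omega>. \<Prod>j\<in>J. f j (\<omega> j)) \<in> borel_measurable (unit_product J)" if "J \<subseteq> set (t # ts)" for J
    using that Cons.prems(5)
    by (intro borel_measurable_prod_ennreal measurable_compose[OF measurable_component_singleton]) auto
  have "(\<integral>\<^sup>+\<omega>. (\<Prod>j\<in>insert t (set ts). f j (\<omega> j)) \<partial>fdd_law P (t # ts) s x) =
     (\<integral>\<^sup>+y. (\<integral>\<^sup>+\<omega>. (\<Prod>j\<in>insert t (set ts). f j ((fun_upd \<omega> t y) j)) \<partial>fdd_law P ts t y) \<partial>P s t x)"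
    using Cons.prems by (intro nn_integral_fdd_law_Cons[OF P] pm) auto
  also have "\<dots> = (\<integral>\<^sup>+y. f t y * fdd_int P f ts t y \<partial>P s t x)"
  proof (rule nn_integral_prob_cong[OF pr])
    fix y :: real assume y: "y \<in> {0..1}"
    then have y': "y \<in> space unit_borel" by (simp add: space_restrict_space)
    have "(\<Prod>j\<in>insert t (set ts). f j ((fun_upd \<omega> t y) j)) = f t y * (\<Prod>j\<in>set ts. f j (\<omega> j))" for \<omega>
    proof -
      have "(\<Prod>j\<in>set ts. f j ((fun_upd \<omega> t y) j)) = (\<Prod>j\<in>set ts. f j (\<omega> j))"
        using Cons.prems(3) by (intro prod.cong) auto
      then show ?thesis using Cons.prems(3) by simp
    qed
    then have "(\<integral>\<^sup>+\<omega>. (\<Prod>j\<in>insert t (set ts). f j ((fun_upd \<omega> t y) j)) \<partial>fdd_law P ts t y) =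
        (\<integral>\<^sup>+\<omega>. f t y * (\<Prod>j\<in>set ts. f j (\<omega> j)) \<partial>fdd_law P ts t y)" by simp
    also have "\<dots> = f t y * (\<integral>\<^sup>+\<omega>. (\<Prod>j\<in>set ts. f j (\<omega> j)) \<partial>fdd_law P ts t y)"
      using pm[of "set ts"] prob_algebraD(2)[OF measurable_space[OF fdd_law_measurable[OF P st(3,4)] y']]
      by (intro nn_integral_cmult) (auto cong: measurable_cong_sets)
    also have "\<dots> = f t y * fdd_int P f ts t y"
      using Cons.prems st y by (subst Cons.IH) auto
    finally show "(\<integral>\<^sup>+\<omega>. (\<Prod>j\<in>insert t (set ts). f j ((fun_upd \<omega> t y) j)) \<partial>fdd_law P ts t y) = f t y * fdd_int P f ts t y" .
  qed
  finally show ?case by simp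
qed

text \<open>Kolmogorov's theorem is about Polish spaces, so the laws are moved from products of the unit interval to products of
  the real line.\<close>
definition fdd_marginal :: "(real \<Rightarrow> real \<Rightarrow> real \<Rightarrow> real measure) \<Rightarrow> real measure \<Rightarrow> real set \<Rightarrow> (real \<Rightarrow> real) measure" where
  "fdd_marginal P m0 J = distr (m0 \<bind> fdd_law P (sorted_list_of_set J) 0) (real_product J) (\<lambda>\<omega>. \<omega>)"

context
  fixes P m0
  assumes P: "transition_family P" and m0: "m0 \<in> probs unit_borel"
begin

lemma fdd_bind_in_prob_algebra:
  assumes J: "finite J" "J \<subseteq> {0..}"
  shows "m0 \<bind> fdd_law P (sorted_list_of_set J) 0 \<in> probs (unit_product J)"
  using bind_in_prob_algebra[OF m0 fdd_law_measurable[OF P order_refl], of "sorted_list_of_set J"] J by auto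

lemma PiM_unit_borel_id:
  "(\<lambda>\<omega>. \<omega>) \<in> unit_product J \<rightarrow>\<^sub>M real_product J"
proof (rule measurable_PiM_single')
  fix i assume "i \<in> J"
  from measurable_component_singleton[OF this, of "\<lambda>_. unit_borel"]
  show "(\<lambda>\<omega>. \<omega> i) \<in> unit_product J \<rightarrow>\<^sub>M borel"
    by (simp add: measurable_restrict_space2_iff)
qed (auto simp: space_PiM PiE_def)

lemma prob_space_fdd_marginal:
  assumes J: "finite J" "J \<subseteq> {0..}"
  shows "prob_space (fdd_marginal P m0 J)"
  unfolding fdd_marginal_def
  using prob_algebraD(1,2)[OF fdd_bind_in_prob_algebra[OF J]] PiM_unit_borel_id
  by (intro prob_space.prob_space_distr) (auto cong: measurable_cong_sets)

lemma nn_integral_fdd_marginal: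
  assumes J: "finite J" "J \<subseteq> {0..}" and g: "g \<in> borel_measurable (real_product J)"
  shows "(\<integral>\<^sup>+\<omega>. g \<omega> \<partial>fdd_marginal P m0 J) = (\<integral>\<^sup>+x. (\<integral>\<^sup>+\<omega>. g \<omega> \<partial>fdd_law P (sorted_list_of_set J) 0 x) \<partial>m0)"
proof -
  let ?K = "fdd_law P (sorted_list_of_set J) 0"
  have K: "?K \<in> unit_borel \<rightarrow>\<^sub>M prob_algebra (unit_product J)"
    using fdd_law_measurable[OF P order_refl, of "sorted_list_of_set J"] J by auto
  have g': "g \<in> borel_measurable (unit_product J)"
    using measurable_compose[OF PiM_unit_borel_id g] by simp
  have "(\<integral>\<^sup>+\<omega>. g \<omega> \<partial>fdd_marginal P m0 J) = (\<integral>\<^sup>+\<omega>. g \<omega> \<partial>(m0 \<bind> ?K))"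
    unfolding fdd_marginal_def
    using PiM_unit_borel_id prob_algebraD(2)[OF fdd_bind_in_prob_algebra[OF J]]
    by (intro nn_integral_distr) (auto simp: g cong: measurable_cong_sets)
  also have "\<dots> = (\<integral>\<^sup>+x. (\<integral>\<^sup>+\<omega>. g \<omega> \<partial>?K x) \<partial>m0)"
    using measurable_prob_algebraD[OF K] prob_algebraD(2)[OF m0]
    by (intro nn_integral_bind[OF g']) (auto cong: measurable_cong_sets)
  finally show ?thesis .
qed

lemma nn_integral_fdd_marginal_prod:
  assumes J: "finite J" "J \<subseteq> {0..}" and f: "\<And>j. j \<in> J \<Longrightarrow> f j \<in> borel_measurable borel"
  shows "(\<integral>\<^sup>+\<omega>. (\<Prod>j\<in>J. f j (\<omega> j)) \<partial>fdd_marginal P m0 J) = (\<integral>\<^sup>+x. fdd_int P f (sorted_list_of_set J) 0 x \<partial>m0)"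
proof -
  have "(\<lambda>\<omega>. \<Prod>j\<in>J. f j (\<omega> j)) \<in> borel_measurable (real_product J)"
    using f by (intro borel_measurable_prod_ennreal measurable_compose[OF measurable_component_singleton]) auto
  from nn_integral_fdd_marginal[OF J this]
  have "(\<integral>\<^sup>+\<omega>. (\<Prod>j\<in>J. f j (\<omega> j)) \<partial>fdd_marginal P m0 J) =
    (\<integral>\<^sup>+x. (\<integral>\<^sup>+\<omega>. (\<Prod>j\<in>set (sorted_list_of_set J). f j (\<omega> j)) \<partial>fdd_law P (sorted_list_of_set J) 0 x) \<partial>m0)"
    using J by simp
  also have "\<dots> = (\<integral>\<^sup>+x. fdd_int P f (sorted_list_of_set J) 0 x \<partial>m0)"
    by (intro nn_integral_prob_cong[OF m0] nn_integral_fdd_law[OF P])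
       (use J f in \<open>auto intro: measurable_restrict_space1\<close>)
  finally show ?thesis .
qed

lemma fdd_int_superset:
  assumes "finite H" "finite J" "J \<union> H \<subseteq> {0..}" "J \<inter> H = {}" and x: "x \<in> {0..1}"
    and "\<And>j. j \<in> J \<union> H \<Longrightarrow> f j \<in> borel_measurable unit_borel" "\<And>j y. j \<in> H \<Longrightarrow> y \<in> {0..1} \<Longrightarrow> f j y = 1"
  shows "fdd_int P f (sorted_list_of_set (J \<union> H)) 0 x = fdd_int P f (sorted_list_of_set J) 0 x"
  using assms(1,3,4,6,7)
proof (induction H rule: finite_induct)
  case (insert t H)
  have "sorted_list_of_set (J \<union> insert t H) = insort t (sorted_list_of_set (J \<union> H))"
    using insert assms(2) by (simp add: sorted_list_of_set_insert)
  moreover have "fdd_int P f (insort t (sorted_list_of_set (J \<union> H))) 0 x = fdd_int P f (sorted_list_of_set (J \<union> H)) 0 x"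
    by (rule fdd_int_insort[OF P]) (use insert assms(2) x in auto)
  moreover have "fdd_int P f (sorted_list_of_set (J \<union> H)) 0 x = fdd_int P f (sorted_list_of_set J) 0 x"
    using insert by auto
  ultimately show ?case by simp
qed simp

text \<open>On a rectangle over \<open>J\<close> this is \<open>fdd_int_superset\<close>, with the trivial test function at the times outside
  \<open>J\<close>.\<close>
lemma fdd_marginal_projective:
  assumes JH: "J \<subseteq> H" "finite H" "H \<subseteq> {0..}"
  shows "fdd_marginal P m0 J = distr (fdd_marginal P m0 H) (real_product J) (\<lambda>\<omega>. restrict \<omega> J)"
proof -
  have J: "finite J" "J \<subseteq> {0..}" using JH by (auto intro: finite_subset)
  have r: "(\<lambda>\<omega>. restrict \<omega> J) \<in> fdd_marginal P m0 H \<rightarrow>\<^sub>M real_product J"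
    unfolding fdd_marginal_def using measurable_restrict_subset[OF JH(1), of "\<lambda>_. borel"] by (simp cong: measurable_cong_sets)
  show ?thesis
  proof (rule measure_eqI_PiM_finite[OF J(1)])
    show "sets (fdd_marginal P m0 J) = sets (real_product J)" by (simp add: fdd_marginal_def)
    show "range (\<lambda>_::nat. space (real_product J)) \<subseteq> prod_algebra J (\<lambda>_. borel)"
      using prod_algebraI_finite[OF J(1), of "\<lambda>_. UNIV" "\<lambda>_. borel"] by (auto simp: space_PiM)
    show "emeasure (fdd_marginal P m0 J) (space (real_product J)) \<noteq> \<infinity>" for i :: nat
      using finite_measure.emeasure_finite[OF prob_space.finite_measure[OF prob_space_fdd_marginal[OF J]]] by simp
    fix B :: "real \<Rightarrow> real set" assume B: "\<And>i. i \<in> J \<Longrightarrow> B i \<in> sets borel"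
    then have PiB: "Pi\<^sub>E J B \<in> sets (real_product J)" using J by (intro sets_PiM_I_finite) auto
    define f :: "real \<Rightarrow> real \<Rightarrow> ennreal" where "f j = (if j \<in> J then indicator (B j) else (\<lambda>_. 1))" for j
    have fm: "f j \<in> borel_measurable borel" for j using B by (auto simp: f_def)
    have ind: "indicator (Pi\<^sub>E J B) (restrict \<omega> J) = (\<Prod>j\<in>J. f j (\<omega> j))" for \<omega>
    proof -
      have "(\<Prod>j\<in>J. f j (\<omega> j)) = (\<Prod>j\<in>J. indicator (B j) (\<omega> j))" by (intro prod.cong) (auto simp: f_def)
      moreover have "restrict \<omega> J \<in> Pi\<^sub>E J B \<longleftrightarrow> (\<forall>j\<in>J. \<omega> j \<in> B j)" by (auto simp: PiE_iff)
      ultimately show ?thesis using J(1) by (auto simp: indicator_def prod_zero_iff)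
    qed
    have "emeasure (fdd_marginal P m0 J) (Pi\<^sub>E J B) = (\<integral>\<^sup>+\<omega>. indicator (Pi\<^sub>E J B) \<omega> \<partial>fdd_marginal P m0 J)"
      using PiB by (simp add: fdd_marginal_def)
    also have "\<dots> = (\<integral>\<^sup>+\<omega>. (\<Prod>j\<in>J. f j (\<omega> j)) \<partial>fdd_marginal P m0 J)"
    proof (rule nn_integral_cong)
      fix \<omega> assume "\<omega> \<in> space (fdd_marginal P m0 J)"
      then have "\<omega> \<in> extensional J" by (simp add: fdd_marginal_def space_PiM PiE_def)
      then have "restrict \<omega> J = \<omega>" by (rule extensional_restrict)
      with ind[of \<omega>] show "indicator (Pi\<^sub>E J B) \<omega> = (\<Prod>j\<in>J. f j (\<omega> j))" by simp
    qed
    also have "\<dots> = (\<integral>\<^sup>+x. fdd_int P f (sorted_list_of_set J) 0 x \<partial>m0)"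
      by (rule nn_integral_fdd_marginal_prod[OF J fm])
    also have "\<dots> = (\<integral>\<^sup>+x. fdd_int P f (sorted_list_of_set H) 0 x \<partial>m0)"
    proof (rule nn_integral_prob_cong[OF m0])
      fix x :: real assume "x \<in> {0..1}"
      have "J \<union> (H - J) = H" using JH by auto
      moreover have "fdd_int P f (sorted_list_of_set (J \<union> (H - J))) 0 x = fdd_int P f (sorted_list_of_set J) 0 x"
      proof (rule fdd_int_superset)
        show "f j \<in> borel_measurable unit_borel" for j by (rule measurable_restrict_space1[OF fm])
        show "f j y = 1" if "j \<in> H - J" for j y using that by (simp add: f_def)
      qed (use JH J \<open>x \<in> {0..1}\<close> in auto)
      ultimately show "fdd_int P f (sorted_list_of_set J) 0 x = fdd_int P f (sorted_list_of_set H) 0 x" by simp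
    qed
    also have "\<dots> = (\<integral>\<^sup>+\<omega>. (\<Prod>j\<in>H. f j (\<omega> j)) \<partial>fdd_marginal P m0 H)"
      by (rule nn_integral_fdd_marginal_prod[OF JH(2,3) fm, symmetric])
    also have "\<dots> = (\<integral>\<^sup>+\<omega>. indicator (Pi\<^sub>E J B) (restrict \<omega> J) \<partial>fdd_marginal P m0 H)"
    proof (rule nn_integral_cong)
      fix \<omega>
      have "(\<Prod>j\<in>J. f j (\<omega> j)) = (\<Prod>j\<in>H. f j (\<omega> j))"
        by (rule prod.mono_neutral_left) (use JH in \<open>auto simp: f_def\<close>)
      then show "(\<Prod>j\<in>H. f j (\<omega> j)) = indicator (Pi\<^sub>E J B) (restrict \<omega> J)" by (simp add: ind)
    qed
    also have "\<dots> = (\<integral>\<^sup>+\<omega>. indicator (Pi\<^sub>E J B) \<omega> \<partial>distr (fdd_marginal P m0 H) (real_product J) (\<lambda>\<omega>. restrict \<omega> J))"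
      using PiB by (intro nn_integral_distr[OF r, symmetric]) simp
    finally show "emeasure (fdd_marginal P m0 J) (Pi\<^sub>E J B) = emeasure (distr (fdd_marginal P m0 H) (real_product J) (\<lambda>\<omega>. restrict \<omega> J)) (Pi\<^sub>E J B)"
      using PiB by simp
  qed auto
qed

lemma kolmogorov_extension:
  obtains L :: "(real \<Rightarrow> real) measure" where "prob_space L" "sets L = sets (real_product {0..})"
    "\<And>J g. finite J \<Longrightarrow> J \<subseteq> {0..} \<Longrightarrow> g \<in> borel_measurable (real_product J) \<Longrightarrow>
      (\<integral>\<^sup>+\<omega>. g (restrict \<omega> J) \<partial>L) = (\<integral>\<^sup>+x. (\<integral>\<^sup>+\<omega>. g \<omega> \<partial>fdd_law P (sorted_list_of_set J) 0 x) \<partial>m0)"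
proof -
  interpret polish_projective "{0..}" "fdd_marginal P m0"
    by (rule polish_projective.intro, rule projective_family.intro)
       (rule fdd_marginal_projective prob_space_fdd_marginal; assumption)+
  show thesis
  proof (rule that[of lim])
    show "prob_space lim" by (rule P.prob_space_axioms)
    show sets: "sets lim = sets (real_product {0..})" by (rule sets_lim)
    fix J and g :: "(real \<Rightarrow> real) \<Rightarrow> ennreal"
    assume J: "finite J" "J \<subseteq> {0..}" and g: "g \<in> borel_measurable (real_product J)"
    have r: "(\<lambda>\<omega>. restrict \<omega> J) \<in> lim \<rightarrow>\<^sub>M real_product J"
      using measurable_restrict_subset[OF J(2), of "\<lambda>_. borel"] by (simp cong: measurable_cong_sets add: sets)
    have "distr lim (real_product J) (\<lambda>\<omega>. restrict \<omega> J) = fdd_marginal P m0 J"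
    proof (rule measure_eqI)
      show "sets (distr lim (real_product J) (\<lambda>\<omega>. restrict \<omega> J)) = sets (fdd_marginal P m0 J)"
        by (simp add: fdd_marginal_def)
      fix A assume A: "A \<in> sets (distr lim (real_product J) (\<lambda>\<omega>. restrict \<omega> J))"
      then have "emeasure (distr lim (real_product J) (\<lambda>\<omega>. restrict \<omega> J)) A = emeasure lim (emb {0..} J A)"
        unfolding prod_emb_def using sets_eq_imp_space_eq[OF sets]
        by (subst emeasure_distr[OF r]) (simp_all add: space_PiM)
      also have "\<dots> = emeasure (fdd_marginal P m0 J) A" using A by (intro emeasure_lim_emb[OF J(2,1)]) simp
      finally show "emeasure (distr lim (real_product J) (\<lambda>\<omega>. restrict \<omega> J)) A = emeasure (fdd_marginal P m0 J) A" .
    qed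
    moreover have "(\<integral>\<^sup>+\<omega>. g \<omega> \<partial>distr lim (real_product J) (\<lambda>\<omega>. restrict \<omega> J)) = (\<integral>\<^sup>+\<omega>. g (restrict \<omega> J) \<partial>lim)"
      using g by (intro nn_integral_distr[OF r]) simp
    ultimately
    show "(\<integral>\<^sup>+\<omega>. g (restrict \<omega> J) \<partial>lim) = (\<integral>\<^sup>+x. (\<integral>\<^sup>+\<omega>. g \<omega> \<partial>fdd_law P (sorted_list_of_set J) 0 x) \<partial>m0)"
      using nn_integral_fdd_marginal[OF J g] by simp
  qed
qed

end

section \<open>Paths with finitely many jumps\<close>

lemma constant_skorohod_path: "c \<in> {0..1} \<Longrightarrow> restrict (\<lambda>_. c) {0..} \<in> skorohod_paths"
  unfolding skorohod_paths_def mem_Collect_eq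
proof (intro conjI allI impI)
  fix t :: real assume "0 \<le> t"
  then have "\<forall>\<^sub>F s in at_right t. restrict (\<lambda>_. c) {0..} s = restrict (\<lambda>_. c) {0..} t"
    unfolding eventually_at_right_field by (intro exI[of _ "t + 1"]) auto
  then show "(restrict (\<lambda>_. c) {0..} \<longlongrightarrow> restrict (\<lambda>_. c) {0..} t) (at_right t)" by (rule tendsto_eventually)
next
  fix t :: real assume "0 < t"
  then have "\<forall>\<^sub>F s in at_left t. restrict (\<lambda>_. c) {0..} s = c"
    unfolding eventually_at_left_field by (intro exI[of _ 0]) auto
  then show "\<exists>l. (restrict (\<lambda>_. c) {0..} \<longlongrightarrow> l) (at_left t)" by (intro exI[of _ c] tendsto_eventually)
qed auto

text \<open>The expected number of jumps is a sum of probabilities that two neighbouring grid values differ.\<close>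
lemma card_jumps_eq_sum:
  "(of_nat (card (jumps \<omega> n (real r))) :: ennreal) =
    (\<Sum>i<r * 2 ^ n. if \<omega> (real i / 2 ^ n) \<noteq> \<omega> (real (Suc i) / 2 ^ n) then 1 else 0)"
proof -
  have "real (Suc i) / 2 ^ n \<le> real r \<longleftrightarrow> i < r * 2 ^ n" for i
  proof -
    have "real (Suc i) / 2 ^ n \<le> real r \<longleftrightarrow> real (Suc i) \<le> real (r * 2 ^ n)"
      by (simp add: divide_le_eq)
    then show ?thesis by (simp only: of_nat_le_iff Suc_le_eq)
  qed
  then have "jumps \<omega> n (real r) = {i \<in> {..<r * 2 ^ n}. \<omega> (real i / 2 ^ n) \<noteq> \<omega> (real (Suc i) / 2 ^ n)}"
    by (auto simp: jumps_def)
  then show ?thesis by (simp add: sum.inter_filter[symmetric])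
qed

lemma neq_measurable_ennreal:
  fixes f g :: "'a \<Rightarrow> real"
  assumes [measurable]: "f \<in> borel_measurable M" "g \<in> borel_measurable M"
  shows "(\<lambda>x. if f x \<noteq> g x then 1 else 0 :: ennreal) \<in> borel_measurable M"
proof -
  have "{x \<in> space M. f x \<noteq> g x} \<in> sets M" by measurable
  then show ?thesis by (intro measurable_If) auto
qed

context
  fixes P m0
  assumes P: "transition_family P" and m0: "m0 \<in> probs unit_borel"
    and jump: "\<And>s t x. 0 \<le> s \<Longrightarrow> s \<le> t \<Longrightarrow> x \<in> {0..1} \<Longrightarrow> emeasure (P s t x) ({0..1} - {x}) \<le> ennreal (4 * (t - s))"
begin

lemma fdd_law_pair_jump:
  assumes st: "0 \<le> s" "s < t" and x: "x \<in> {0..1}"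
  shows "(\<integral>\<^sup>+\<omega>. (if \<omega> s \<noteq> \<omega> t then 1 else 0) \<partial>fdd_law P [s, t] 0 x) \<le> ennreal (4 * (t - s))"
proof -
  note cs = measurable_component_singleton[of _ _ "\<lambda>_. unit_borel", unfolded measurable_restrict_space2_iff, THEN conjunct1]
  have [measurable]: "(\<lambda>\<omega>. \<omega> s) \<in> borel_measurable (unit_product {s, t})"
    "(\<lambda>\<omega>. \<omega> t) \<in> borel_measurable (unit_product {s, t})" by (auto intro: cs)
  have [measurable]: "(\<lambda>\<omega>. \<omega> t) \<in> borel_measurable (unit_product {t})" by (auto intro: cs)
  have pr: "P 0 s x \<in> probs unit_borel" by (rule transition_familyD(2)[OF P]) (use st x in auto)
  let ?c = "ennreal (4 * (t - s))"
  have "(\<integral>\<^sup>+\<omega>. (if \<omega> s \<noteq> \<omega> t then 1 else 0) \<partial>fdd_law P [s, t] 0 x) =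
     (\<integral>\<^sup>+y. (\<integral>\<^sup>+\<omega>. (if (fun_upd \<omega> s y) s \<noteq> (fun_upd \<omega> s y) t then 1 else 0) \<partial>fdd_law P [t] s y) \<partial>P 0 s x)"
    by (rule nn_integral_fdd_law_Cons[OF P]) (use st x in \<open>auto intro!: neq_measurable_ennreal[simplified] cs\<close>)
  also have "\<dots> \<le> (\<integral>\<^sup>+y. ?c \<partial>P 0 s x)"
  proof (rule nn_integral_mono)
    fix y assume "y \<in> space (P 0 s x)"
    then have y: "y \<in> {0..1}" using prob_algebraD(3)[OF pr] by (simp add: space_restrict_space)
    have pr': "P s t y \<in> probs unit_borel" by (rule transition_familyD(2)[OF P]) (use st y in auto)
    have "(\<integral>\<^sup>+\<omega>. (if (fun_upd \<omega> s y) s \<noteq> (fun_upd \<omega> s y) t then 1 else 0) \<partial>fdd_law P [t] s y) =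
        (\<integral>\<^sup>+\<omega>. (if y \<noteq> \<omega> t then 1 else 0) \<partial>fdd_law P [t] s y)"
      using st by simp
    also have "\<dots> = (\<integral>\<^sup>+z. (\<integral>\<^sup>+\<omega>. (if y \<noteq> (fun_upd \<omega> t z) t then 1 else 0) \<partial>fdd_law P [] t z) \<partial>P s t y)"
      by (rule nn_integral_fdd_law_Cons[OF P]) (use st y in \<open>auto intro!: neq_measurable_ennreal[simplified] cs\<close>)
    also have "\<dots> = (\<integral>\<^sup>+z. (if y \<noteq> z then 1 else 0) \<partial>P s t y)"
      by (simp add: nn_integral_return space_PiM del: nn_integral_const)
    also have "\<dots> = (\<integral>\<^sup>+z. indicator ({0..1} - {y}) z \<partial>P s t y)"
      by (rule nn_integral_prob_cong[OF pr']) auto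
    also have "\<dots> = emeasure (P s t y) ({0..1} - {y})"
      by (rule nn_integral_indicator) (simp add: prob_algebraD(2)[OF pr'] sets_restrict_space_iff)
    also have "\<dots> \<le> ?c" by (rule jump) (use st y in auto)
    finally show "(\<integral>\<^sup>+\<omega>. (if (fun_upd \<omega> s y) s \<noteq> (fun_upd \<omega> s y) t then 1 else 0) \<partial>fdd_law P [t] s y) \<le> ?c" .
  qed
  also have "\<dots> = ?c" using prob_space.emeasure_space_1[OF prob_algebraD(1)[OF pr]] by simp
  finally show ?thesis .
qed

text \<open>Kolmogorov's extension has no path regularity. Since a jump between two times has probability at most
  four times their distance, the expected number of jumps along the grid of level \<open>n\<close> up to time \<open>r\<close> is
  at most \<open>4 r\<close>. It increases with \<open>n\<close>, so by monotone convergence almost every path is regular along the dyadic times.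
  Its right limits form a step path, and by the Borel-Cantelli lemma they are a version of
  the process, so that they have the same finite-dimensional distributions.\<close>
lemma exists_skorohod_law:
  "\<exists>Q \<in> probs skorohod. has_fdd Q (\<lambda>t \<omega>. \<omega> t) P m0"
proof -
  obtain L :: "(real \<Rightarrow> real) measure" where L: "prob_space L" and sets_L: "sets L = sets (real_product {0..})"
    and ext: "\<And>J g. finite J \<Longrightarrow> J \<subseteq> {0..} \<Longrightarrow> g \<in> borel_measurable (real_product J) \<Longrightarrow>
      (\<integral>\<^sup>+\<omega>. g (restrict \<omega> J) \<partial>L) = (\<integral>\<^sup>+x. (\<integral>\<^sup>+\<omega>. g \<omega> \<partial>fdd_law P (sorted_list_of_set J) 0 x) \<partial>m0)"
    by (rule kolmogorov_extension[OF P m0]) blast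
  interpret L: prob_space L by (rule L)
  have coord[measurable]: "(\<lambda>\<omega>. \<omega> t) \<in> borel_measurable L" if "0 \<le> t" for t
    using measurable_component_singleton[of t "{0..}" "\<lambda>_. borel"] that by (simp add: measurable_cong_sets[OF sets_L refl])
  have prod: "(\<integral>\<^sup>+\<omega>. (\<Prod>j\<in>J. f j (\<omega> j)) \<partial>L) = (\<integral>\<^sup>+x. fdd_int P f (sorted_list_of_set J) 0 x \<partial>m0)"
    if J: "finite J" "J \<subseteq> {0..}" and f: "\<And>j. j \<in> J \<Longrightarrow> f j \<in> borel_measurable borel" for J and f :: "real \<Rightarrow> real \<Rightarrow> ennreal"
  proof -
    have "(\<lambda>\<omega>. \<Prod>j\<in>J. f j (\<omega> j)) \<in> borel_measurable (real_product J)"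
      using f by (intro borel_measurable_prod_ennreal measurable_compose[OF measurable_component_singleton]) auto
    from ext[OF J this]
    have "(\<integral>\<^sup>+\<omega>. (\<Prod>j\<in>J. f j (\<omega> j)) \<partial>L) =
        (\<integral>\<^sup>+x. (\<integral>\<^sup>+\<omega>. (\<Prod>j\<in>set (sorted_list_of_set J). f j (\<omega> j)) \<partial>fdd_law P (sorted_list_of_set J) 0 x) \<partial>m0)"
      using J by simp
    also have "\<dots> = (\<integral>\<^sup>+x. fdd_int P f (sorted_list_of_set J) 0 x \<partial>m0)"
      by (intro nn_integral_prob_cong[OF m0] nn_integral_fdd_law[OF P])
         (use J f in \<open>auto intro: measurable_restrict_space1\<close>)
    finally show ?thesis .
  qed
  have in01: "AE \<omega> in L. \<omega> t \<in> {0..1}" if t: "0 \<le> t" for t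
  proof -
    have "(\<integral>\<^sup>+\<omega>. indicator (- {0..1}) (\<omega> t) \<partial>L) = (\<integral>\<^sup>+x. fdd_int P (\<lambda>_. indicator (- {0..1})) [t] 0 x \<partial>m0)"
      using prod[of "{t}" "\<lambda>_. indicator (- {0..1})"] t by simp
    also have "\<dots> = (\<integral>\<^sup>+x. 0 \<partial>m0)"
    proof (rule nn_integral_prob_cong[OF m0])
      fix x :: real assume x: "x \<in> {0..1}"
      have "fdd_int P (\<lambda>_. indicator (- {0..1})) [t] 0 x = (\<integral>\<^sup>+y. 0 \<partial>P 0 t x)"
        unfolding fdd_int.simps
        by (rule nn_integral_prob_cong[OF transition_familyD(2)[OF P order_refl t x]]) auto
      then show "fdd_int P (\<lambda>_. indicator (- {0..1})) [t] 0 x = 0" by simp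
    qed
    finally have "(\<integral>\<^sup>+\<omega>. indicator (- {0..1}) (\<omega> t) \<partial>L) = 0" by simp
    then have "AE \<omega> in L. indicator (- {0..1}) (\<omega> t) = (0::ennreal)"
      using t by (subst (asm) nn_integral_0_iff_AE) auto
    then show ?thesis by eventually_elim (auto simp: indicator_def split: if_splits)
  qed
  have pair: "(\<integral>\<^sup>+\<omega>. (if \<omega> s \<noteq> \<omega> t then 1 else 0) \<partial>L) \<le> ennreal (4 * (t - s))" if st: "0 \<le> s" "s < t" for s t
  proof -
    have [measurable]: "(\<lambda>\<omega>. \<omega> s) \<in> borel_measurable (real_product {s, t})"
      "(\<lambda>\<omega>. \<omega> t) \<in> borel_measurable (real_product {s, t})" by (auto intro: measurable_component_singleton)
    have "(\<lambda>\<omega>. if \<omega> s \<noteq> \<omega> t then 1 else 0 :: ennreal) \<in> borel_measurable (real_product {s, t})"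
      by (rule neq_measurable_ennreal) measurable
    from ext[OF _ _ this]
    have "(\<integral>\<^sup>+\<omega>. (if \<omega> s \<noteq> \<omega> t then 1 else 0) \<partial>L) =
        (\<integral>\<^sup>+x. (\<integral>\<^sup>+\<omega>. (if \<omega> s \<noteq> \<omega> t then 1 else 0) \<partial>fdd_law P [s, t] 0 x) \<partial>m0)"
      using st by simp
    also have "\<dots> \<le> (\<integral>\<^sup>+x. ennreal (4 * (t - s)) \<partial>m0)"
      using prob_algebraD(3)[OF m0] st by (intro nn_integral_mono fdd_law_pair_jump) (auto simp: space_restrict_space)
    also have "\<dots> = ennreal (4 * (t - s))" using prob_space.emeasure_space_1[OF prob_algebraD(1)[OF m0]] by simp
    finally show ?thesis .
  qed
  have finite_jumps: "AE \<omega> in L. \<exists>C. \<forall>n. card (jumps \<omega> n (real r)) \<le> C" for r :: nat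
  proof -
    let ?V = "\<lambda>n \<omega>. of_nat (card (jumps \<omega> n (real r))) :: ennreal"
    have V[measurable]: "?V n \<in> borel_measurable L" for n
      unfolding card_jumps_eq_sum
      by (intro borel_measurable_sum neq_measurable_ennreal coord) auto
    have "(\<integral>\<^sup>+\<omega>. ?V n \<omega> \<partial>L) \<le> ennreal (4 * real r)" for n
    proof -
      have "(\<integral>\<^sup>+\<omega>. ?V n \<omega> \<partial>L) = (\<Sum>i<r * 2 ^ n. \<integral>\<^sup>+\<omega>. (if \<omega> (real i / 2 ^ n) \<noteq> \<omega> (real (Suc i) / 2 ^ n) then 1 else 0) \<partial>L)"
        unfolding card_jumps_eq_sum
        by (intro nn_integral_sum neq_measurable_ennreal coord) auto
      also have "\<dots> \<le> (\<Sum>i<r * 2 ^ n. ennreal (4 * (1 / 2 ^ n)))"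
      proof (rule sum_mono)
        fix i
        have "real (Suc i) / 2 ^ n - real i / 2 ^ n = 1 / 2 ^ n" by (simp add: field_simps)
        moreover have "real i / 2 ^ n < real (Suc i) / 2 ^ n" by (intro divide_strict_right_mono) auto
        ultimately show "(\<integral>\<^sup>+\<omega>. (if \<omega> (real i / 2 ^ n) \<noteq> \<omega> (real (Suc i) / 2 ^ n) then 1 else 0) \<partial>L) \<le> ennreal (4 * (1 / 2 ^ n))"
          using pair[of "real i / 2 ^ n" "real (Suc i) / 2 ^ n"] by simp
      qed
      also have "\<dots> = ennreal (4 * real r)"
        by (simp add: ennreal_of_nat_eq_real_of_nat ennreal_mult[symmetric] field_simps)
      finally show ?thesis .
    qed
    then have "(SUP n. \<integral>\<^sup>+\<omega>. ?V n \<omega> \<partial>L) \<le> ennreal (4 * real r)" by (intro SUP_least)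
    moreover have "(\<integral>\<^sup>+\<omega>. (SUP n. ?V n \<omega>) \<partial>L) = (SUP n. \<integral>\<^sup>+\<omega>. ?V n \<omega> \<partial>L)"
      by (intro nn_integral_monotone_convergence_SUP V)
         (auto simp: incseq_Suc_iff le_fun_def card_jumps_refine)
    ultimately have "(\<integral>\<^sup>+\<omega>. (SUP n. ?V n \<omega>) \<partial>L) < \<infinity>"
      using le_less_trans[OF _ ennreal_less_top[of "4 * real r"]] by simp
    then have "(\<integral>\<^sup>+\<omega>. (SUP n. ?V n \<omega>) \<partial>L) \<noteq> \<infinity>" by (rule less_imp_neq)
    then have "AE \<omega> in L. (SUP n. ?V n \<omega>) \<noteq> \<infinity>" by (intro nn_integral_PInf_AE) measurable
    then show ?thesis
    proof eventually_elim
      case (elim \<omega>)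
      then have "(SUP n. ?V n \<omega>) < top" by (simp only: less_top infinity_ennreal_def not_False_eq_True)
      from ennreal_Ex_less_of_nat[OF this] obtain C where C: "(SUP n. ?V n \<omega>) < of_nat C" by blast
      have "card (jumps \<omega> n (real r)) \<le> C" for n
      proof -
        have "?V n \<omega> < of_nat C" using C by (rule le_less_trans[OF SUP_upper[OF UNIV_I]])
        then show ?thesis by (simp add: less_imp_le)
      qed
      then show ?case by blast
    qed
  qed
  have "AE \<omega> in L. regular_path \<omega>"
  proof -
    have "countable dyadic"
    proof -
      have "dyadic = (\<lambda>(i, n). real i / 2 ^ n) ` (UNIV :: (nat \<times> nat) set)" by (auto simp: dyadic_def)
      then show ?thesis using countable_image[OF countableI_type] by metis
    qed
    then have "AE \<omega> in L. \<forall>d\<in>dyadic. \<omega> d \<in> {0..1}"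
      using in01[OF dyadic_nonneg] by (subst AE_ball_countable) blast+
    moreover have "AE \<omega> in L. \<forall>r::nat. \<exists>C. \<forall>n. card (jumps \<omega> n (real r)) \<le> C"
      using finite_jumps by (subst AE_all_countable) blast
    ultimately show ?thesis unfolding regular_path_def by eventually_elim blast
  qed
  then obtain N where N: "{\<omega> \<in> space L. \<not> regular_path \<omega>} \<subseteq> N" "N \<in> null_sets L"
    by (auto elim!: AE_E simp: null_sets_def)
  then have N_meas[measurable]: "N \<in> sets L" by auto
  \<comment> \<open>On the exceptional null set any path in the Skorohod space will do.\<close>
  define Y where "Y t \<omega> = (if \<omega> \<in> N then 0 else right_limit \<omega> t)" for t \<omega>
  have path: "restrict (\<lambda>t. Y t \<omega>) {0..} \<in> skorohod_paths" if "\<omega> \<in> space L" for \<omega>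
    using that N(1) constant_skorohod_path[of 0] right_limit_skorohod[of \<omega>]
    by (cases "\<omega> \<in> N") (auto simp: Y_def)
  have Y01: "Y t \<omega> \<in> {0..1}" if "\<omega> \<in> space L" "0 \<le> t" for t \<omega>
    using path[OF that(1)] that(2) unfolding skorohod_paths_def by (auto simp: restrict_PiE_iff)
  have Y_borel: "Y t \<in> borel_measurable L" if t: "0 \<le> t" for t
  proof -
    have [measurable]: "(\<lambda>\<omega>. \<omega> (next_grid n t)) \<in> borel_measurable L" for n
      by (rule coord[OF dyadic_nonneg[OF next_grid_dyadic[OF t]]])
    have "(\<lambda>\<omega>. right_limit \<omega> t) \<in> borel_measurable L" unfolding right_limit_def by measurable
    then show ?thesis unfolding Y_def[abs_def] by measurable
  qed
  have Y[measurable]: "Y t \<in> L \<rightarrow>\<^sub>M unit_borel" if t: "0 \<le> t" for t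
    using Y_borel[OF t] Y01[OF _ t] by (intro measurable_restrict_space2) auto
  have Y_eq: "AE \<omega> in L. Y t \<omega> = \<omega> t" if t: "0 \<le> t" for t
  proof -
    let ?A = "\<lambda>n. {\<omega> \<in> space L. \<omega> t \<noteq> \<omega> (next_grid n t)}"
    have ng: "0 \<le> next_grid n t" for n by (rule dyadic_nonneg[OF next_grid_dyadic[OF t]])
    have A: "?A n \<in> sets L" for n
      by (rule borel_measurable_neq[OF coord[OF t] coord[OF ng]])
    have bound: "emeasure L (?A n) \<le> ennreal (4 * (1 / 2) ^ n)" for n
    proof -
      have "emeasure L (?A n) = (\<integral>\<^sup>+\<omega>. (if \<omega> t \<noteq> \<omega> (next_grid n t) then 1 else 0) \<partial>L)"
        by (subst nn_integral_indicator[OF A, symmetric]) (auto intro!: nn_integral_cong split: split_indicator)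
      also have "\<dots> \<le> ennreal (4 * (next_grid n t - t))" by (rule pair[OF t next_grid_gt])
      also have "\<dots> \<le> ennreal (4 * (1 / 2) ^ n)"
        using next_grid_le[of n t] by (intro ennreal_leI) (simp add: power_divide)
      finally show ?thesis .
    qed
    have "AE \<omega> in L. \<forall>\<^sub>F n in sequentially. \<omega> \<in> space L - ?A n"
    proof (rule borel_cantelli_AE1[OF A])
      show "emeasure L (?A n) < \<infinity>" for n by (simp add: less_top[symmetric])
      have "summable (\<lambda>n. 4 * (1 / 2) ^ n :: real)" by (intro summable_mult summable_geometric) auto
      then show "summable (\<lambda>n. measure L (?A n))"
      proof (rule summable_comparison_test')
        show "norm (measure L (?A n)) \<le> 4 * (1 / 2) ^ n" for n
          using bound[of n] by (simp add: L.emeasure_eq_measure)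
      qed
    qed
    moreover have "AE \<omega> in L. \<omega> \<notin> N" using N(2) by (rule AE_not_in)
    ultimately show ?thesis using AE_space
    proof eventually_elim
      case (elim \<omega>)
      then have "regular_path \<omega>" using N(1) by auto
      from right_limit_eventually[OF this t] elim(1)
      have "\<forall>\<^sub>F n in sequentially. right_limit \<omega> t = \<omega> t"
        by eventually_elim (use elim in auto)
      then show ?case using elim(2) by (simp add: Y_def)
    qed
  qed
  define \<Phi> where "\<Phi> \<omega> = restrict (\<lambda>t. Y t \<omega>) {0..}" for \<omega>
  have \<Phi>: "\<Phi> \<in> L \<rightarrow>\<^sub>M skorohod"
    unfolding skorohod_def \<Phi>_def[abs_def]
    by (intro measurable_restrict_space2 measurable_restrict Y) (use path in auto)
  show ?thesis
  proof
    show "distr L skorohod \<Phi> \<in> probs skorohod"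
      using L.prob_space_distr[OF \<Phi>] by (simp add: space_prob_algebra)
    show "has_fdd (distr L skorohod \<Phi>) (\<lambda>t \<omega>. \<omega> t) P m0"
      unfolding has_fdd_def
    proof (intro allI impI)
      fix J and f :: "real \<Rightarrow> real \<Rightarrow> ennreal"
      assume J: "finite J" "J \<subseteq> {0..}" and f: "\<forall>j\<in>J. f j \<in> borel_measurable unit_borel"
      \<comment> \<open>The coordinates under \<open>L\<close> are real valued and lie in the unit interval only almost surely.\<close>
      define f' where "f' j x = (if x \<in> {0..1} then f j x else 0)" for j x
      have f': "f' j \<in> borel_measurable borel" if "j \<in> J" for j
      proof -
        have "(\<lambda>x. f j x * indicator {0..1} x) \<in> borel_measurable borel"
          using f that by (subst (asm) borel_measurable_restrict_space_iff_ennreal) auto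
        moreover have "f' j = (\<lambda>x. f j x * indicator {0..1} x)" by (auto simp: f'_def fun_eq_iff indicator_def)
        ultimately show ?thesis by simp
      qed
      have "(\<integral>\<^sup>+\<omega>. (\<Prod>j\<in>J. f j (\<omega> j)) \<partial>distr L skorohod \<Phi>) = (\<integral>\<^sup>+\<omega>. (\<Prod>j\<in>J. f j (\<Phi> \<omega> j)) \<partial>L)"
        using J f by (intro nn_integral_distr[OF \<Phi>])
          (auto intro!: borel_measurable_prod_ennreal measurable_compose[OF skorohod_coordinate_measurable])
      also have "\<dots> = (\<integral>\<^sup>+\<omega>. (\<Prod>j\<in>J. f' j (\<omega> j)) \<partial>L)"
      proof (rule nn_integral_cong_AE)
        have "AE \<omega> in L. \<forall>j\<in>J. Y j \<omega> = \<omega> j"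
          by (subst AE_finite_all[OF J(1)]) (use J Y_eq in auto)
        then show "AE \<omega> in L. (\<Prod>j\<in>J. f j (\<Phi> \<omega> j)) = (\<Prod>j\<in>J. f' j (\<omega> j))"
          using AE_space
        proof eventually_elim
          case (elim \<omega>)
          show ?case
          proof (rule prod.cong[OF refl])
            fix j assume "j \<in> J"
            with elim J Y01[OF elim(2), of j] show "f j (\<Phi> \<omega> j) = f' j (\<omega> j)" by (auto simp: \<Phi>_def f'_def)
          qed
        qed
      qed
      also have "\<dots> = (\<integral>\<^sup>+x. fdd_int P f' (sorted_list_of_set J) 0 x \<partial>m0)" by (rule prod[OF J f'])
      also have "\<dots> = (\<integral>\<^sup>+x. fdd_int P f (sorted_list_of_set J) 0 x \<partial>m0)"
        by (intro nn_integral_prob_cong[OF m0] fdd_int_cong[OF P refl]) (use J in \<open>auto simp: f'_def\<close>)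
      finally show "(\<integral>\<^sup>+\<omega>. (\<Prod>j\<in>J. f j (\<omega> j)) \<partial>distr L skorohod \<Phi>) = (\<integral>\<^sup>+x. fdd_int P f (sorted_list_of_set J) 0 x \<partial>m0)" .
    qed
  qed
qed

end

section \<open>The law of the nonlinear Markov process\<close>

context
  fixes \<Delta> w :: real and m0 :: "real measure"
  assumes w: "0 < w" "w < 1" and m0: "m0 \<in> probs unit_borel"
begin

interpretation collision unit_borel "collide \<Delta> w"
  using w by (rule collision_collide)

text \<open>The kernels of the Markov process in the definition are not given, but the generator determines them. Hence
  every law with this generator has the same finite-dimensional distributions.\<close>
lemma markov_law_fdd:
  assumes Q: "markov_law (\<lambda>t. gen \<Delta> w (evol m0 t m0)) m0 Q"
    and J: "finite J" "J \<subseteq> {0..}" and B: "\<And>j. j \<in> J \<Longrightarrow> B j \<in> sets unit_borel"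
  shows "(\<integral>\<^sup>+\<omega>. (\<Prod>j\<in>J. indicator (B j) (\<omega> j)) \<partial>Q) =
    (\<integral>\<^sup>+x. fdd_int (transition m0) (\<lambda>t. indicator (B t)) (sorted_list_of_set J) 0 x \<partial>m0)"
proof -
  obtain P where P: "markov_process Q (\<lambda>t \<omega>. \<omega> t) P" "has_generator P (\<lambda>t. gen \<Delta> w (evol m0 t m0))"
    and init: "distr Q unit_borel (\<lambda>\<omega>. \<omega> 0) = m0"
    using Q by (auto simp: markov_law_def)
  have tf: "transition_family P" using P(1) by (simp add: markov_process_def)
  have "P s t x = transition m0 s t x" if "0 \<le> s" "s \<le> t" "x \<in> {0..1}" for s t x
    by (rule generator_determines_transitions[OF transition_family_transition[OF w m0] has_generator_transition[OF w m0] tf P(2)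
        gen_bdd_meas[OF w flow_in_prob_algebra[OF m0]] transition_lipschitz_bdd[OF w m0] that])
  then have "(\<integral>\<^sup>+x. fdd_int P (\<lambda>t. indicator (B t)) (sorted_list_of_set J) 0 x \<partial>m0) =
      (\<integral>\<^sup>+x. fdd_int (transition m0) (\<lambda>t. indicator (B t)) (sorted_list_of_set J) 0 x \<partial>m0)"
    using J by (intro nn_integral_prob_cong[OF m0] fdd_int_cong[OF transition_family_transition[OF w m0]]) auto
  with markov_process_fdd[OF P(1) init J B] show ?thesis by simp
qed

text \<open>The path construction applies to \<open>transition m0\<close>: the probability of a jump is bounded by applying \<open>transition_close_return\<close> to the indicator of the complement of
  the starting point.\<close>
lemma exists_markov_law: "\<exists>Q. markov_law (\<lambda>t. gen \<Delta> w (evol m0 t m0)) m0 Q"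
proof -
  note tf = transition_family_transition[OF w m0]
  have "emeasure (transition m0 s t x) ({0..1} - {x}) \<le> ennreal (4 * (t - s))"
    if st: "0 \<le> s" "s \<le> t" and x: "x \<in> {0..1}" for s t x
  proof -
    have xs: "x \<in> space unit_borel" using x by (simp add: space_restrict_space)
    have A: "{0..1} - {x} \<in> sets unit_borel" by (simp add: sets_restrict_space_iff)
    have "indicator ({0..1} - {x}) \<in> bounded_meas unit_borel 1" using A by (auto simp: bounded_meas_def indicator_def)
    with transition_close_return[OF m0 st(2) xs]
    have "\<bar>(\<integral>y. indicator ({0..1} - {x}) y \<partial>transition m0 s t x) - (\<integral>y. indicator ({0..1} - {x}) y \<partial>return unit_borel x)\<bar> \<le> 4 * (t - s)"
      by (auto simp: tv_close_def)
    moreover have "(\<integral>y. indicator ({0..1} - {x}) y \<partial>return unit_borel x) = (0::real)"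
      using xs A by (subst integral_return) auto
    ultimately have "measure (transition m0 s t x) ({0..1} - {x}) \<le> 4 * (t - s)"
      using prob_algebraD(3)[OF transition_in_prob_algebra[OF m0 xs, of s t]]
      by (simp add: space_restrict_space Int_absorb2)
    then show ?thesis using st
      by (simp add: finite_measure.emeasure_eq_measure[OF prob_space.finite_measure[OF prob_algebraD(1)[OF transition_in_prob_algebra[OF m0 xs]]]])
  qed
  from exists_skorohod_law[OF tf m0 this]
  obtain Q where Q: "Q \<in> probs skorohod" and fdd: "has_fdd Q (\<lambda>t \<omega>. \<omega> t) (transition m0) m0" by blast
  have X: "(\<lambda>\<omega>. \<omega> t) \<in> Q \<rightarrow>\<^sub>M unit_borel" if "0 \<le> t" for t
    using skorohod_coordinate_measurable[OF that] by (simp add: measurable_cong_sets[OF prob_algebraD(2)[OF Q] refl])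
  have mp: "markov_process Q (\<lambda>t \<omega>. \<omega> t) (transition m0)"
    by (rule has_fdd_imp_markov_process[OF prob_algebraD(1)[OF Q] X tf fdd])
  have "distr Q unit_borel (\<lambda>\<omega>. \<omega> 0) = m0"
  proof (rule measure_eqI)
    show "sets (distr Q unit_borel (\<lambda>\<omega>. \<omega> 0)) = sets m0" using prob_algebraD(2)[OF m0] by simp
    fix C assume "C \<in> sets (distr Q unit_borel (\<lambda>\<omega>. \<omega> 0))"
    then have C: "C \<in> sets unit_borel" by simp
    have "emeasure (distr Q unit_borel (\<lambda>\<omega>. \<omega> 0)) C = (\<integral>\<^sup>+x. indicator C x \<partial>distr Q unit_borel (\<lambda>\<omega>. \<omega> 0))"
      using C by simp
    also have "\<dots> = (\<integral>\<^sup>+\<omega>. indicator C (\<omega> 0) \<partial>Q)"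
      using C by (intro nn_integral_distr[OF X]) auto
    also have "\<dots> = (\<integral>\<^sup>+\<omega>. (\<Prod>j\<in>{0::real}. indicator C (\<omega> j)) \<partial>Q)" by simp
    also have "\<dots> = (\<integral>\<^sup>+x. fdd_int (transition m0) (\<lambda>_. indicator C) (sorted_list_of_set {0}) 0 x \<partial>m0)"
      by (rule fdd[unfolded has_fdd_def, rule_format, of "{0}" "\<lambda>_. indicator C"]) (use C in auto)
    also have "\<dots> = (\<integral>\<^sup>+x. indicator C x \<partial>m0)"
    proof (rule nn_integral_prob_cong[OF m0])
      fix x :: real assume "x \<in> {0..1}"
      then have "x \<in> space unit_borel" by (simp add: space_restrict_space)
      then show "fdd_int (transition m0) (\<lambda>_. indicator C) (sorted_list_of_set {0}) 0 x = indicator C x"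
        using C by (simp add: transition_self[OF m0])
    qed
    also have "\<dots> = emeasure m0 C" using C prob_algebraD(2)[OF m0] by simp
    finally show "emeasure (distr Q unit_borel (\<lambda>\<omega>. \<omega> 0)) C = emeasure m0 C" .
  qed
  with Q mp has_generator_transition[OF w m0] show ?thesis unfolding markov_law_def by blast
qed

lemma markov_law_marginal:
  assumes Q: "markov_law (\<lambda>t. gen \<Delta> w (evol m0 t m0)) m0 Q" and t: "0 \<le> t"
  shows "distr Q unit_borel (\<lambda>\<omega>. \<omega> t) = evol m0 t m0"
proof (rule measure_eqI)
  have pr: "evol m0 t m0 \<in> probs unit_borel" by (rule flow_in_prob_algebra[OF m0])
  have Q': "Q \<in> probs skorohod" using Q by (simp add: markov_law_def)
  have X: "(\<lambda>\<omega>. \<omega> t) \<in> Q \<rightarrow>\<^sub>M unit_borel"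
    using skorohod_coordinate_measurable[OF t] by (simp add: measurable_cong_sets[OF prob_algebraD(2)[OF Q'] refl])
  show "sets (distr Q unit_borel (\<lambda>\<omega>. \<omega> t)) = sets (evol m0 t m0)" using prob_algebraD(2)[OF pr] by simp
  fix C assume "C \<in> sets (distr Q unit_borel (\<lambda>\<omega>. \<omega> t))"
  then have C: "C \<in> sets unit_borel" by simp
  have "emeasure (distr Q unit_borel (\<lambda>\<omega>. \<omega> t)) C = (\<integral>\<^sup>+x. indicator C x \<partial>distr Q unit_borel (\<lambda>\<omega>. \<omega> t))"
    using C by simp
  also have "\<dots> = (\<integral>\<^sup>+\<omega>. indicator C (\<omega> t) \<partial>Q)"
    using C by (intro nn_integral_distr[OF X]) auto
  also have "\<dots> = (\<integral>\<^sup>+\<omega>. (\<Prod>j\<in>{t}. indicator C (\<omega> j)) \<partial>Q)" by simp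
  also have "\<dots> = (\<integral>\<^sup>+x. fdd_int (transition m0) (\<lambda>_. indicator C) (sorted_list_of_set {t}) 0 x \<partial>m0)"
    using t C by (intro markov_law_fdd[OF Q]) auto
  also have "\<dots> = (\<integral>\<^sup>+x. emeasure (transition m0 0 t x) C \<partial>m0)"
  proof (rule nn_integral_prob_cong[OF m0])
    fix x :: real assume "x \<in> {0..1}"
    then have "x \<in> space unit_borel" by (simp add: space_restrict_space)
    from prob_algebraD(2)[OF transition_in_prob_algebra[OF m0 this]]
    show "fdd_int (transition m0) (\<lambda>_. indicator C) (sorted_list_of_set {t}) 0 x = emeasure (transition m0 0 t x) C"
      using C by simp
  qed
  also have "\<dots> = emeasure (m0 \<bind> transition m0 0 t) C"
    by (rule emeasure_bind_prob_algebra[OF m0 transition_measurable[OF m0] C, symmetric])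
  finally show "emeasure (distr Q unit_borel (\<lambda>\<omega>. \<omega> t)) C = emeasure (evol m0 t m0) C"
    by (simp add: bind_transition_0[OF m0 t])
qed

end

theorem theorem4p1:
  fixes \<Delta> w :: real and m0 :: "real measure"
  assumes "0 < \<Delta>" "\<Delta> \<le> 1" "0 < w" "w < 1"
    and "m0 \<in> space (prob_algebra unit_borel)"
  shows "\<exists>m. problem1 \<Delta> w m0 m \<and>
    (\<forall>m'. problem1 \<Delta> w m0 m' \<longrightarrow> (\<forall>t\<ge>0. m' t = m t)) \<and>
    (\<forall>t\<ge>0. ((\<lambda>s. tv_dist (m s) (m t)) \<longlongrightarrow> 0) (at t within {0..})) \<and>
    (\<forall>T\<ge>0. \<forall>\<epsilon>>0. \<exists>\<delta>>0. \<forall>m0' m'.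
       m0' \<in> space (prob_algebra unit_borel) \<and> tv_dist m0' m0 < \<delta> \<and> problem1 \<Delta> w m0' m' \<longrightarrow>
         (\<forall>t\<in>{0..T}. tv_dist (m' t) (m t) < \<epsilon>)) \<and>
    (\<exists>!Q. markov_law (\<lambda>t. gen \<Delta> w (m t)) m0 Q) \<and>
    (\<forall>Q. markov_law (\<lambda>t. gen \<Delta> w (m t)) m0 Q \<longrightarrow>
       (\<forall>t\<ge>0. distr Q unit_borel (\<lambda>\<omega>. \<omega> t) = m t))"
proof -
  note w = assms(3,4) and m0 = assms(5)
  interpret collision unit_borel "collide \<Delta> w" using w by (rule collision_collide)
  show ?thesis
  proof (intro exI[of _ "\<lambda>t. evol m0 t m0"] conjI allI impI)
    show "problem1 \<Delta> w m0 (\<lambda>t. evol m0 t m0)" by (rule problem1_evol[OF w m0])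
    show "problem1 \<Delta> w m0 m' \<Longrightarrow> 0 \<le> t \<Longrightarrow> m' t = evol m0 t m0" for m' t by (rule problem1_unique[OF w m0])
    show "0 \<le> t \<Longrightarrow> ((\<lambda>s. tv_dist (evol m0 s m0) (evol m0 t m0)) \<longlongrightarrow> 0) (at t within {0..})" for t
      by (rule problem1_tv_continuous[OF w m0])
    show "markov_law (\<lambda>t. gen \<Delta> w (evol m0 t m0)) m0 Q \<Longrightarrow> 0 \<le> t \<Longrightarrow> distr Q unit_borel (\<lambda>\<omega>. \<omega> t) = evol m0 t m0" for Q t
      by (rule markov_law_marginal[OF w m0])
    have "Q = Q'" if "markov_law (\<lambda>t. gen \<Delta> w (evol m0 t m0)) m0 Q" "markov_law (\<lambda>t. gen \<Delta> w (evol m0 t m0)) m0 Q'" for Q Q'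
      by (rule skorohod_law_eqI) (use that markov_law_fdd[OF w m0 that(1)] markov_law_fdd[OF w m0 that(2)] in \<open>auto simp: markov_law_def\<close>)
    with exists_markov_law[OF w m0] show "\<exists>!Q. markov_law (\<lambda>t. gen \<Delta> w (evol m0 t m0)) m0 Q" by blast
  next
    fix T \<epsilon> :: real assume T: "0 \<le> T" and \<epsilon>: "0 < \<epsilon>"
    \<comment> \<open>Chosen to make the stability bound \<open>2 \<delta> exp (12 T)\<close> equal to \<open>\<epsilon>\<close>.\<close>
    define \<delta> where "\<delta> = \<epsilon> / (2 * exp (12 * T))"
    have \<delta>: "0 < \<delta>" using \<epsilon> by (simp add: \<delta>_def)
    show "\<exists>\<delta>>0. \<forall>m0' m'. m0' \<in> probs unit_borel \<and> tv_dist m0' m0 < \<delta> \<and> problem1 \<Delta> w m0' m' \<longrightarrow>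
           (\<forall>t\<in>{0..T}. tv_dist (m' t) (evol m0 t m0) < \<epsilon>)"
    proof (intro exI[of _ \<delta>] conjI \<delta> allI impI ballI)
      fix m0' m' t assume h: "m0' \<in> probs unit_borel \<and> tv_dist m0' m0 < \<delta> \<and> problem1 \<Delta> w m0' m'"
        and t: "t \<in> {0..T}"
      have "0 \<le> tv_dist m0' m0" using h m0 by (intro tv_close_nonneg[OF tv_close_tv_dist]) auto
      have "tv_dist (m' t) (evol m0 t m0) \<le> 2 * tv_dist m0' m0 * exp (12 * t)"
        using h t by (intro problem1_stability[OF w m0]) auto
      also have "\<dots> \<le> 2 * tv_dist m0' m0 * exp (12 * T)"
        using t \<open>0 \<le> tv_dist m0' m0\<close> by (intro mult_left_mono) auto
      also have "\<dots> < 2 * \<delta> * exp (12 * T)" using h by simp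
      also have "\<dots> = \<epsilon>" by (simp add: \<delta>_def)
      finally show "tv_dist (m' t) (evol m0 t m0) < \<epsilon>" .
    qed
  qed
qed

end
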